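(* Let $n,m,k_1,k_2$ be positive integers in the large dimensional proportional regime $$\alpha=\lim_{n\to\infty}\frac{m}{n},\qquad \beta_1=\lim_{n\to\infty}\frac{k_1}{n},\qquad \beta_2=\lim_{n\to\infty}\frac{k_2}{n},$$ and let each element of $\mathbf{h}\in\mathbb{R}^m$ and $\mathbf{g}\in\mathbb{R}^n$ be a standard normal random variable independent of any other randomness. Set $$L=\frac{1}{\sqrt{k_1k_2}}\max_{\mathbf{x}\in\mathcal{S}_{\mathbf{x}},\,\mathbf{y}\in\mathcal{S}_{\mathbf{y}}}\left(\mathbf{h}^T\mathbf{y}+\mathbf{g}^T\mathbf{x}\right)$$ and $$L^{(2)}=\frac{1}{\sqrt{k_1k_2}}\ \min_{c_3>0}\left(-\frac{c_3}{2}+\frac{1}{c_3}\log\left(\mathbb{E}\,e^{c_3\max_{\mathbf{y}\in\mathcal{S}_{\mathbf{y}}}\left(\mathbf{h}^T\mathbf{y}\right)}\right)+\frac{1}{c_3}\log\left(\mathbb{E}\,e^{c_3\max_{\mathbf{x}\in\mathcal{S}_{\mathbf{x}}}\left(\mathbf{g}^T\mathbf{x}\right)}\right)\right).$$ For $A\in\mathbb{R}^{m\times n}$ comprised of independent standard normal entries and $\xi$ its largest average $k_1\times k_2$ submatrix value, one has $$\lim_{n\to\infty}\mathbb{E}\,\xi\sqrt{n}\ \le\ \lim_{n\to\infty}\mathbb{E}\,L^{(2)}\sqrt{n}\ \le\ \lim_{n\to\infty}\mathbb{E}\,L\sqrt{n},$$ with the middle term being the (so-called) lifted random dual.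
   Context: For $A\in\mathbb{R}^{m\times n}$, the largest average $k_1\times k_2$ submatrix value is $$\xi=\frac{1}{k_1k_2}\max_{\substack{I_1\subset\{1,\dots,m\},\ |I_1|=k_1\\ I_2\subset\{1,\dots,n\},\ |I_2|=k_2}}\ \sum_{i\in I_1,\,j\in I_2}A_{ij}=\frac{1}{\sqrt{k_1k_2}}\max_{\mathbf{x}\in\mathcal{S}_{\mathbf{x}},\,\mathbf{y}\in\mathcal{S}_{\mathbf{y}}}\mathbf{y}^TA\mathbf{x},$$ where $\mathcal{S}_{\mathbf{x}}=\{\mathbf{x}\in\mathbb{R}^n:\ \mathbf{x}_i\in\{0,1/\sqrt{k_2}\}\text{ for all }i,\ \sum_{i=1}^n\mathbf{x}_i=\sqrt{k_2}\}$ and $\mathcal{S}_{\mathbf{y}}=\{\mathbf{y}\in\mathbb{R}^m:\ \mathbf{y}_i\in\{0,1/\sqrt{k_1}\}\text{ for all }i,\ \sum_{i=1}^m\mathbf{y}_i=\sqrt{k_1}\}$. *)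

theory Defs
  imports "HOL-Probability.Probability"
begin

definition largest_avg_submatrix ::
    "nat \<Rightarrow> nat \<Rightarrow> nat \<Rightarrow> nat \<Rightarrow> (nat \<Rightarrow> nat \<Rightarrow> real) \<Rightarrow> real" where
  "largest_avg_submatrix m n k1 k2 A =
     1 / (real k1 * real k2) *
     Max ((\<lambda>(I1, I2). \<Sum>i\<in>I1. \<Sum>j\<in>I2. A i j) `
       ({I1. I1 \<subseteq> {..<m} \<and> card I1 = k1} \<times> {I2. I2 \<subseteq> {..<n} \<and> card I2 = k2}))"

(* Vectors in R^d are extensional functions on {..<d}, so this set is finite. The sets S_x and S_y
   are selector_vecs n k2 and selector_vecs m k1. *)
definition selector_vecs :: "nat \<Rightarrow> nat \<Rightarrow> (nat \<Rightarrow> real) set" where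
  "selector_vecs d k =
     {x \<in> {..<d} \<rightarrow>\<^sub>E {0, 1 / sqrt (real k)}. (\<Sum>i<d. x i) = sqrt (real k)}"

definition max_selector :: "nat \<Rightarrow> nat \<Rightarrow> (nat \<Rightarrow> real) \<Rightarrow> real" where
  "max_selector d k v = Max ((\<lambda>x. \<Sum>i<d. v i * x i) ` selector_vecs d k)"

definition random_dual ::
    "nat \<Rightarrow> nat \<Rightarrow> nat \<Rightarrow> nat \<Rightarrow> (nat \<Rightarrow> real) \<Rightarrow> (nat \<Rightarrow> real) \<Rightarrow> real" where
  "random_dual m n k1 k2 h g =
     1 / sqrt (real k1 * real k2) *
     Max ((\<lambda>(x, y). (\<Sum>i<m. h i * y i) + (\<Sum>j<n. g j * x j)) `
       (selector_vecs n k2 \<times> selector_vecs m k1))"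

(* The minimum over c > 0 is an infimum: for k1 = m and k2 = n the objective is c / 2, so no
   minimiser exists. For positive k1 \<le> m and k2 \<le> n the objective is bounded below: any fixed
   x, y in the selector sets have norm 1, so each term (1/c) ln E exp (...) is at least c / 2. *)
definition lifted_random_dual ::
    "'a measure \<Rightarrow> nat \<Rightarrow> nat \<Rightarrow> nat \<Rightarrow> nat \<Rightarrow>
     (nat \<Rightarrow> 'a \<Rightarrow> real) \<Rightarrow> (nat \<Rightarrow> 'a \<Rightarrow> real) \<Rightarrow> real" where
  "lifted_random_dual M m n k1 k2 h g =
     1 / sqrt (real k1 * real k2) *
     (INF c\<in>{0<..}.
        - c / 2
        + 1 / c * ln (LINT \<omega>|M. exp (c * max_selector m k1 (\<lambda>i. h i \<omega>)))
        + 1 / c * ln (LINT \<omega>|M. exp (c * max_selector n k2 (\<lambda>j. g j \<omega>))))"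

lemma selector_vecs_eq:
  assumes "k > 0"
  shows "selector_vecs d k =
    (\<lambda>I. restrict (\<lambda>i. if i \<in> I then 1 / sqrt (real k) else 0) {..<d}) ` {I. I \<subseteq> {..<d} \<and> card I = k}"
    (is "_ = ?f ` ?S")
proof (intro set_eqI iffI)
  fix x assume x: "x \<in> selector_vecs d k"
  define I where "I = {i\<in>{..<d}. x i \<noteq> 0}"
  have Id: "I \<subseteq> {..<d}" by (auto simp: I_def)
  have P: "x \<in> {..<d} \<rightarrow>\<^sub>E {0, 1 / sqrt (real k)}" and s: "(\<Sum>i<d. x i) = sqrt (real k)"
    using x by (auto simp: selector_vecs_def)
  have xI: "x i = (if i \<in> I then 1 / sqrt (real k) else 0)" if "i < d" for i
    using PiE_mem[OF P, of i] that by (auto simp: I_def)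
  have "(\<Sum>i<d. x i) = (\<Sum>i<d. if i \<in> I then 1 / sqrt (real k) else 0)"
    by (intro sum.cong) (auto simp: xI)
  also have "\<dots> = (\<Sum>i\<in>I. 1 / sqrt (real k))"
    using Id by (subst sum.inter_restrict[symmetric]) (auto simp: Int_absorb1)
  finally have "real (card I) / sqrt (real k) = sqrt (real k)" using s by simp
  then have "real (card I) = real k" using assms by (simp add: divide_eq_eq)
  then have "I \<in> ?S" by (auto simp: I_def)
  moreover have "x = ?f I"
    using PiE_arb[OF P] by (intro ext) (auto simp: restrict_def xI)
  ultimately show "x \<in> ?f ` ?S" by blast
next
  fix x assume "x \<in> ?f ` ?S"
  then obtain I where I: "I \<subseteq> {..<d}" "card I = k" and x: "x = ?f I" by auto
  have "(\<Sum>i<d. x i) = (\<Sum>i<d. if i \<in> I then 1 / sqrt (real k) else 0)"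
    by (simp add: x)
  also have "\<dots> = (\<Sum>i\<in>I. 1 / sqrt (real k))"
    using I by (subst sum.inter_restrict[symmetric]) (auto simp: Int_absorb1)
  also have "\<dots> = sqrt (real k)" using I assms by (simp add: real_div_sqrt)
  finally show "x \<in> selector_vecs d k" by (auto simp: selector_vecs_def x)
qed

lemma largest_avg_submatrix_eq:
  assumes "0 < k1" "k1 \<le> m" "0 < k2" "k2 \<le> n"
  shows "largest_avg_submatrix m n k1 k2 A =
    1 / sqrt (real k1 * real k2) *
    Max ((\<lambda>(x, y). \<Sum>i<m. \<Sum>j<n. y i * A i j * x j) ` (selector_vecs n k2 \<times> selector_vecs m k1))"
proof -
  define S where "S d k = {I::nat set. I \<subseteq> {..<d} \<and> card I = k}" for d k :: nat
  define f where
    "f d k I = restrict (\<lambda>i. if i \<in> I then 1 / sqrt (real k) else 0) {..<d}"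
    for d k :: nat and I
  define c where "c = 1 / sqrt (real k1 * real k2)"
  define F where "F = (\<lambda>(I1, I2). \<Sum>i\<in>I1. \<Sum>j\<in>I2. A i j)"
  have c: "c > 0" using assms by (simp add: c_def)
  have fin: "finite (S d k)" for d k by (simp add: S_def)
  have "{..<k1} \<in> S m k1" "{..<k2} \<in> S n k2" using assms by (auto simp: S_def)
  then have ne: "S m k1 \<times> S n k2 \<noteq> {}" by blast
  have sv: "selector_vecs d k = f d k ` S d k" if "k > 0" for d k
    using selector_vecs_eq[OF that] by (simp add: S_def f_def)
  have sum_f: "(\<Sum>i<d. f d k I i * v i) = 1 / sqrt (real k) * (\<Sum>i\<in>I. v i)"
    if "I \<in> S d k" for d k I and v :: "nat \<Rightarrow> real"
  proof -
    have "(\<Sum>i<d. f d k I i * v i) = (\<Sum>i<d. if i \<in> I then 1 / sqrt (real k) * v i else 0)"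
      by (intro sum.cong) (auto simp: f_def)
    also have "\<dots> = (\<Sum>i\<in>I. 1 / sqrt (real k) * v i)"
      using that by (subst sum.inter_restrict[symmetric]) (auto simp: S_def Int_absorb1)
    finally show ?thesis by (simp add: sum_distrib_left)
  qed
  have val: "(\<Sum>i<m. \<Sum>j<n. f m k1 I1 i * A i j * f n k2 I2 j) = c * F (I1, I2)"
    if "I1 \<in> S m k1" "I2 \<in> S n k2" for I1 I2
  proof -
    have "(\<Sum>i<m. \<Sum>j<n. f m k1 I1 i * A i j * f n k2 I2 j) =
        (\<Sum>i<m. f m k1 I1 i * (\<Sum>j<n. f n k2 I2 j * A i j))"
      by (simp add: sum_distrib_left mult_ac)
    also have "\<dots> = 1 / sqrt (real k1) * (\<Sum>i\<in>I1. 1 / sqrt (real k2) * (\<Sum>j\<in>I2. A i j))"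
      by (simp only: sum_f[OF that(1)] sum_f[OF that(2)])
    also have "\<dots> = c * F (I1, I2)"
      by (simp add: c_def F_def sum_distrib_left[symmetric] sum_divide_distrib[symmetric] real_sqrt_mult)
    finally show ?thesis .
  qed
  have "(\<lambda>(x, y). \<Sum>i<m. \<Sum>j<n. y i * A i j * x j) ` (selector_vecs n k2 \<times> selector_vecs m k1)
      = (\<lambda>t. c * t) ` F ` (S m k1 \<times> S n k2)"
  proof -
    have "selector_vecs n k2 \<times> selector_vecs m k1
        = (\<lambda>(I1, I2). (f n k2 I2, f m k1 I1)) ` (S m k1 \<times> S n k2)"
      using assms by (auto simp: sv)
    then show ?thesis by (auto simp: image_image val intro!: image_cong)
  qed
  also have "Max \<dots> = c * Max (F ` (S m k1 \<times> S n k2))"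
    using ne c fin by (intro mono_Max_commute[symmetric]) (auto intro!: monoI)
  finally show ?thesis
    using assms
    by (simp add: largest_avg_submatrix_def S_def[symmetric] F_def[symmetric] c_def[symmetric])
       (simp add: c_def)
qed

end

theory Submission
  imports Defs
begin

text \<open>
  For unit vectors the process \<open>y\<^sup>T A x + g'\<close>, with an extra standard normal \<open>g'\<close>, has the same variances
  as \<open>h\<^sup>T y + g\<^sup>T x\<close> and larger covariances, the difference being
  \<open>(1 - \<langle>x, x'\<rangle>) (1 - \<langle>y, y'\<rangle>)\<close>. Slepian's comparison for \<open>exp (c max)\<close>, proved by Lindeberg
  replacement, and Jensen's inequality bound the expected maximum of \<open>y\<^sup>T A x\<close> by the objective of the
  lifted dual for every \<open>c\<close>; the term \<open>- c / 2\<close> comes from \<open>E exp (c g') = exp (c\<^sup>2 / 2)\<close>. Letting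
  \<open>c\<close> tend to \<open>0\<close> in the objective gives the plain dual.

  For the limits, \<open>max h\<^sup>T y\<close> is \<open>1 / \<surd>k\<close> times the sum of the \<open>k\<close> largest of \<open>d\<close> standard normals.
  Its mean and its cumulant generating function are nonnegative and superadditive in \<open>(d, k)\<close>, so that a
  two-parameter Fekete argument gives convergence after division by \<open>d\<close>. With \<open>c = s \<surd>n\<close> the
  objective is \<open>- s / 2\<close> plus a function increasing in \<open>s\<close>, which makes the infimum converge too.
\<close>

section \<open>Products of standard normal measures\<close>

text \<open>The maximum is not differentiable, so the comparison is run for \<open>softmax\<close>,
  the power c / b of an exponential sum with parameter b. Its second-order response to a Gaussian
  increment weighs covariances by -c (b - c): for c < b a larger covariance lowers the expectation,
  the direction required for exp (c max), and b -> infinity recovers the maximum. Exchanging one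
  small independent increment at a time needs only a third-order Taylor bound and the stability of
  normal laws; no derivative is taken under an integral.

  Two obstacles shape the limits. Filling by blocks breaks down when k / d tends to 1, because the
  unchosen positions d - k then have no positive proportion; that case is settled by explicit
  two-sided bounds. Moreover, the cumulant generating functions are evaluated at arguments such as s
  sqrt (n / k1), which move with n. Convexity makes their pointwise limit continuous, and
  monotonicity absorbs the movement.\<close>

definition stdn :: "real measure" where
  "stdn = density lborel std_normal_density"

abbreviation gauss :: "'i set \<Rightarrow> ('i \<Rightarrow> real) measure" where
  "gauss I \<equiv> PiM I (\<lambda>_. stdn)"

lemma sets_stdn [simp, measurable_cong]: "sets stdn = sets borel"
  by (simp add: stdn_def)

lemma space_stdn [simp]: "space stdn = UNIV"
  by (simp add: stdn_def)

lemma prob_space_stdn: "prob_space stdn"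
  unfolding stdn_def by (rule prob_space_normal_density) simp

interpretation stdn: prob_space stdn
  by (rule prob_space_stdn)

lemma prob_space_gauss: "prob_space (gauss I)"
  by (intro prob_space_PiM prob_space_stdn)

lemma sets_gauss: "sets (gauss I) = sets (PiM I (\<lambda>_. borel))"
  by (intro sets_PiM_cong) auto

interpretation gauss: product_prob_space "\<lambda>_. stdn" UNIV
  by standard

lemma gauss_law:
  assumes "prob_space M" and ind: "prob_space.indep_vars M (\<lambda>_. borel) X I"
    and N: "\<And>i. i \<in> I \<Longrightarrow> distributed M lborel (X i) std_normal_density"
  shows "distr M (gauss I) (\<lambda>\<omega>. \<lambda>i\<in>I. X i \<omega>) = gauss I"
proof -
  interpret prob_space M by fact
  have rv: "random_variable borel (X i)" if "i \<in> I" for i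
    using distributed_measurable[OF N[OF that]] by simp
  have d: "distr M borel (X i) = stdn" if "i \<in> I" for i
    using distributed_distr_eq_density[OF N[OF that]] unfolding stdn_def
    by (metis distr_cong sets_lborel)
  show ?thesis
  proof (cases "I = {}")
    \<comment> \<open>Over the empty index set both measures are the point mass at the only
      extensional function; the product characterization of independence used in the other case is
      for nonempty index sets.\<close>
    case True
    interpret D: prob_space "distr M (gauss I) (\<lambda>\<omega>. \<lambda>i\<in>I. X i \<omega>)"
      by (rule prob_space_distr) (auto intro!: measurable_restrict simp: True)
    show ?thesis unfolding True
      apply (rule measure_eqI)
       apply simp
      subgoal for A
        using D.emeasure_space_1 by (auto simp: True sets_PiM_empty space_PiM_empty)
      done
  next
    case False
    have "distr M (gauss I) (\<lambda>\<omega>. \<lambda>i\<in>I. X i \<omega>) = distr M (PiM I (\<lambda>_. borel)) (\<lambda>\<omega>. \<lambda>i\<in>I. X i \<omega>)"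
      by (rule distr_cong) (auto simp: sets_gauss)
    also have "\<dots> = PiM I (\<lambda>i. distr M borel (X i))"
      using ind indep_vars_iff_distr_eq_PiM'[OF False rv] by simp
    also have "\<dots> = gauss I"
      by (intro PiM_cong) (auto simp: d)
    finally show ?thesis .
  qed
qed

text \<open>The matrix and the two vectors are blocks of one independent family; this moves each
  block to its own coordinate space, \<open>f\<close> being the embedding of its indices.\<close>

lemma gauss_law_inj:
  assumes "prob_space M" and ind: "prob_space.indep_vars M (\<lambda>_. borel) X K"
    and N: "\<And>i. i \<in> K \<Longrightarrow> distributed M lborel (X i) std_normal_density"
    and f: "inj_on f I" "f \<in> I \<rightarrow> K"
  shows "distr M (gauss I) (\<lambda>\<omega>. \<lambda>i\<in>I. X (f i) \<omega>) = gauss I"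
    "(\<lambda>\<omega>. \<lambda>i\<in>I. X (f i) \<omega>) \<in> measurable M (gauss I)"
proof -
  interpret prob_space M by fact
  have rv: "random_variable borel (X i)" if "i \<in> K" for i
    using distributed_measurable[OF N[OF that]] by simp
  have m: "(\<lambda>\<omega>. \<lambda>i\<in>K. X i \<omega>) \<in> measurable M (gauss K)"
    by (intro measurable_restrict) (use rv in auto)
  have m2: "(\<lambda>w. \<lambda>i\<in>I. w (f i)) \<in> measurable (gauss K) (gauss I)"
    using f by (intro measurable_restrict measurable_component_singleton) auto
  have "distr (gauss K) (gauss I) (\<lambda>w. \<lambda>i\<in>I. w (f i)) = gauss I"
    using distr_PiM_reindex[of K "\<lambda>_. stdn" f I] prob_space_stdn f by auto
  then have "distr (distr M (gauss K) (\<lambda>\<omega>. \<lambda>i\<in>K. X i \<omega>)) (gauss I) (\<lambda>w. \<lambda>i\<in>I. w (f i)) = gauss I"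
    using gauss_law[OF assms(1-3)] by simp
  then have "distr M (gauss I) ((\<lambda>w. \<lambda>i\<in>I. w (f i)) \<circ> (\<lambda>\<omega>. \<lambda>i\<in>K. X i \<omega>)) = gauss I"
    using distr_distr[OF m2 m] by simp
  also have "(\<lambda>w. \<lambda>i\<in>I. w (f i)) \<circ> (\<lambda>\<omega>. \<lambda>i\<in>K. X i \<omega>) = (\<lambda>\<omega>. \<lambda>i\<in>I. X (f i) \<omega>)"
    using f by (auto simp: fun_eq_iff Pi_iff)
  finally show "distr M (gauss I) (\<lambda>\<omega>. \<lambda>i\<in>I. X (f i) \<omega>) = gauss I" .
  show "(\<lambda>\<omega>. \<lambda>i\<in>I. X (f i) \<omega>) \<in> measurable M (gauss I)"
    by (intro measurable_restrict) (use rv f in \<open>auto simp: measurable_cong_sets[OF refl sets_stdn]\<close>)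
qed

lemma gauss_reindex:
  assumes f: "inj_on f I" "f \<in> I \<rightarrow> K"
  shows "distr (gauss K) (gauss I) (\<lambda>w. \<lambda>i\<in>I. w (f i)) = gauss I"
    "(\<lambda>w. \<lambda>i\<in>I. w (f i)) \<in> measurable (gauss K) (gauss I)"
proof -
  show "distr (gauss K) (gauss I) (\<lambda>w. \<lambda>i\<in>I. w (f i)) = gauss I"
    using distr_PiM_reindex[of K "\<lambda>_. stdn" f I] prob_space_stdn f by auto
  show "(\<lambda>w. \<lambda>i\<in>I. w (f i)) \<in> measurable (gauss K) (gauss I)"
    using f by (intro measurable_restrict measurable_component_singleton) auto
qed

lemma gauss_component:
  assumes "i \<in> I"
  shows "distr (gauss I) stdn (\<lambda>w. w i) = stdn"
proof -
  have "distr (gauss I) ((\<lambda>_. stdn) i) (\<lambda>w. w i) = (\<lambda>_. stdn) i"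
    by (rule distr_PiM_component) (use assms prob_space_stdn in auto)
  then show ?thesis by simp
qed

lemma gauss_indep:
  "prob_space.indep_vars (gauss I) (\<lambda>_. borel) (\<lambda>i w. w i) I"
proof (cases "I = {}")
  case True
  interpret prob_space "gauss I" by (rule prob_space_gauss)
  show ?thesis unfolding indep_vars_def indep_sets_def using True by auto
next
  case False
  interpret prob_space "gauss I" by (rule prob_space_gauss)
  have m: "random_variable borel (\<lambda>w. w i)" if "i \<in> I" for i
    using that by measurable
  have "distr (gauss I) (PiM I (\<lambda>_. borel)) (\<lambda>w. \<lambda>i\<in>I. w i) = distr (gauss I) (gauss I) (\<lambda>w. w)"
    by (intro distr_cong) (auto simp: sets_gauss space_PiM PiE_def extensional_restrict)
  also have "\<dots> = gauss I" by (rule distr_id)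
  also have "\<dots> = PiM I (\<lambda>i. distr (gauss I) borel (\<lambda>w. w i))"
  proof (intro PiM_cong refl)
    fix i assume "i \<in> I"
    then have "distr (gauss I) stdn (\<lambda>w. w i) = stdn" by (rule gauss_component)
    then show "stdn = distr (gauss I) borel (\<lambda>w. w i)"
      by (metis distr_cong sets_stdn)
  qed
  finally show ?thesis using indep_vars_iff_distr_eq_PiM'[OF False m] by simp
qed

lemma gauss_distributed:
  assumes "i \<in> I"
  shows "distributed (gauss I) lborel (\<lambda>w. w i) std_normal_density"
proof -
  have "distr (gauss I) lborel (\<lambda>w. w i) = distr (gauss I) stdn (\<lambda>w. w i)"
    by (intro distr_cong) auto
  also have "\<dots> = density lborel std_normal_density"
    using gauss_component[OF assms] by (simp add: stdn_def)
  finally show ?thesis using assms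
    by (auto simp: distributed_def)
qed

text \<open>Two independent copies are realised as one Gaussian family over the disjoint sum of
  \<open>I\<close> with itself. There the combinations (s w i + t v i) / r are standard normal, and
  they are independent because they use disjoint pairs of coordinates. Nonnegative extended
  integrals avoid integrability conditions on \<open>f\<close>.\<close>

lemma gauss_stable:
  assumes I: "finite I" and st: "s\<^sup>2 + t\<^sup>2 = r\<^sup>2" "s > 0" "t > 0" "r > 0"
    and f: "f \<in> borel_measurable (gauss I)"
  shows "(\<integral>\<^sup>+w. f (\<lambda>i\<in>I. r * w i) \<partial>gauss I)
    = (\<integral>\<^sup>+w. \<integral>\<^sup>+v. f (\<lambda>i\<in>I. s * w i + t * v i) \<partial>gauss I \<partial>gauss I)"
proof -
  let ?L = "Inl ` I :: ('a + 'a) set" and ?R = "Inr ` I :: ('a + 'a) set"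
  let ?K = "?L \<union> ?R"
  interpret K: prob_space "gauss ?K" by (rule prob_space_gauss)
  interpret PP: pair_sigma_finite "gauss I" "gauss I"
    by (intro pair_sigma_finite.intro prob_space_imp_sigma_finite prob_space_gauss)
  define X where "X i w = (s * w (Inl i) + t * w (Inr i)) / r" for i and w :: "'a + 'a \<Rightarrow> real"
  have "K.indep_vars (\<lambda>j. PiM {Inl j, Inr j} (\<lambda>_. borel))
      (\<lambda>j \<omega>. restrict (\<lambda>i. \<omega> i) {Inl j, Inr j}) I"
    by (rule K.indep_vars_restrict[OF gauss_indep]) (auto simp: disjoint_family_on_def)
  then have "K.indep_vars (\<lambda>_. borel)
      (\<lambda>j \<omega>. (\<lambda>u. (s * u (Inl j) + t * u (Inr j)) / r) (restrict (\<lambda>i. \<omega> i) {Inl j, Inr j})) I"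
    by (rule K.indep_vars_compose2) measurable
  then have ind: "K.indep_vars (\<lambda>_. borel) X I"
    by (rule K.indep_vars_cong[THEN iffD1, rotated -1]) (auto simp: X_def fun_eq_iff)
  define c where "c = case_sum (\<lambda>_::'a. s / r) (\<lambda>_::'a. t / r)"
  have N: "distributed (gauss ?K) lborel (X i) std_normal_density" if i: "i \<in> I" for i
  proof -
    have "K.indep_vars (\<lambda>_. borel) (\<lambda>i w. w i) {Inl i, Inr i}"
      by (rule K.indep_vars_subset[OF gauss_indep]) (use i in auto)
    then have "K.indep_vars (\<lambda>_. borel) (\<lambda>l w. (\<lambda>x. c l * x) (w l)) {Inl i, Inr i}"
      by (rule K.indep_vars_compose2) auto
    then have iv: "K.indep_vars (\<lambda>_. borel) (\<lambda>l w. c l * w l) {Inl i, Inr i}"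
      by simp
    have d: "distributed (gauss ?K) lborel (\<lambda>w. c l * w l) (normal_density 0 (c l))"
      if "l \<in> {Inl i, Inr i}" for l
    proof -
      have "distributed (gauss ?K) lborel (\<lambda>w. 0 + c l * w l) (normal_density (0 + c l * 0) (\<bar>c l\<bar> * 1))"
        by (rule K.normal_density_affine[OF gauss_distributed]) (use i st that in \<open>auto simp: c_def\<close>)
      then show ?thesis using st that by (auto simp: c_def)
    qed
    have "distributed (gauss ?K) lborel (\<lambda>w. \<Sum>l\<in>{Inl i, Inr i}. c l * w l)
        (normal_density (\<Sum>l\<in>{Inl i, Inr i}. 0) (sqrt (\<Sum>l\<in>{Inl i, Inr i}. (c l)\<^sup>2)))"
      by (rule K.sum_indep_normal[OF _ _ iv _ d]) (use st in \<open>auto simp: c_def\<close>)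
    moreover have "(s/r)\<^sup>2 + (t/r)\<^sup>2 = 1"
      using st by (simp add: power_divide add_divide_distrib[symmetric])
    ultimately show ?thesis by (simp add: X_def[abs_def] add_divide_distrib c_def)
  qed
  have mr: "(\<lambda>w. \<lambda>i\<in>I. r * w i) \<in> measurable (gauss I) (gauss I)"
    by (intro measurable_restrict) auto
  define h where "h = (\<lambda>w. f (\<lambda>i\<in>I. r * w i))"
  have h: "h \<in> borel_measurable (gauss I)"
    unfolding h_def using measurable_compose[OF mr f] by simp
  have mX: "(\<lambda>w. \<lambda>i\<in>I. X i w) \<in> measurable (gauss ?K) (gauss I)"
    unfolding X_def by (intro measurable_restrict) auto
  have m2: "(\<lambda>w. \<lambda>i\<in>I. s * w (Inl i) + t * w (Inr i)) \<in> measurable (gauss ?K) (gauss I)"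
    by (intro measurable_restrict) auto
  have m3: "(\<lambda>p. \<lambda>i\<in>I. s * fst p i + t * snd p i) \<in> measurable (gauss I \<Otimes>\<^sub>M gauss I) (gauss I)"
    by (intro measurable_restrict) measurable
  have "(\<integral>\<^sup>+w. h w \<partial>gauss I) = (\<integral>\<^sup>+w. h (\<lambda>i\<in>I. X i w) \<partial>gauss ?K)"
    by (subst gauss_law[OF prob_space_gauss ind N, symmetric], simp)
       (rule nn_integral_distr[OF mX], simp add: h)
  also have "\<dots> = (\<integral>\<^sup>+w. f (\<lambda>i\<in>I. s * w (Inl i) + t * w (Inr i)) \<partial>gauss ?K)"
    unfolding h_def X_def using st by (intro nn_integral_cong arg_cong[where f=f]) auto
  \<comment> \<open>Tonelli separates the two halves of the index set; each half is then renamed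
    back to \<open>I\<close>.\<close>
  also have "\<dots> = (\<integral>\<^sup>+x. \<integral>\<^sup>+y. f (\<lambda>i\<in>I. s * merge ?L ?R (x, y) (Inl i) + t * merge ?L ?R (x, y) (Inr i)) \<partial>gauss ?R \<partial>gauss ?L)"
    by (rule gauss.product_nn_integral_fold) (use I measurable_compose[OF m2 f] in auto)
  also have "\<dots> = (\<integral>\<^sup>+x. \<integral>\<^sup>+y. f (\<lambda>i\<in>I. s * x (Inl i) + t * y (Inr i)) \<partial>gauss ?R \<partial>gauss ?L)"
    by (intro nn_integral_cong arg_cong[where f=f]) (auto simp: merge_def)
  also have "\<dots> = (\<integral>\<^sup>+x. \<integral>\<^sup>+y. f (\<lambda>i\<in>I. s * (\<lambda>i\<in>I. x (Inl i)) i + t * y i) \<partial>gauss I \<partial>gauss ?L)"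
  proof (intro nn_integral_cong)
    fix x
    have mm: "(\<lambda>y. \<lambda>i\<in>I. s * x (Inl i) + t * y i) \<in> measurable (gauss I) (gauss I)"
      by (intro measurable_restrict) auto
    note D = gauss_reindex[of Inr I ?R]
    have "(\<integral>\<^sup>+y. f (\<lambda>i\<in>I. s * x (Inl i) + t * y i) \<partial>gauss I) = 
      (\<integral>\<^sup>+y. f (\<lambda>i\<in>I. s * x (Inl i) + t * y i) \<partial>distr (gauss ?R) (gauss I) (\<lambda>w. \<lambda>i\<in>I. w (Inr i)))"
      by (subst D(1)) auto
    also have "\<dots> = (\<integral>\<^sup>+y. f (\<lambda>i\<in>I. s * x (Inl i) + t * (\<lambda>i\<in>I. y (Inr i)) i) \<partial>gauss ?R)"
      by (rule nn_integral_distr) (use D(2) measurable_compose[OF mm f] in auto)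
    finally show "(\<integral>\<^sup>+y. f (\<lambda>i\<in>I. s * x (Inl i) + t * y (Inr i)) \<partial>gauss ?R) = 
      (\<integral>\<^sup>+y. f (\<lambda>i\<in>I. s * (\<lambda>i\<in>I. x (Inl i)) i + t * y i) \<partial>gauss I)"
      by (simp cong: restrict_cong)
  qed
  also have "\<dots> = (\<integral>\<^sup>+x. \<integral>\<^sup>+y. f (\<lambda>i\<in>I. s * x i + t * y i) \<partial>gauss I \<partial>gauss I)"
  proof -
    note D = gauss_reindex[of Inl I ?L]
    have "(\<lambda>p. f (\<lambda>i\<in>I. s * fst p i + t * snd p i)) \<in> borel_measurable (gauss I \<Otimes>\<^sub>M gauss I)"
      using measurable_compose[OF m3 f] by simp
    then have m: "(\<lambda>x. \<integral>\<^sup>+y. f (\<lambda>i\<in>I. s * x i + t * y i) \<partial>gauss I) \<in> borel_measurable (gauss I)"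
      using sigma_finite_measure.borel_measurable_nn_integral_fst[OF prob_space_imp_sigma_finite[OF prob_space_gauss]] by fastforce
    have "(\<integral>\<^sup>+x. \<integral>\<^sup>+y. f (\<lambda>i\<in>I. s * x i + t * y i) \<partial>gauss I \<partial>gauss I)
      = (\<integral>\<^sup>+x. \<integral>\<^sup>+y. f (\<lambda>i\<in>I. s * x i + t * y i) \<partial>gauss I \<partial>distr (gauss ?L) (gauss I) (\<lambda>w. \<lambda>i\<in>I. w (Inl i)))"
      by (subst D(1)) auto
    also have "\<dots> = (\<integral>\<^sup>+x. \<integral>\<^sup>+y. f (\<lambda>i\<in>I. s * (\<lambda>i\<in>I. x (Inl i)) i + t * y i) \<partial>gauss I \<partial>gauss ?L)"
      by (rule nn_integral_distr) (use D(2) m in auto)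
    finally show ?thesis ..
  qed
  finally show ?thesis by (simp add: h_def)
qed

lemma gauss_stable_sqrt:
  assumes K: "finite K" and st: "s \<ge> 0" "\<epsilon> > 0"
    and f: "f \<in> borel_measurable (gauss K)"
  shows "(\<integral>\<^sup>+w. f (\<lambda>i\<in>K. sqrt (s + \<epsilon>\<^sup>2) * w i) \<partial>gauss K)
    = (\<integral>\<^sup>+w. \<integral>\<^sup>+v. f (\<lambda>i\<in>K. sqrt s * w i + \<epsilon> * v i) \<partial>gauss K \<partial>gauss K)"
\<comment> \<open>The interpolation below reaches variance 0, where \<open>gauss_stable\<close> does
  not apply; there the outer integrand is constant and the measure has mass one.\<close>
proof (cases "s = 0")
  case True
  interpret prob_space "gauss K" by (rule prob_space_gauss)
  show ?thesis using st True by (simp add: emeasure_space_1)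
next
  case False
  then show ?thesis using st 
    by (intro gauss_stable[OF K _ _ _ _ f]) (auto simp: add_pos_pos)
qed

section \<open>Exponential moments and covariances of standard normal coordinates\<close>

lemma has_bochner_integral_stdn_exp:
  "has_bochner_integral stdn (\<lambda>x. exp (c * x)) (exp (c\<^sup>2 / 2))"
proof -
  have eq: "std_normal_density x * exp (c * x) = exp (c\<^sup>2 / 2) * normal_density c 1 x" for x
  proof -
    have "- (x\<^sup>2 / 2) + c * x = c\<^sup>2 / 2 - (x - c)\<^sup>2 / 2"
      by (simp add: power2_eq_square field_simps)
    then show ?thesis
      by (simp add: normal_density_def mult_exp_exp)
  qed
  have "has_bochner_integral lborel (\<lambda>x. exp (c\<^sup>2 / 2) * normal_density c 1 x) (exp (c\<^sup>2 / 2) * 1)"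
    by (intro has_bochner_integral_mult_right) (simp add: has_bochner_integral_iff)
  then show ?thesis
    unfolding stdn_def by (subst has_bochner_integral_density) (auto simp: eq[symmetric])
qed

lemma integrable_stdn_exp_abs: "integrable stdn (\<lambda>x. exp (c * \<bar>x\<bar>))"
proof (rule Bochner_Integration.integrable_bound)
  show "integrable stdn (\<lambda>x. exp (c * x) + exp (- c * x))"
    using has_bochner_integral_stdn_exp[of c] has_bochner_integral_stdn_exp[of "- c"]
    by (intro Bochner_Integration.integrable_add) (auto simp: has_bochner_integral_iff)
  have "\<bar>exp (c * \<bar>x\<bar>)\<bar> \<le> \<bar>exp (c * x) + exp (- c * x)\<bar>" for x
    by (subst (2) abs_of_pos) (auto simp: abs_if intro: add_pos_pos)
  then show "AE x in stdn. norm (exp (c * \<bar>x\<bar>)) \<le> norm (exp (c * x) + exp (- c * x))"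
    by (intro AE_I2) simp
qed simp

lemma integrable_gauss_exp:
  assumes "finite I"
  shows "integrable (gauss I) (\<lambda>w. exp (C * (\<Sum>i\<in>I. \<bar>w i\<bar>)))"
proof -
  have "integrable (gauss I) (\<lambda>w. \<Prod>i\<in>I. exp (C * \<bar>w i\<bar>))"
    by (rule gauss.product_integrable_prod[OF assms integrable_stdn_exp_abs])
  then show ?thesis
    using assms by (simp add: exp_sum sum_distrib_left)
qed

text \<open>An exponential of the l1 norm dominates every maximum of finitely many linear forms,
  which grows at most linearly, as well as the exponentials of such maxima.\<close>

lemma integrable_gauss_exp_bound:
  fixes f :: "('i \<Rightarrow> real) \<Rightarrow> real"
  assumes "finite I" and f: "f \<in> borel_measurable (gauss I)"
    and b: "\<And>w. \<bar>f w\<bar> \<le> K * exp (C * (\<Sum>i\<in>I. \<bar>w i\<bar>))"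
  shows "integrable (gauss I) f"
proof (rule Bochner_Integration.integrable_bound)
  show "integrable (gauss I) (\<lambda>w. K * exp (C * (\<Sum>i\<in>I. \<bar>w i\<bar>)))"
    by (intro Bochner_Integration.integrable_mult_right integrable_gauss_exp assms)
  show "AE w in gauss I. norm (f w) \<le> norm (K * exp (C * (\<Sum>i\<in>I. \<bar>w i\<bar>)))"
    using order_trans[OF b abs_ge_self] by (intro AE_I2) auto
qed fact

lemma integral_gauss_exp_linear:
  assumes "finite I"
  shows "(\<integral>w. exp (\<Sum>i\<in>I. a i * w i) \<partial>gauss I) = exp ((\<Sum>i\<in>I. (a i)\<^sup>2) / 2)"
proof -
  have "(\<integral>w. exp (\<Sum>i\<in>I. a i * w i) \<partial>gauss I) = (\<integral>w. (\<Prod>i\<in>I. exp (a i * w i)) \<partial>gauss I)"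
    using assms by (simp add: exp_sum)
  also have "\<dots> = (\<Prod>i\<in>I. \<integral>x. exp (a i * x) \<partial>stdn)"
    using has_bochner_integral_stdn_exp
    by (intro gauss.product_integral_prod[OF assms]) (auto simp: has_bochner_integral_iff)
  also have "\<dots> = (\<Prod>i\<in>I. exp ((a i)\<^sup>2 / 2))"
    using has_bochner_integral_stdn_exp by (simp add: has_bochner_integral_iff)
  also have "\<dots> = exp ((\<Sum>i\<in>I. (a i)\<^sup>2) / 2)"
    using assms by (simp add: exp_sum sum_divide_distrib)
  finally show ?thesis .
qed

lemma stdn_moment_1: "has_bochner_integral stdn (\<lambda>x. x) 0"
  unfolding stdn_def using std_normal_moment_odd[of 0]
  by (subst has_bochner_integral_density) auto

lemma stdn_moment_2: "has_bochner_integral stdn (\<lambda>x. x\<^sup>2) 1"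
  unfolding stdn_def using std_normal_moment_even[of 1]
  by (subst has_bochner_integral_density) (auto simp: fact_2)

lemma gauss_component_integral:
  assumes i: "i \<in> I" and f: "has_bochner_integral stdn f (x :: real)"
  shows "has_bochner_integral (gauss I) (\<lambda>w. f (w i)) x"
proof -
  have m: "(\<lambda>w. w i) \<in> measurable (gauss I) stdn"
    using i by measurable
  have "has_bochner_integral (distr (gauss I) stdn (\<lambda>w. w i)) f x"
    by (subst gauss_component[OF i]) (rule f)
  then show ?thesis
    using borel_measurable_has_bochner_integral[OF f] m
    by (simp add: has_bochner_integral_iff integrable_distr_eq integral_distr)
qed

lemma gauss_covariance:
  assumes I: "finite I" and ij: "i \<in> I" "j \<in> I"
  shows "has_bochner_integral (gauss I) (\<lambda>w. w i * w j) (if i = j then 1 else 0)"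
proof (cases "i = j")
  case True
  then show ?thesis
    using gauss_component_integral[OF ij(1) stdn_moment_2] by (simp add: power2_eq_square)
next
  case False
  interpret prob_space "gauss I" by (rule prob_space_gauss)
  have iv: "indep_vars (\<lambda>_. borel) (\<lambda>i w. w i) {i, j}"
    by (rule indep_vars_subset[OF gauss_indep]) (use ij in auto)
  have int: "integrable (gauss I) (\<lambda>w. w k)" "(\<integral>w. w k \<partial>gauss I) = 0" if "k \<in> {i, j}" for k
    using gauss_component_integral[OF _ stdn_moment_1, of k I] that ij
    by (auto simp: has_bochner_integral_iff)
  show ?thesis
    using indep_vars_integrable[OF _ iv] indep_vars_lebesgue_integral[OF _ iv] int False
    by (auto simp: has_bochner_integral_iff)
qed

text \<open>The centred Gaussian process indexed by \<open>s\<close> whose covariance is the Gram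
  matrix of the rows of \<open>a\<close>. Both sides of the comparison have this form.\<close>

definition lin :: "'i set \<Rightarrow> ('s \<Rightarrow> 'i \<Rightarrow> real) \<Rightarrow> ('i \<Rightarrow> real) \<Rightarrow> 's \<Rightarrow> real" where
  "lin I a w s = (\<Sum>i\<in>I. a s i * w i)"

lemma lin_measurable [measurable]: "(\<lambda>w. lin I a w s) \<in> borel_measurable (gauss I)"
  unfolding lin_def by measurable

lemma lin_mean: "has_bochner_integral (gauss I) (\<lambda>w. lin I a w s) 0"
proof -
  have "has_bochner_integral (gauss I) (\<lambda>w. \<Sum>i\<in>I. a s i * w i) (\<Sum>i\<in>I. a s i * 0)"
    by (intro has_bochner_integral_sum has_bochner_integral_mult_right
        gauss_component_integral[OF _ stdn_moment_1])
  then show ?thesis by (simp add: lin_def[abs_def])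
qed

lemma lin_covariance:
  assumes "finite I"
  shows "has_bochner_integral (gauss I) (\<lambda>w. lin I a w s * lin I a w s') (\<Sum>i\<in>I. a s i * a s' i)"
proof -
  have "has_bochner_integral (gauss I) (\<lambda>w. \<Sum>i\<in>I. \<Sum>j\<in>I. (a s i * a s' j) * (w i * w j))
    (\<Sum>i\<in>I. \<Sum>j\<in>I. (a s i * a s' j) * (if i = j then 1 else 0))"
    by (intro has_bochner_integral_sum has_bochner_integral_mult_right gauss_covariance assms)
  also have "(\<lambda>w. \<Sum>i\<in>I. \<Sum>j\<in>I. (a s i * a s' j) * (w i * w j)) = (\<lambda>w. lin I a w s * lin I a w s')"
    by (simp add: fun_eq_iff lin_def sum_product mult_ac)
  also have "(\<Sum>i\<in>I. \<Sum>j\<in>I. (a s i * a s' j) * (if i = j then 1 else 0)) = (\<Sum>i\<in>I. a s i * a s' i)"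
    using assms by (simp add: if_distrib cong: if_cong)
  finally show ?thesis .
qed

lemma lin_bound:
  assumes "finite I" "finite S" "s \<in> S"
  shows "\<bar>lin I a w s\<bar> \<le> (\<Sum>s\<in>S. \<Sum>i\<in>I. \<bar>a s i\<bar>) * (\<Sum>i\<in>I. \<bar>w i\<bar>)"
proof -
  have A: "\<bar>a s i\<bar> \<le> (\<Sum>s\<in>S. \<Sum>i\<in>I. \<bar>a s i\<bar>)" if "i \<in> I" for i
    using assms that
    by (intro order_trans[OF member_le_sum[of i I "\<lambda>i. \<bar>a s i\<bar>"] member_le_sum[of s S "\<lambda>s. \<Sum>i\<in>I. \<bar>a s i\<bar>"]])
       (auto intro: sum_nonneg)
  have "\<bar>lin I a w s\<bar> \<le> (\<Sum>i\<in>I. \<bar>a s i * w i\<bar>)"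
    unfolding lin_def by (rule sum_abs)
  also have "\<dots> \<le> (\<Sum>i\<in>I. (\<Sum>s\<in>S. \<Sum>i\<in>I. \<bar>a s i\<bar>) * \<bar>w i\<bar>)"
    by (intro sum_mono) (auto simp: abs_mult intro!: mult_right_mono A)
  finally show ?thesis by (simp add: sum_distrib_left)
qed

section \<open>Slepian comparison of exponential moments\<close>

text \<open>A smooth substitute for exp (c max z): it lies between this quantity and its product
  with \<open>card S\<close> to the power c / b.\<close>

definition softmax :: "'s set \<Rightarrow> real \<Rightarrow> real \<Rightarrow> ('s \<Rightarrow> real) \<Rightarrow> real" where
  "softmax S b c z = (\<Sum>s\<in>S. exp (b * z s)) powr (c / b)"

text \<open>The weights that arise on differentiating the logarithm of the exponential sum; all
  derivatives of \<open>softmax\<close> are \<open>softmax\<close> times polynomials in averages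
  under these weights.\<close>

definition gibbs :: "'s set \<Rightarrow> real \<Rightarrow> ('s \<Rightarrow> real) \<Rightarrow> 's \<Rightarrow> real" where
  "gibbs S b z s = exp (b * z s) / (\<Sum>s\<in>S. exp (b * z s))"

context
  fixes S :: "'s set" and b c :: real
  assumes S: "finite S" "S \<noteq> {}" and bc: "0 < c" "c < b"
begin

lemma partition_pos: "(\<Sum>s\<in>S. exp (b * z s)) > 0"
  using S by (intro sum_pos) auto

lemma softmax_pos: "softmax S b c z > 0"
  unfolding softmax_def using partition_pos[of z] by (simp del: exp_gt_zero)

lemma gibbs_nonneg: "gibbs S b z s \<ge> 0"
  unfolding gibbs_def using partition_pos[of z] by simp

lemma gibbs_sum: "(\<Sum>s\<in>S. gibbs S b z s) = 1"
  unfolding gibbs_def sum_divide_distrib[symmetric] using partition_pos[of z] by simp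

lemma gibbs_average_bound:
  assumes "\<And>s. s \<in> S \<Longrightarrow> \<bar>v s\<bar> \<le> V"
  shows "\<bar>\<Sum>s\<in>S. gibbs S b z s * v s\<bar> \<le> V"
proof -
  have "\<bar>\<Sum>s\<in>S. gibbs S b z s * v s\<bar> \<le> (\<Sum>s\<in>S. gibbs S b z s * V)"
    using assms
    by (intro order_trans[OF sum_abs] sum_mono) (auto simp: abs_mult gibbs_nonneg intro!: mult_left_mono)
  then show ?thesis by (simp add: sum_distrib_right[symmetric] gibbs_sum)
qed

lemma softmax_mono:
  assumes "\<And>s. s \<in> S \<Longrightarrow> z s \<le> z' s + U"
  shows "softmax S b c z \<le> exp (c * U) * softmax S b c z'"
proof -
  have "(\<Sum>s\<in>S. exp (b * z s)) \<le> (\<Sum>s\<in>S. exp (b * U) * exp (b * z' s))"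
    using assms bc by (intro sum_mono) (auto simp: mult_exp_exp ring_distribs[symmetric] add.commute)
  then have "softmax S b c z \<le> (exp (b * U) * (\<Sum>s\<in>S. exp (b * z' s))) powr (c / b)"
    unfolding softmax_def using bc partition_pos[of z]
    by (intro powr_mono2) (auto simp: sum_distrib_left)
  also have "\<dots> = exp (c * U) * softmax S b c z'"
    unfolding softmax_def using bc partition_pos[of z'] by (simp add: powr_mult exp_powr_real)
  finally show ?thesis .
qed

lemma softmax_upper:
  assumes "\<And>s. s \<in> S \<Longrightarrow> z s \<le> U"
  shows "softmax S b c z \<le> real (card S) powr (c / b) * exp (c * U)"
  using softmax_mono[of z "\<lambda>_. 0" U] assms by (simp add: softmax_def mult.commute)

lemma softmax_lower:
  assumes "s \<in> S"
  shows "exp (c * z s) \<le> softmax S b c z"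
proof -
  have "exp (c * z s) = exp (b * z s) powr (c / b)"
    using bc by (simp add: exp_powr_real)
  also have "\<dots> \<le> softmax S b c z"
    unfolding softmax_def using S assms bc
    by (intro powr_mono2 member_le_sum[of s S "\<lambda>s. exp (b * z s)"]) auto
  finally show ?thesis .
qed

text \<open>Taylor's formula along the line from z in direction u. If m k denotes the k-th moment of
  u under the Gibbs weights, then its derivative is b (m (k+1) - m k * m 1), so the first three
  derivatives are explicit and each moment is at most U^k in modulus. The error is relative to
  \<open>softmax\<close> at the base point, which allows it to be integrated over base points
  later.\<close>

lemma softmax_taylor:
  fixes z u :: "'s \<Rightarrow> real"
  assumes u: "\<And>s. s \<in> S \<Longrightarrow> \<bar>u s\<bar> \<le> U" and e: "\<epsilon> > 0"
  defines "g \<equiv> gibbs S b z"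
  shows "\<bar>softmax S b c (\<lambda>s. z s + \<epsilon> * u s) - softmax S b c z *
      (1 + c * \<epsilon> * (\<Sum>s\<in>S. g s * u s) + \<epsilon>\<^sup>2 / 2 *
        (c * b * (\<Sum>s\<in>S. g s * (u s)\<^sup>2) - c * (b - c) * (\<Sum>s\<in>S. g s * u s)\<^sup>2))\<bar>
    \<le> 2 * b ^ 3 * (\<epsilon> * U) ^ 3 * exp (c * (\<epsilon> * U)) * softmax S b c z"
proof -
  define E where "E t s = exp (b * (z s + t * u s))" for t s
  define Z where "Z t = (\<Sum>s\<in>S. E t s)" for t
  define N where "N k t = (\<Sum>s\<in>S. E t s * (u s) ^ k)" for k t
  define m where "m k t = N k t / Z t" for k t
  define f where "f t = Z t powr (c / b)" for t
  have Zpos: "Z t > 0" for t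
    unfolding Z_def E_def using partition_pos[of "\<lambda>s. z s + t * u s"] by simp
  have U: "U \<ge> 0" using S u by (metis abs_ge_zero all_not_in_conv order_trans)
  have dE: "((\<lambda>t. E t s) has_real_derivative b * u s * E t s) (at t)" for s t
    unfolding E_def by (auto intro!: derivative_eq_intros)
  have dN: "(N k has_real_derivative b * N (Suc k) t) (at t)" for k t
  proof -
    have "((\<lambda>t. \<Sum>s\<in>S. E t s * (u s) ^ k) has_real_derivative (\<Sum>s\<in>S. b * u s * E t s * (u s) ^ k)) (at t)"
      by (intro DERIV_sum DERIV_cmult_right dE)
    then show ?thesis
      unfolding N_def[abs_def] by (simp add: sum_distrib_left mult_ac)
  qed
  have dZ: "(Z has_real_derivative b * N 1 t) (at t)" for t
    using dN[of 0 t] by (simp add: N_def[abs_def] Z_def[abs_def])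
  have dm: "(m k has_real_derivative b * (m (Suc k) t - m k t * m 1 t)) (at t)" for k t
    unfolding m_def[abs_def] using Zpos[of t]
    by (auto intro!: derivative_eq_intros dN dZ simp: field_simps power2_eq_square)
  have df: "(f has_real_derivative c * f t * m 1 t) (at t)" for t
  proof -
    have "((\<lambda>t. Z t powr (c / b)) has_real_derivative Z t powr (c / b) * (0 * ln (Z t) + b * N 1 t * (c / b) / Z t)) (at t)"
      by (rule DERIV_powr[OF dZ Zpos]) auto
    then show ?thesis unfolding f_def[abs_def] m_def using bc
      by (simp add: mult_ac)
  qed
  \<comment> \<open>The explicit j-th derivative of \<open>f\<close> along the line, for j up to 3;
    the last branch is meant for j = 3 only.\<close>
  define D where "D j = (case j of 0 \<Rightarrow> f | Suc 0 \<Rightarrow> (\<lambda>t. c * f t * m 1 t)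
    | Suc (Suc 0) \<Rightarrow> (\<lambda>t. f t * (c * b * m 2 t - c * (b - c) * (m 1 t)\<^sup>2))
    | Suc (Suc (Suc _)) \<Rightarrow> (\<lambda>t. f t * (c * m 1 t * (c * b * m 2 t - c * (b - c) * (m 1 t)\<^sup>2)
        + (c * b * (b * (m 3 t - m 2 t * m 1 t)) - c * (b - c) * (2 * m 1 t * (b * (m 2 t - m 1 t * m 1 t)))))))"
    for j :: nat
  have D: "(D j has_real_derivative D (Suc j) t) (at t)" if j3: "j < 3" for j t
  proof -
    consider "j = 0" | "j = 1" | "j = 2" using j3 by linarith
    then show ?thesis
    proof cases
      case 1 then show ?thesis using df by (simp add: D_def)
    next
      case 2
      have "((\<lambda>t. c * f t * m 1 t) has_real_derivative 
         f t * (c * b * m 2 t - c * (b - c) * (m 1 t)\<^sup>2)) (at t)"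
        using dm[of 1 t] 
        by (auto intro!: derivative_eq_intros df simp: algebra_simps power2_eq_square numeral_2_eq_2)
      then show ?thesis using 2 by (simp add: D_def)
    next
      case 3
      have d2: "(m 2 has_real_derivative b * (m 3 t - m 2 t * m 1 t)) (at t)"
        using dm[of 2 t] by (simp add: numeral_3_eq_3 numeral_2_eq_2)
      have d1: "(m 1 has_real_derivative b * (m 2 t - m 1 t * m 1 t)) (at t)"
        using dm[of 1 t] by (simp add: numeral_2_eq_2)
      have "((\<lambda>t. f t * (c * b * m 2 t - c * (b - c) * (m 1 t)\<^sup>2)) has_real_derivative 
         f t * (c * m 1 t * (c * b * m 2 t - c * (b - c) * (m 1 t)\<^sup>2)
        + (c * b * (b * (m 3 t - m 2 t * m 1 t)) - c * (b - c) * (2 * m 1 t * (b * (m 2 t - m 1 t * m 1 t)))))) (at t)"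
        by (rule derivative_eq_intros df d1 d2 refl)+ (simp add: algebra_simps power2_eq_square)
      then show ?thesis using 3 by (simp add: D_def numeral_2_eq_2)
    qed
  qed
  have "\<exists>t. 0 < t \<and> t < \<epsilon> \<and> f \<epsilon> = (\<Sum>j<3. D j 0 / fact j * \<epsilon> ^ j) + D 3 t / fact 3 * \<epsilon> ^ 3"
    by (rule Maclaurin) (use e D in \<open>auto simp: D_def\<close>)
  then obtain t where t: "0 < t" "t < \<epsilon>" and
    eq: "f \<epsilon> = (\<Sum>j<3. D j 0 / fact j * \<epsilon> ^ j) + D 3 t / fact 3 * \<epsilon> ^ 3" by blast
  have mk: "m k t = (\<Sum>s\<in>S. gibbs S b (\<lambda>s. z s + t * u s) s * (u s) ^ k)" for k t
    unfolding m_def N_def Z_def E_def gibbs_def sum_divide_distrib by simp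
  have mb: "\<bar>m k t\<bar> \<le> U ^ k" for k t
    unfolding mk by (rule gibbs_average_bound) (simp add: power_abs u power_mono)
  have f0: "f t = softmax S b c (\<lambda>s. z s + t * u s)" for t
    unfolding f_def Z_def E_def softmax_def ..
  \<comment> \<open>The remainder sits at an unknown intermediate point; returning to the base point
    costs the exponential factor of the bound.\<close>
  have ft: "f t \<le> exp (c * (\<epsilon> * U)) * f 0"
    unfolding f0
  proof (rule softmax_mono)
    fix s assume s: "s \<in> S"
    have "t * u s \<le> t * U" using u[OF s] t by (intro mult_left_mono) auto
    also have "\<dots> \<le> \<epsilon> * U" using t U by (intro mult_right_mono) auto
    finally show "z s + t * u s \<le> z s + 0 * u s + \<epsilon> * U" by simp
  qed
  have fpos: "f t > 0" for t unfolding f0 by (rule softmax_pos)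
  have q: "\<bar>c * b * m 2 t - c * (b - c) * (m 1 t)\<^sup>2\<bar> \<le> 2 * b\<^sup>2 * U\<^sup>2"
  proof -
    have "\<bar>c * b * m 2 t\<bar> \<le> b * b * U\<^sup>2"
      unfolding abs_mult using bc mb[of 2 t] by (intro mult_mono) auto
    moreover have "\<bar>c * (b - c) * (m 1 t)\<^sup>2\<bar> \<le> b * b * U\<^sup>2"
      unfolding abs_mult using bc mb[of 1 t] by (intro mult_mono) (auto simp: abs_le_square_iff[symmetric])
    ultimately show ?thesis by (simp add: power2_eq_square)
  qed
  \<comment> \<open>The three products contribute 2, 2 and 4 times b^3 U^3, by c < b and the moment
    bounds. The resulting 8 / 3! is rounded up to the constant 2 of the claim.\<close>
  have "\<bar>c * m 1 t * (c * b * m 2 t - c * (b - c) * (m 1 t)\<^sup>2)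
        + (c * b * (b * (m 3 t - m 2 t * m 1 t)) - c * (b - c) * (2 * m 1 t * (b * (m 2 t - m 1 t * m 1 t))))\<bar>
      \<le> 2 * b ^ 3 * U ^ 3 + 2 * b ^ 3 * U ^ 3 + 4 * b ^ 3 * U ^ 3"
  proof -
    have 1: "\<bar>c * m 1 t * (c * b * m 2 t - c * (b - c) * (m 1 t)\<^sup>2)\<bar> \<le> b * U * (2 * b\<^sup>2 * U\<^sup>2)"
      unfolding abs_mult[of "c * m 1 t"]
      by (rule mult_mono[OF _ q]) (use bc mb[of 1 t] U in \<open>auto simp: abs_mult intro!: mult_mono\<close>)
    have m21: "\<bar>m 2 t * m 1 t\<bar> \<le> U ^ 2 * U"
      unfolding abs_mult using mb[of 2 t] mb[of 1 t] U by (intro mult_mono) auto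
    have "\<bar>m 3 t - m 2 t * m 1 t\<bar> \<le> U ^ 3 + U ^ 3"
      using mb[of 3 t] m21 by (simp add: power2_eq_square power3_eq_cube)
    then have 2: "\<bar>c * b * (b * (m 3 t - m 2 t * m 1 t))\<bar> \<le> b * b * (b * (U ^ 3 + U ^ 3))"
      unfolding abs_mult using bc U by (intro mult_mono) auto
    have m11: "\<bar>m 1 t * m 1 t\<bar> \<le> U * U"
      unfolding abs_mult using mb[of 1 t] U by (intro mult_mono) auto
    have "\<bar>m 2 t - m 1 t * m 1 t\<bar> \<le> U ^ 2 + U ^ 2"
      using mb[of 2 t] m11 unfolding power2_eq_square by linarith
    then have 3: "\<bar>c * (b - c) * (2 * m 1 t * (b * (m 2 t - m 1 t * m 1 t)))\<bar> \<le> b * b * (2 * U * (b * (U ^ 2 + U ^ 2)))"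
      unfolding abs_mult using bc U mb[of 1 t] by (intro mult_mono) auto
    show ?thesis using 1 2 3 by (simp add: power2_eq_square power3_eq_cube algebra_simps)
  qed
  then have "\<bar>D 3 t\<bar> \<le> f t * (8 * b ^ 3 * U ^ 3)"
    unfolding D_def numeral_3_eq_3 using fpos[of t] by (simp add: abs_mult numeral_3_eq_3 mult_ac)
  also have "\<dots> \<le> (exp (c * (\<epsilon> * U)) * f 0) * (8 * b ^ 3 * U ^ 3)"
    using ft bc U by (intro mult_right_mono) auto
  finally have D3: "\<bar>D 3 t\<bar> / 6 * \<epsilon> ^ 3 \<le> (exp (c * (\<epsilon> * U)) * f 0) * (8 * b ^ 3 * U ^ 3) / 6 * \<epsilon> ^ 3"
    using e by (intro mult_right_mono divide_right_mono) auto
  have "\<bar>f \<epsilon> - (\<Sum>j<3. D j 0 / fact j * \<epsilon> ^ j)\<bar> = \<bar>D 3 t\<bar> / 6 * \<epsilon> ^ 3"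
    using e by (simp add: eq abs_mult fact_numeral)
  also note D3
  also have "(exp (c * (\<epsilon> * U)) * f 0) * (8 * b ^ 3 * U ^ 3) / 6 * \<epsilon> ^ 3 
     \<le> 2 * b ^ 3 * (\<epsilon> * U) ^ 3 * exp (c * (\<epsilon> * U)) * f 0"
    using e bc U fpos[of 0] by (simp add: power_mult_distrib field_simps)
  finally have "\<bar>f \<epsilon> - (\<Sum>j<3. D j 0 / fact j * \<epsilon> ^ j)\<bar> \<le> 
    2 * b ^ 3 * (\<epsilon> * U) ^ 3 * exp (c * (\<epsilon> * U)) * f 0" .
  also have "(\<Sum>j<3. D j 0 / fact j * \<epsilon> ^ j) = f 0 * (1 + c * \<epsilon> * m 1 0 + \<epsilon>\<^sup>2 / 2 *
        (c * b * m 2 0 - c * (b - c) * (m 1 0)\<^sup>2))"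
  proof -
    have "(\<Sum>j<3. D j 0 / fact j * \<epsilon> ^ j) = D 0 0 + D 1 0 * \<epsilon> + D 2 0 / 2 * \<epsilon>\<^sup>2"
      by (simp add: numeral_3_eq_3 numeral_2_eq_2)
    moreover have "D 0 0 = f 0" "D 1 0 = c * f 0 * m 1 0"
      "D 2 0 = f 0 * (c * b * m 2 0 - c * (b - c) * (m 1 0)\<^sup>2)"
      by (simp_all add: D_def numeral_2_eq_2)
    ultimately show ?thesis
      by (simp only:) (simp add: field_simps)
  qed
  finally show ?thesis
    unfolding mk f0 g_def by simp
qed

end

section \<open>Lindeberg replacement of one Gaussian process by another\<close>

lemma softmax_lin_measurable [measurable]:
  "(\<lambda>w. softmax S b c (\<lambda>s. z s + r * lin I a w s)) \<in> borel_measurable (gauss I)"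
  unfolding softmax_def by measurable

lemma lin_restrict: "lin I a (\<lambda>i\<in>I. x * u i + y * v i) s = x * lin I a u s + y * lin I a v s"
  by (simp add: lin_def sum.distrib sum_distrib_left algebra_simps)

lemma lin_restrict1: "lin I a (\<lambda>i\<in>I. x * u i) s = x * lin I a u s"
  by (simp add: lin_def sum_distrib_left algebra_simps)

text \<open>One term of the exponential series. It absorbs the cube of the Taylor remainder into an
  exponential weight.\<close>

lemma cube_le_exp: "x ^ 3 \<le> 6 * exp x" if "x \<ge> 0" for x :: real
proof -
  have "x ^ 3 / fact 3 \<le> exp x"
  proof -
    have "(\<Sum>n\<in>{3}. x ^ n /\<^sub>R fact n) \<le> (\<Sum>n. x ^ n /\<^sub>R fact n)"
      using that by (intro sum_le_suminf summable_exp_generic) auto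
    then show ?thesis by (simp add: exp_def divide_inverse mult.commute)
  qed
  then show ?thesis by (simp add: fact_numeral)
qed

text \<open>The second-order coefficient of the expected \<open>softmax\<close> under a Gaussian
  increment with covariance \<open>K\<close>. Variances enter through the first sum; the double sum
  has the negative weight -c (b - c), so with equal variances larger covariances give a smaller
  value.\<close>

definition quad :: "'s set \<Rightarrow> real \<Rightarrow> real \<Rightarrow> ('s \<Rightarrow> 's \<Rightarrow> real) \<Rightarrow> ('s \<Rightarrow> real) \<Rightarrow> real" where
  "quad S b c K z = c * b * (\<Sum>s\<in>S. gibbs S b z s * K s s)
     - c * (b - c) * (\<Sum>s\<in>S. \<Sum>t\<in>S. gibbs S b z s * gibbs S b z t * K s t)"

context
  fixes S :: "'s set" and b c :: real
  assumes S: "finite S" "S \<noteq> {}" and bc: "0 < c" "c < b"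
begin

text \<open>Integrating the Taylor formula: the linear term has mean zero and the quadratic one
  becomes \<open>quad\<close>. It is essential that \<open>C\<close> depends neither on \<epsilon>
  nor on the base point \<open>z\<close>.\<close>

lemma softmax_gauss_expansion:
  fixes a :: "'s \<Rightarrow> 'i \<Rightarrow> real"
  assumes I: "finite I"
  shows "\<exists>C\<ge>0. \<forall>\<epsilon> z. 0 < \<epsilon> \<longrightarrow> \<epsilon> \<le> 1 \<longrightarrow>
    integrable (gauss I) (\<lambda>w. softmax S b c (\<lambda>s. z s + \<epsilon> * lin I a w s)) \<and>
    \<bar>(\<integral>w. softmax S b c (\<lambda>s. z s + \<epsilon> * lin I a w s) \<partial>gauss I)
      - softmax S b c z * (1 + \<epsilon>\<^sup>2 / 2 * quad S b c (\<lambda>s t. \<Sum>i\<in>I. a s i * a t i) z)\<bar>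
    \<le> C * \<epsilon> ^ 3 * softmax S b c z"
proof -
  interpret prob_space "gauss I" by (rule prob_space_gauss)
  define A where "A = (\<Sum>s\<in>S. \<Sum>i\<in>I. \<bar>a s i\<bar>)"
  have A: "A \<ge> 0" unfolding A_def by (intro sum_nonneg) auto
  \<comment> \<open>The exponent (c + 1) A collects two factors: one A from bounding the cube of the
    remainder by 6 times an exponential, and c A from exp (c \<epsilon> U), where \<epsilon> is at
    most 1. The constant 12 below is 2 times this 6.\<close>
  define W where "W = (\<lambda>w::'i \<Rightarrow> real. exp ((c + 1) * A * (\<Sum>i\<in>I. \<bar>w i\<bar>)))"
  have W: "integrable (gauss I) W" unfolding W_def by (rule integrable_gauss_exp[OF I])
  define C where "C = 12 * b ^ 3 * (\<integral>w. W w \<partial>gauss I)"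
  have "C \<ge> 0" unfolding C_def using bc by (intro mult_nonneg_nonneg Bochner_Integration.integral_nonneg) (auto simp: W_def)
  moreover have "integrable (gauss I) (\<lambda>w. softmax S b c (\<lambda>s. z s + \<epsilon> * lin I a w s)) \<and>
    \<bar>(\<integral>w. softmax S b c (\<lambda>s. z s + \<epsilon> * lin I a w s) \<partial>gauss I)
      - softmax S b c z * (1 + \<epsilon>\<^sup>2 / 2 * quad S b c (\<lambda>s t. \<Sum>i\<in>I. a s i * a t i) z)\<bar>
    \<le> C * \<epsilon> ^ 3 * softmax S b c z" if e: "0 < \<epsilon>" "\<epsilon> \<le> 1" for \<epsilon> and z :: "'s \<Rightarrow> real"
  proof -
    define g where "g = gibbs S b z"
    let ?F = "\<lambda>w. softmax S b c (\<lambda>s. z s + \<epsilon> * lin I a w s)"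
    define G where "G w = softmax S b c z *
      (1 + c * \<epsilon> * (\<Sum>s\<in>S. g s * lin I a w s) + \<epsilon>\<^sup>2 / 2 *
        (c * b * (\<Sum>s\<in>S. g s * (lin I a w s)\<^sup>2) - c * (b - c) * (\<Sum>s\<in>S. g s * lin I a w s)\<^sup>2))" for w
    have Gint: "has_bochner_integral (gauss I) G
      (softmax S b c z * (1 + \<epsilon>\<^sup>2 / 2 * quad S b c (\<lambda>s t. \<Sum>i\<in>I. a s i * a t i) z))"
    proof -
      have "has_bochner_integral (gauss I) (\<lambda>w. softmax S b c z *
      (1 + c * \<epsilon> * (\<Sum>s\<in>S. g s * lin I a w s) + \<epsilon>\<^sup>2 / 2 *
        (c * b * (\<Sum>s\<in>S. g s * (lin I a w s * lin I a w s)) - c * (b - c) * (\<Sum>s\<in>S. \<Sum>t\<in>S. g s * g t * (lin I a w s * lin I a w t)))))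
      (softmax S b c z *
      (1 + c * \<epsilon> * (\<Sum>s\<in>S. g s * 0) + \<epsilon>\<^sup>2 / 2 *
        (c * b * (\<Sum>s\<in>S. g s * (\<Sum>i\<in>I. a s i * a s i)) - c * (b - c) * (\<Sum>s\<in>S. \<Sum>t\<in>S. g s * g t * (\<Sum>i\<in>I. a s i * a t i)))))"
        by (intro has_bochner_integral_mult_right has_bochner_integral_add has_bochner_integral_diff
            has_bochner_integral_sum lin_mean lin_covariance I)
           (simp add: has_bochner_integral_iff prob_space)
      moreover have "(\<Sum>s\<in>S. g s * v s)\<^sup>2 = (\<Sum>s\<in>S. \<Sum>t\<in>S. g s * g t * (v s * v t))" for v
        by (simp add: power2_eq_square sum_product mult_ac)
      ultimately show ?thesis
        by (simp add: G_def[abs_def] quad_def g_def[symmetric] power2_eq_square)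
    qed
    have b1: "\<bar>?F w - G w\<bar> \<le> 12 * b ^ 3 * \<epsilon> ^ 3 * softmax S b c z * W w" for w
    proof -
      define U where "U = A * (\<Sum>i\<in>I. \<bar>w i\<bar>)"
      have U: "U \<ge> 0" unfolding U_def using A by (intro mult_nonneg_nonneg sum_nonneg) auto
      have "\<bar>?F w - G w\<bar> \<le> 2 * b ^ 3 * (\<epsilon> * U) ^ 3 * exp (c * (\<epsilon> * U)) * softmax S b c z"
        unfolding G_def g_def
        by (rule softmax_taylor[OF S bc _ e(1)]) (use lin_bound[OF I S(1)] in \<open>auto simp: U_def A_def\<close>)
      also have "\<dots> = 2 * b ^ 3 * \<epsilon> ^ 3 * softmax S b c z * (U ^ 3 * exp (c * (\<epsilon> * U)))"
        by (simp add: power_mult_distrib mult_ac)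
      also have "\<dots> \<le> 2 * b ^ 3 * \<epsilon> ^ 3 * softmax S b c z * (6 * exp U * exp (c * U))"
        using bc e U softmax_pos[OF S bc, of z]
        by (intro mult_left_mono mult_mono cube_le_exp) (auto simp: mult_left_le_one_le less_imp_le)
      also have "\<dots> = 12 * b ^ 3 * \<epsilon> ^ 3 * softmax S b c z * W w"
        by (simp add: W_def U_def mult_exp_exp algebra_simps)
      finally show ?thesis .
    qed
    have Dint: "integrable (gauss I) (\<lambda>w. ?F w - G w)"
    proof (rule Bochner_Integration.integrable_bound)
      show "integrable (gauss I) (\<lambda>w. 12 * b ^ 3 * \<epsilon> ^ 3 * softmax S b c z * W w)"
        using W by simp
      show "(\<lambda>w. ?F w - G w) \<in> borel_measurable (gauss I)"
        using borel_measurable_has_bochner_integral[OF Gint] by measurable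
      show "AE w in gauss I. norm (?F w - G w) \<le> norm (12 * b ^ 3 * \<epsilon> ^ 3 * softmax S b c z * W w)"
        using order_trans[OF b1 abs_ge_self] by (intro AE_I2) auto
    qed
    have G1: "integrable (gauss I) G" and G2: "integral\<^sup>L (gauss I) G = 
      (softmax S b c z * (1 + \<epsilon>\<^sup>2 / 2 * quad S b c (\<lambda>s t. \<Sum>i\<in>I. a s i * a t i) z))"
      using Gint by (auto simp: has_bochner_integral_iff)
    have Fint: "integrable (gauss I) ?F"
      using Bochner_Integration.integrable_add[OF Dint G1] by simp
    have "\<bar>(\<integral>w. ?F w \<partial>gauss I) - integral\<^sup>L (gauss I) G\<bar> = \<bar>\<integral>w. ?F w - G w \<partial>gauss I\<bar>"
      using Fint G1 by simp
    also have "\<dots> \<le> (\<integral>w. \<bar>?F w - G w\<bar> \<partial>gauss I)"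
      by (rule integral_abs_bound)
    also have "\<dots> \<le> (\<integral>w. 12 * b ^ 3 * \<epsilon> ^ 3 * softmax S b c z * W w \<partial>gauss I)"
      using Dint W by (intro integral_mono b1) auto
    also have "\<dots> = C * \<epsilon> ^ 3 * softmax S b c z"
      by (simp add: C_def)
    finally show ?thesis using Fint G2 by simp
  qed
  ultimately show ?thesis by blast
qed

lemma quad_mono:
  assumes "\<And>s. s \<in> S \<Longrightarrow> K s s = L s s" "\<And>s t. s \<in> S \<Longrightarrow> t \<in> S \<Longrightarrow> L s t \<le> K s t"
  shows "quad S b c K z \<le> quad S b c L z"
proof -
  have "(\<Sum>s\<in>S. \<Sum>t\<in>S. gibbs S b z s * gibbs S b z t * L s t) \<le> (\<Sum>s\<in>S. \<Sum>t\<in>S. gibbs S b z s * gibbs S b z t * K s t)"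
    by (intro sum_mono mult_left_mono assms mult_nonneg_nonneg gibbs_nonneg[OF S bc])
  then show ?thesis unfolding quad_def using assms(1) bc
    by (auto intro!: diff_mono mult_left_mono)
qed

context
  fixes a :: "'s \<Rightarrow> 'i \<Rightarrow> real" and a' :: "'s \<Rightarrow> 'j \<Rightarrow> real" and I :: "'i set" and J :: "'j set"
  assumes I: "finite I" and J: "finite J"
    and var: "\<And>s. s \<in> S \<Longrightarrow> (\<Sum>i\<in>I. a s i * a s i) = (\<Sum>j\<in>J. a' s j * a' s j)"
    and cov: "\<And>s t. s \<in> S \<Longrightarrow> t \<in> S \<Longrightarrow> (\<Sum>j\<in>J. a' s j * a' t j) \<le> (\<Sum>i\<in>I. a s i * a t i)"
begin

text \<open>The quadratic terms are ordered by \<open>quad_mono\<close>, so only the two cubic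
  errors remain. The extended nonnegative form can be integrated over \<open>z\<close> without
  further conditions.\<close>

lemma softmax_gauss_step:
  "\<exists>C\<ge>0. \<forall>\<epsilon> z. 0 < \<epsilon> \<longrightarrow> \<epsilon> \<le> 1 \<longrightarrow>
    (\<integral>\<^sup>+w. ennreal (softmax S b c (\<lambda>s. z s + \<epsilon> * lin I a w s)) \<partial>gauss I)
    \<le> (\<integral>\<^sup>+v. ennreal (softmax S b c (\<lambda>s. z s + \<epsilon> * lin J a' v s)) \<partial>gauss J)
      + ennreal (C * \<epsilon> ^ 3) * ennreal (softmax S b c z)"
proof -
  obtain C1 where C1: "C1 \<ge> 0" "\<And>\<epsilon> z. 0 < \<epsilon> \<Longrightarrow> \<epsilon> \<le> 1 \<Longrightarrow>
    integrable (gauss I) (\<lambda>w. softmax S b c (\<lambda>s. z s + \<epsilon> * lin I a w s)) \<and>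
    \<bar>(\<integral>w. softmax S b c (\<lambda>s. z s + \<epsilon> * lin I a w s) \<partial>gauss I)
      - softmax S b c z * (1 + \<epsilon>\<^sup>2 / 2 * quad S b c (\<lambda>s t. \<Sum>i\<in>I. a s i * a t i) z)\<bar>
    \<le> C1 * \<epsilon> ^ 3 * softmax S b c z"
    using softmax_gauss_expansion[OF I, of a] by blast
  obtain C2 where C2: "C2 \<ge> 0" "\<And>\<epsilon> z. 0 < \<epsilon> \<Longrightarrow> \<epsilon> \<le> 1 \<Longrightarrow>
    integrable (gauss J) (\<lambda>w. softmax S b c (\<lambda>s. z s + \<epsilon> * lin J a' w s)) \<and>
    \<bar>(\<integral>w. softmax S b c (\<lambda>s. z s + \<epsilon> * lin J a' w s) \<partial>gauss J)
      - softmax S b c z * (1 + \<epsilon>\<^sup>2 / 2 * quad S b c (\<lambda>s t. \<Sum>i\<in>J. a' s i * a' t i) z)\<bar>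
    \<le> C2 * \<epsilon> ^ 3 * softmax S b c z"
    using softmax_gauss_expansion[OF J, of a'] by blast
  have "(\<integral>\<^sup>+w. ennreal (softmax S b c (\<lambda>s. z s + \<epsilon> * lin I a w s)) \<partial>gauss I)
    \<le> (\<integral>\<^sup>+v. ennreal (softmax S b c (\<lambda>s. z s + \<epsilon> * lin J a' v s)) \<partial>gauss J)
      + ennreal ((C1 + C2) * \<epsilon> ^ 3) * ennreal (softmax S b c z)" if e: "0 < \<epsilon>" "\<epsilon> \<le> 1" for \<epsilon> z
  proof -
    note h1 = C1(2)[OF e, of z] and h2 = C2(2)[OF e, of z]
    have pos: "softmax S b c z \<ge> 0" for z using softmax_pos[OF S bc, of z] by simp
    have "softmax S b c z * (1 + \<epsilon>\<^sup>2 / 2 * quad S b c (\<lambda>s t. \<Sum>i\<in>I. a s i * a t i) z)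
      \<le> softmax S b c z * (1 + \<epsilon>\<^sup>2 / 2 * quad S b c (\<lambda>s t. \<Sum>i\<in>J. a' s i * a' t i) z)"
      using var cov by (intro mult_left_mono add_left_mono quad_mono pos) auto
    then have "(\<integral>w. softmax S b c (\<lambda>s. z s + \<epsilon> * lin I a w s) \<partial>gauss I)
      \<le> (\<integral>v. softmax S b c (\<lambda>s. z s + \<epsilon> * lin J a' v s) \<partial>gauss J) + (C1 + C2) * \<epsilon> ^ 3 * softmax S b c z"
      using h1[THEN conjunct2] h2[THEN conjunct2] unfolding abs_le_iff distrib_right by linarith
    then have "ennreal (\<integral>w. softmax S b c (\<lambda>s. z s + \<epsilon> * lin I a w s) \<partial>gauss I)
      \<le> ennreal ((\<integral>v. softmax S b c (\<lambda>s. z s + \<epsilon> * lin J a' v s) \<partial>gauss J) + (C1 + C2) * \<epsilon> ^ 3 * softmax S b c z)"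
      by (rule ennreal_leI)
    also have "\<dots> = ennreal (\<integral>v. softmax S b c (\<lambda>s. z s + \<epsilon> * lin J a' v s) \<partial>gauss J)
      + ennreal ((C1 + C2) * \<epsilon> ^ 3) * ennreal (softmax S b c z)"
      using pos e C1(1) C2(1)
      by (subst ennreal_plus) (auto simp: ennreal_mult Bochner_Integration.integral_nonneg)
    finally show ?thesis
      using h1 h2 pos by (simp add: nn_integral_eq_integral)
  qed
  then show ?thesis using C1(1) C2(1) by (intro exI[of _ "C1 + C2"]) auto
qed

text \<open>Moving variance \<open>\<epsilon>\<^sup>2\<close> from one process to the other costs \<open>O(\<epsilon>\<^sup>3)\<close>, so \<open>1 / \<epsilon>\<^sup>2\<close> steps cost
  \<open>O(\<epsilon>)\<close> in total.\<close>

definition interp :: "real \<Rightarrow> real \<Rightarrow> ennreal" where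
  "interp s t = (\<integral>\<^sup>+w. \<integral>\<^sup>+v. ennreal (softmax S b c
     (\<lambda>x. sqrt s * lin I a w x + sqrt t * lin J a' v x)) \<partial>gauss J \<partial>gauss I)"

text \<open>The error of each replacement carries a factor \<open>interp s t\<close>; a bound on the
  whole unit square lets the errors of all steps be added. It comes from l1 domination, as sqrt s
  and sqrt t stay at most 1.\<close>

lemma interp_bounded:
  "\<exists>B\<ge>0. \<forall>s t. 0 \<le> s \<longrightarrow> s \<le> 1 \<longrightarrow> 0 \<le> t \<longrightarrow> t \<le> 1 \<longrightarrow> interp s t \<le> ennreal B"
proof -
  define A where "A = (\<Sum>s\<in>S. \<Sum>i\<in>I. \<bar>a s i\<bar>)"
  define A' where "A' = (\<Sum>s\<in>S. \<Sum>i\<in>J. \<bar>a' s i\<bar>)"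
  have A: "A \<ge> 0" "A' \<ge> 0" unfolding A_def A'_def by (intro sum_nonneg; auto)+
  define V where "V = (\<lambda>w::'i \<Rightarrow> real. exp (c * A * (\<Sum>i\<in>I. \<bar>w i\<bar>)))"
  define W where "W = (\<lambda>w::'j \<Rightarrow> real. exp (c * A' * (\<Sum>i\<in>J. \<bar>w i\<bar>)))"
  define k where "k = real (card S) powr (c / b)"
  have VW: "integrable (gauss I) V" "integrable (gauss J) W"
    unfolding V_def W_def by (rule integrable_gauss_exp I J)+
  have nn: "V w \<ge> 0" "W v \<ge> 0" "k \<ge> 0" for w v by (auto simp: V_def W_def k_def)
  define B where "B = k * ((\<integral>w. V w \<partial>gauss I) * (\<integral>w. W w \<partial>gauss J))"
  have "interp s t \<le> ennreal B" if st: "0 \<le> s" "s \<le> 1" "0 \<le> t" "t \<le> 1" for s t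
  proof -
    have le: "softmax S b c (\<lambda>x. sqrt s * lin I a w x + sqrt t * lin J a' v x) \<le> k * (V w * W v)" for w v
    proof -
      have "softmax S b c (\<lambda>x. sqrt s * lin I a w x + sqrt t * lin J a' v x)
        \<le> k * exp (c * (A * (\<Sum>i\<in>I. \<bar>w i\<bar>) + A' * (\<Sum>i\<in>J. \<bar>v i\<bar>)))"
        unfolding k_def
      proof (rule softmax_upper[OF S bc])
        fix x assume x: "x \<in> S"
        have "\<bar>sqrt s * lin I a w x\<bar> \<le> 1 * (A * (\<Sum>i\<in>I. \<bar>w i\<bar>))"
          unfolding abs_mult A_def using st by (intro mult_mono lin_bound[OF I S(1) x]) auto
        moreover have "\<bar>sqrt t * lin J a' v x\<bar> \<le> 1 * (A' * (\<Sum>i\<in>J. \<bar>v i\<bar>))"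
          unfolding abs_mult A'_def using st by (intro mult_mono lin_bound[OF J S(1) x]) auto
        ultimately show "sqrt s * lin I a w x + sqrt t * lin J a' v x \<le> A * (\<Sum>i\<in>I. \<bar>w i\<bar>) + A' * (\<Sum>i\<in>J. \<bar>v i\<bar>)"
          by linarith
      qed
      also have "\<dots> = k * (V w * W v)"
        by (simp add: V_def W_def mult_exp_exp algebra_simps)
      finally show ?thesis .
    qed
    have "interp s t \<le> (\<integral>\<^sup>+w. \<integral>\<^sup>+v. ennreal k * (ennreal (V w) * ennreal (W v)) \<partial>gauss J \<partial>gauss I)"
      unfolding interp_def using le nn
      by (intro nn_integral_mono) (simp add: ennreal_mult'[symmetric] ennreal_leI)
    also have "\<dots> = ennreal k * ((\<integral>\<^sup>+w. ennreal (V w) \<partial>gauss I) * (\<integral>\<^sup>+v. ennreal (W v) \<partial>gauss J))"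
      using borel_measurable_integrable[OF VW(1)] borel_measurable_integrable[OF VW(2)]
      by (simp add: nn_integral_cmult nn_integral_multc mult.assoc)
    also have "\<dots> = ennreal B"
      using VW nn unfolding B_def
      by (simp add: nn_integral_eq_integral ennreal_mult' Bochner_Integration.integral_nonneg)
    finally show ?thesis .
  qed
  moreover have "B \<ge> 0" unfolding B_def using nn by (auto intro!: mult_nonneg_nonneg Bochner_Integration.integral_nonneg)
  ultimately show ?thesis by blast
qed

text \<open>Stability splits variance s + \<epsilon>^2 into s and an independent increment of size
  \<epsilon>. With everything else frozen as base point, the increment is exchanged for one of the
  other process and then merged with variance t.\<close>

lemma interp_step:
  "\<exists>C\<ge>0. \<forall>s t \<epsilon>. 0 \<le> s \<longrightarrow> 0 \<le> t \<longrightarrow> 0 < \<epsilon> \<longrightarrow> \<epsilon> \<le> 1 \<longrightarrow>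
     interp (s + \<epsilon>\<^sup>2) t \<le> interp s (t + \<epsilon>\<^sup>2) + ennreal (C * \<epsilon> ^ 3) * interp s t"
proof -
  interpret PI: prob_space "gauss I" by (rule prob_space_gauss)
  interpret PJ: prob_space "gauss J" by (rule prob_space_gauss)
  interpret P: pair_sigma_finite "gauss I" "gauss J" ..
  obtain C where C: "C \<ge> 0" "\<And>\<epsilon> z. 0 < \<epsilon> \<Longrightarrow> \<epsilon> \<le> 1 \<Longrightarrow>
    (\<integral>\<^sup>+w. ennreal (softmax S b c (\<lambda>s. z s + \<epsilon> * lin I a w s)) \<partial>gauss I)
    \<le> (\<integral>\<^sup>+v. ennreal (softmax S b c (\<lambda>s. z s + \<epsilon> * lin J a' v s)) \<partial>gauss J)
      + ennreal (C * \<epsilon> ^ 3) * ennreal (softmax S b c z)"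
    using softmax_gauss_step by blast
  have "interp (s + \<epsilon>\<^sup>2) t \<le> interp s (t + \<epsilon>\<^sup>2) + ennreal (C * \<epsilon> ^ 3) * interp s t"
    if st: "0 \<le> s" "0 \<le> t" "0 < \<epsilon>" "\<epsilon> \<le> 1" for s t \<epsilon>
  proof -
    define F where "F = (\<lambda>z. ennreal (softmax S b c z))"
    have Fm: "(\<lambda>q. F (\<lambda>x. f q x)) \<in> borel_measurable N"
      if "\<And>x. (\<lambda>q. f q x) \<in> borel_measurable N" for f :: "'q \<Rightarrow> 's \<Rightarrow> real" and N
      unfolding F_def softmax_def using that by measurable
    have l1: "(\<lambda>p. lin I a (f p) x) \<in> borel_measurable N" if "f \<in> measurable N (gauss I)" for f :: "'q \<Rightarrow> 'i \<Rightarrow> real" and N x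
      using measurable_compose[OF that lin_measurable] .
    have l2: "(\<lambda>p. lin J a' (f p) x) \<in> borel_measurable N" if "f \<in> measurable N (gauss J)" for f :: "'q \<Rightarrow> 'j \<Rightarrow> real" and N x
      using measurable_compose[OF that lin_measurable] .
    define X where "X = lin I a"
    define Y where "Y = lin J a'"
    have "interp (s + \<epsilon>\<^sup>2) t = (\<integral>\<^sup>+w. (\<integral>\<^sup>+v. F (\<lambda>x. X (\<lambda>i\<in>I. sqrt (s + \<epsilon>\<^sup>2) * w i) x + sqrt t * Y v x) \<partial>gauss J) \<partial>gauss I)"
      by (simp add: interp_def F_def X_def Y_def lin_restrict1)
    also have "\<dots> = (\<integral>\<^sup>+w. \<integral>\<^sup>+w'. (\<integral>\<^sup>+v. F (\<lambda>x. X (\<lambda>i\<in>I. sqrt s * w i + \<epsilon> * w' i) x + sqrt t * Y v x) \<partial>gauss J) \<partial>gauss I \<partial>gauss I)"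
    proof (rule gauss_stable_sqrt[OF I st(1,3)])
      have "(\<lambda>p. F (\<lambda>x. X (fst p) x + sqrt t * Y (snd p) x)) \<in> borel_measurable (gauss I \<Otimes>\<^sub>M gauss J)"
        unfolding X_def Y_def by (intro Fm borel_measurable_add borel_measurable_times borel_measurable_const l1 l2) auto
      then show "(\<lambda>w. \<integral>\<^sup>+v. F (\<lambda>x. X w x + sqrt t * Y v x) \<partial>gauss J) \<in> borel_measurable (gauss I)"
        using PJ.borel_measurable_nn_integral_fst by fastforce
    qed
    also have "\<dots> = (\<integral>\<^sup>+w. \<integral>\<^sup>+w'. \<integral>\<^sup>+v. F (\<lambda>x. (sqrt s * X w x + sqrt t * Y v x) + \<epsilon> * X w' x) \<partial>gauss J \<partial>gauss I \<partial>gauss I)"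
      by (simp add: X_def lin_restrict add_ac)
    \<comment> \<open>The fresh increment has to be integrated innermost, so that the base point is
      fixed when it is exchanged.\<close>
    also have "\<dots> = (\<integral>\<^sup>+w. \<integral>\<^sup>+v. \<integral>\<^sup>+w'. F (\<lambda>x. (sqrt s * X w x + sqrt t * Y v x) + \<epsilon> * X w' x) \<partial>gauss I \<partial>gauss J \<partial>gauss I)"
    proof (rule nn_integral_cong)
      fix w
      have "(\<lambda>p. F (\<lambda>x. (sqrt s * X w x + sqrt t * Y (snd p) x) + \<epsilon> * X (fst p) x)) \<in> borel_measurable (gauss I \<Otimes>\<^sub>M gauss J)"
        unfolding X_def Y_def by (intro Fm borel_measurable_add borel_measurable_times borel_measurable_const l1 l2) auto
      then show "(\<integral>\<^sup>+w'. \<integral>\<^sup>+v. F (\<lambda>x. (sqrt s * X w x + sqrt t * Y v x) + \<epsilon> * X w' x) \<partial>gauss J \<partial>gauss I)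
        = (\<integral>\<^sup>+v. \<integral>\<^sup>+w'. F (\<lambda>x. (sqrt s * X w x + sqrt t * Y v x) + \<epsilon> * X w' x) \<partial>gauss I \<partial>gauss J)"
        by (intro P.Fubini'[symmetric]) (simp add: split_beta')
    qed
    \<comment> \<open>The exchange itself; the base point is sqrt s X + sqrt t Y.\<close>
    also have "\<dots> \<le> (\<integral>\<^sup>+w. \<integral>\<^sup>+v. (\<integral>\<^sup>+v'. F (\<lambda>x. (sqrt s * X w x + sqrt t * Y v x) + \<epsilon> * Y v' x) \<partial>gauss J)
        + ennreal (C * \<epsilon> ^ 3) * F (\<lambda>x. sqrt s * X w x + sqrt t * Y v x) \<partial>gauss J \<partial>gauss I)"
      unfolding F_def X_def Y_def by (intro nn_integral_mono C(2) st)
    also have "\<dots> = (\<integral>\<^sup>+w. (\<integral>\<^sup>+v. (\<integral>\<^sup>+v'. F (\<lambda>x. (sqrt s * X w x + sqrt t * Y v x) + \<epsilon> * Y v' x) \<partial>gauss J) \<partial>gauss J)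
        + ennreal (C * \<epsilon> ^ 3) * (\<integral>\<^sup>+v. F (\<lambda>x. sqrt s * X w x + sqrt t * Y v x) \<partial>gauss J) \<partial>gauss I)"
    proof (rule nn_integral_cong)
      fix w
      have "(\<lambda>p. F (\<lambda>x. (sqrt s * X w x + sqrt t * Y (fst p) x) + \<epsilon> * Y (snd p) x)) \<in> borel_measurable (gauss J \<Otimes>\<^sub>M gauss J)"
        unfolding X_def Y_def by (intro Fm borel_measurable_add borel_measurable_times borel_measurable_const l1 l2) auto
      then have 1: "(\<lambda>v. \<integral>\<^sup>+v'. F (\<lambda>x. (sqrt s * X w x + sqrt t * Y v x) + \<epsilon> * Y v' x) \<partial>gauss J) \<in> borel_measurable (gauss J)"
        using PJ.borel_measurable_nn_integral_fst by fastforce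
      have 2: "(\<lambda>v. F (\<lambda>x. sqrt s * X w x + sqrt t * Y v x)) \<in> borel_measurable (gauss J)"
        unfolding X_def Y_def by (intro Fm borel_measurable_add borel_measurable_times borel_measurable_const l1 l2) auto
      show "(\<integral>\<^sup>+v. (\<integral>\<^sup>+v'. F (\<lambda>x. (sqrt s * X w x + sqrt t * Y v x) + \<epsilon> * Y v' x) \<partial>gauss J)
        + ennreal (C * \<epsilon> ^ 3) * F (\<lambda>x. sqrt s * X w x + sqrt t * Y v x) \<partial>gauss J) =
        (\<integral>\<^sup>+v. (\<integral>\<^sup>+v'. F (\<lambda>x. (sqrt s * X w x + sqrt t * Y v x) + \<epsilon> * Y v' x) \<partial>gauss J) \<partial>gauss J)
        + ennreal (C * \<epsilon> ^ 3) * (\<integral>\<^sup>+v. F (\<lambda>x. sqrt s * X w x + sqrt t * Y v x) \<partial>gauss J)"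
        using 1 2 by (simp add: nn_integral_add nn_integral_cmult)
    qed
    \<comment> \<open>Stability in the opposite direction merges the new increment with the variance
      t of the second process.\<close>
    also have "\<dots> = (\<integral>\<^sup>+w. (\<integral>\<^sup>+v. F (\<lambda>x. sqrt s * X w x + sqrt (t + \<epsilon>\<^sup>2) * Y v x) \<partial>gauss J)
        + ennreal (C * \<epsilon> ^ 3) * (\<integral>\<^sup>+v. F (\<lambda>x. sqrt s * X w x + sqrt t * Y v x) \<partial>gauss J) \<partial>gauss I)"
    proof (rule nn_integral_cong, rule arg_cong2[where f="(+)", OF _ refl])
      fix w
      have "(\<integral>\<^sup>+v. F (\<lambda>x. sqrt s * X w x + Y (\<lambda>j\<in>J. sqrt (t + \<epsilon>\<^sup>2) * v j) x) \<partial>gauss J)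
        = (\<integral>\<^sup>+v. \<integral>\<^sup>+v'. F (\<lambda>x. sqrt s * X w x + Y (\<lambda>j\<in>J. sqrt t * v j + \<epsilon> * v' j) x) \<partial>gauss J \<partial>gauss J)"
        by (rule gauss_stable_sqrt[OF J st(2,3)])
           (unfold X_def Y_def, intro Fm borel_measurable_add borel_measurable_times borel_measurable_const l1 l2, auto)
      then show "(\<integral>\<^sup>+v. (\<integral>\<^sup>+v'. F (\<lambda>x. (sqrt s * X w x + sqrt t * Y v x) + \<epsilon> * Y v' x) \<partial>gauss J) \<partial>gauss J)
        = (\<integral>\<^sup>+v. F (\<lambda>x. sqrt s * X w x + sqrt (t + \<epsilon>\<^sup>2) * Y v x) \<partial>gauss J)"
        by (simp add: Y_def lin_restrict lin_restrict1 add_ac)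
    qed
    also have "\<dots> = interp s (t + \<epsilon>\<^sup>2) + ennreal (C * \<epsilon> ^ 3) * interp s t"
    proof -
      have "(\<lambda>p. F (\<lambda>x. sqrt s * X (fst p) x + r * Y (snd p) x)) \<in> borel_measurable (gauss I \<Otimes>\<^sub>M gauss J)" for r
        unfolding X_def Y_def by (intro Fm borel_measurable_add borel_measurable_times borel_measurable_const l1 l2) auto
      then have m: "(\<lambda>w. \<integral>\<^sup>+v. F (\<lambda>x. sqrt s * X w x + r * Y v x) \<partial>gauss J) \<in> borel_measurable (gauss I)" for r
        using PJ.borel_measurable_nn_integral_fst by fastforce
      show ?thesis
        using m by (simp add: nn_integral_add nn_integral_cmult interp_def F_def X_def Y_def)
    qed
    finally show ?thesis .
  qed
  then show ?thesis using C(1) by blast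
qed

lemma interp_endpoints: "interp 1 0 \<le> interp 0 1"
proof -
  obtain C where C: "C \<ge> 0" "\<And>s t \<epsilon>. 0 \<le> s \<Longrightarrow> 0 \<le> t \<Longrightarrow> 0 < \<epsilon> \<Longrightarrow> \<epsilon> \<le> 1 \<Longrightarrow>
     interp (s + \<epsilon>\<^sup>2) t \<le> interp s (t + \<epsilon>\<^sup>2) + ennreal (C * \<epsilon> ^ 3) * interp s t"
    using interp_step by blast
  obtain B where B: "B \<ge> 0" "\<And>s t. 0 \<le> s \<Longrightarrow> s \<le> 1 \<Longrightarrow> 0 \<le> t \<Longrightarrow> t \<le> 1 \<Longrightarrow> interp s t \<le> ennreal B"
    using interp_bounded by blast
  have bound: "interp 1 0 \<le> interp 0 1 + ennreal (C * B * (1 / sqrt (real n)))" if n: "n > 0" for n :: nat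
  proof -
    define \<epsilon> where "\<epsilon> = 1 / sqrt (real n)"
    have e: "0 < \<epsilon>" "\<epsilon> \<le> 1" "\<epsilon>\<^sup>2 = 1 / real n" using n by (auto simp: \<epsilon>_def power_divide)
    \<comment> \<open>After k replacements the variance k / n has moved, at a cost of at most C
      \<epsilon>^3 B each.\<close>
    have "k \<le> n \<Longrightarrow> interp 1 0 \<le> interp ((real n - real k) * \<epsilon>\<^sup>2) (real k * \<epsilon>\<^sup>2) + ennreal (real k * (C * \<epsilon> ^ 3 * B))" for k
    proof (induction k)
      case 0
      then show ?case using e n by simp
    next
      case (Suc k)
      \<comment> \<open>These are the variances of the part common to both sides of the replacement:
        the increment is added to the first process before it and to the second one after it, hence
        \<open>Suc k\<close> in \<open>?s\<close> but \<open>k\<close> in \<open>?t\<close>.\<close>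
      let ?s = "(real n - real (Suc k)) * \<epsilon>\<^sup>2" and ?t = "real k * \<epsilon>\<^sup>2"
      have s: "?s \<ge> 0" "?s \<le> 1" "?t \<ge> 0" "?t \<le> 1" using Suc.prems n unfolding e(3) by (auto simp: field_simps)
      have "interp (?s + \<epsilon>\<^sup>2) ?t \<le> interp ?s (?t + \<epsilon>\<^sup>2) + ennreal (C * \<epsilon> ^ 3) * interp ?s ?t"
        using s e by (intro C(2)) auto
      also have "\<dots> \<le> interp ?s (?t + \<epsilon>\<^sup>2) + ennreal (C * \<epsilon> ^ 3) * ennreal B"
        using s by (intro add_left_mono mult_left_mono B(2)) auto
      also have "\<dots> = interp ?s (?t + \<epsilon>\<^sup>2) + ennreal (C * \<epsilon> ^ 3 * B)"
        using C B e by (simp add: ennreal_mult)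
      finally have 1: "interp (?s + \<epsilon>\<^sup>2) ?t \<le> interp ?s (?t + \<epsilon>\<^sup>2) + ennreal (C * \<epsilon> ^ 3 * B)" .
      have eqs: "?s + \<epsilon>\<^sup>2 = (real n - real k) * \<epsilon>\<^sup>2" "?t + \<epsilon>\<^sup>2 = real (Suc k) * \<epsilon>\<^sup>2"
        by (simp_all add: algebra_simps)
      have "interp 1 0 \<le> interp ((real n - real k) * \<epsilon>\<^sup>2) (real k * \<epsilon>\<^sup>2) + ennreal (real k * (C * \<epsilon> ^ 3 * B))"
        using Suc by simp
      also have "\<dots> \<le> (interp ?s (real (Suc k) * \<epsilon>\<^sup>2) + ennreal (C * \<epsilon> ^ 3 * B)) + ennreal (real k * (C * \<epsilon> ^ 3 * B))"
        using 1 unfolding eqs by (intro add_right_mono)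
      also have "\<dots> = interp ?s (real (Suc k) * \<epsilon>\<^sup>2) + ennreal (C * \<epsilon> ^ 3 * B + real k * (C * \<epsilon> ^ 3 * B))"
        using C B e by (subst ennreal_plus) (auto simp: add.assoc)
      finally show ?case by (simp add: distrib_right)
    qed
    from this[of n] have "interp 1 0 \<le> interp 0 1 + ennreal (real n * (C * \<epsilon> ^ 3 * B))"
      using e n by simp
    also have "real n * (C * \<epsilon> ^ 3 * B) = C * B * (1 / sqrt (real n))"
    proof -
      have "real n * (C * \<epsilon> ^ 3 * B) = C * B * ((real n * \<epsilon>\<^sup>2) * \<epsilon>)"
        by (simp add: power2_eq_square power3_eq_cube)
      also have "real n * \<epsilon>\<^sup>2 = 1" using n e(3) by simp
      finally show ?thesis by (simp add: \<epsilon>_def)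
    qed
    finally show ?thesis .
  qed
  have "(\<lambda>n. C * B * (1 / sqrt (real n))) \<longlonglongrightarrow> 0"
    by real_asymp
  then have "(\<lambda>n. interp 0 1 + ennreal (C * B * (1 / sqrt (real n)))) \<longlonglongrightarrow> interp 0 1 + ennreal 0"
    by (intro tendsto_add tendsto_const tendsto_ennrealI)
  then have "interp 1 0 \<le> interp 0 1 + ennreal 0"
    by (rule tendsto_lowerbound) (intro eventually_sequentiallyI[of 1] bound, simp_all)
  then show ?thesis by simp
qed

theorem slepian_softmax:
  "(\<integral>w. softmax S b c (lin I a w) \<partial>gauss I) \<le> (\<integral>v. softmax S b c (lin J a' v) \<partial>gauss J)"
proof -
  interpret PI: prob_space "gauss I" by (rule prob_space_gauss)
  interpret PJ: prob_space "gauss J" by (rule prob_space_gauss)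
  \<comment> \<open>The expansion at \<epsilon> = 1 and z = 0, taken only for its integrability
    claim.\<close>
  have i1: "integrable (gauss I) (\<lambda>w. softmax S b c (\<lambda>s. 0 + 1 * lin I a w s))"
    using softmax_gauss_expansion[OF I, of a] by (elim exE conjE allE[of _ 1] allE[of _ "\<lambda>_. 0"]) simp
  have i2: "integrable (gauss J) (\<lambda>w. softmax S b c (\<lambda>s. 0 + 1 * lin J a' w s))"
    using softmax_gauss_expansion[OF J, of a'] by (elim exE conjE allE[of _ 1] allE[of _ "\<lambda>_. 0"]) simp
  have pos: "softmax S b c z \<ge> 0" for z using softmax_pos[OF S bc, of z] by simp
  have "ennreal (\<integral>w. softmax S b c (lin I a w) \<partial>gauss I) \<le> ennreal (\<integral>v. softmax S b c (lin J a' v) \<partial>gauss J)"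
    using interp_endpoints i1 i2 pos
    by (simp add: interp_def PI.emeasure_space_1 PJ.emeasure_space_1 nn_integral_eq_integral)
  then show ?thesis
    using pos by (subst (asm) ennreal_le_iff) (auto intro!: Bochner_Integration.integral_nonneg)
qed

end

end


section \<open>From the smooth maximum to the maximum\<close>

lemma Max_lin_measurable [measurable]:
  assumes "finite S" "S \<noteq> {}"
  shows "(\<lambda>w. Max ((\<lambda>s. lin I a w s) ` S)) \<in> borel_measurable (gauss I)"
  using assms by (intro borel_measurable_Max lin_measurable)

lemma integrable_exp_Max_lin:
  assumes S: "finite S" "S \<noteq> {}" and I: "finite I"
  shows "integrable (gauss I) (\<lambda>w. exp (c * Max (lin I a w ` S)))"
proof (rule integrable_gauss_exp_bound[OF I, where K = 1])
  show "(\<lambda>w. exp (c * Max (lin I a w ` S))) \<in> borel_measurable (gauss I)"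
    using S by measurable
  fix w
  have "Max (lin I a w ` S) \<in> lin I a w ` S" using S by (intro Max_in) auto
  then have "\<bar>Max (lin I a w ` S)\<bar> \<le> (\<Sum>s\<in>S. \<Sum>i\<in>I. \<bar>a s i\<bar>) * (\<Sum>i\<in>I. \<bar>w i\<bar>)"
    using lin_bound[OF I S(1)] by auto
  then have "\<bar>c * Max (lin I a w ` S)\<bar> \<le> \<bar>c\<bar> * ((\<Sum>s\<in>S. \<Sum>i\<in>I. \<bar>a s i\<bar>) * (\<Sum>i\<in>I. \<bar>w i\<bar>))"
    unfolding abs_mult by (intro mult_left_mono) auto
  then show "\<bar>exp (c * Max (lin I a w ` S))\<bar> \<le> 1 * exp (\<bar>c\<bar> * (\<Sum>s\<in>S. \<Sum>i\<in>I. \<bar>a s i\<bar>) * (\<Sum>i\<in>I. \<bar>w i\<bar>))"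
    by (simp add: mult.assoc)
qed

text \<open>The sandwich of \<open>softmax\<close> by exp (c max) on both sides loses only the
  factor \<open>card S\<close> to the power c / b, which tends to 1 as b grows with c fixed.\<close>

theorem slepian_exp_Max:
  fixes a :: "'s \<Rightarrow> 'i \<Rightarrow> real" and a' :: "'s \<Rightarrow> 'j \<Rightarrow> real"
  assumes S: "finite S" "S \<noteq> {}" and c: "0 < c" and I: "finite I" and J: "finite J"
    and var: "\<And>s. s \<in> S \<Longrightarrow> (\<Sum>i\<in>I. a s i * a s i) = (\<Sum>j\<in>J. a' s j * a' s j)"
    and cov: "\<And>s t. s \<in> S \<Longrightarrow> t \<in> S \<Longrightarrow> (\<Sum>j\<in>J. a' s j * a' t j) \<le> (\<Sum>i\<in>I. a s i * a t i)"
  shows "(\<integral>w. exp (c * Max (lin I a w ` S)) \<partial>gauss I) \<le> (\<integral>v. exp (c * Max (lin J a' v ` S)) \<partial>gauss J)"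
    (is "?L \<le> ?R")
proof -
  have b: "?L \<le> real (card S) powr (c / b) * ?R" if b: "c < b" for b
  proof -
    note bc = c b
    have i1: "integrable (gauss I) (\<lambda>w. softmax S b c (\<lambda>s. 0 + 1 * lin I a w s))"
      using softmax_gauss_expansion[OF S bc I, of a] by (elim exE conjE allE[of _ 1] allE[of _ "\<lambda>_. 0"]) simp
    have i2: "integrable (gauss J) (\<lambda>w. softmax S b c (\<lambda>s. 0 + 1 * lin J a' w s))"
      using softmax_gauss_expansion[OF S bc J, of a'] by (elim exE conjE allE[of _ 1] allE[of _ "\<lambda>_. 0"]) simp
    have "?L \<le> (\<integral>w. softmax S b c (lin I a w) \<partial>gauss I)"
    proof (rule integral_mono[OF integrable_exp_Max_lin[OF S I]])
      fix w
      have "Max (lin I a w ` S) \<in> lin I a w ` S" using S by (intro Max_in) auto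
      then show "exp (c * Max (lin I a w ` S)) \<le> softmax S b c (lin I a w)"
        using softmax_lower[OF S bc] by auto
    qed (use i1 in simp)
    also have "\<dots> \<le> (\<integral>v. softmax S b c (lin J a' v) \<partial>gauss J)"
      by (rule slepian_softmax[OF S bc I J var cov])
    also have "\<dots> \<le> (\<integral>v. real (card S) powr (c / b) * exp (c * Max (lin J a' v ` S)) \<partial>gauss J)"
      using i2 S by (intro integral_mono Bochner_Integration.integrable_mult_right integrable_exp_Max_lin J softmax_upper[OF S bc]) auto
    finally show ?thesis by simp
  qed
  \<comment> \<open>The sequence b = c + n + 1 always exceeds c, as the comparison for
    \<open>softmax\<close> demands.\<close>
  have "(\<lambda>n::nat. real (card S) powr (c / (c + real (Suc n))) * ?R) \<longlonglongrightarrow> real (card S) powr 0 * ?R"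
  proof (intro tendsto_mult tendsto_const tendsto_powr)
    show "(\<lambda>n::nat. c / (c + real (Suc n))) \<longlonglongrightarrow> 0" by real_asymp
  qed (use S in auto)
  then have "?L \<le> real (card S) powr 0 * ?R"
    by (rule tendsto_lowerbound) (use b in auto)
  then show ?thesis using S by simp
qed

section \<open>Independent blocks and the bilinear comparison\<close>

lemma gauss_integral_reindex:
  fixes f :: "('i \<Rightarrow> real) \<Rightarrow> real"
  assumes "inj_on p I" "p \<in> I \<rightarrow> K" "integrable (gauss I) f"
  shows "integrable (gauss K) (\<lambda>w. f (\<lambda>i\<in>I. w (p i)))"
    "(\<integral>w. f (\<lambda>i\<in>I. w (p i)) \<partial>gauss K) = (\<integral>w. f w \<partial>gauss I)"
proof -
  note D = gauss_reindex[OF assms(1,2)]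
  have m: "f \<in> borel_measurable (gauss I)" using assms(3) by simp
  show "integrable (gauss K) (\<lambda>w. f (\<lambda>i\<in>I. w (p i)))"
    using integrable_distr[OF D(2), of f] assms(3) D(1) by simp
  show "(\<integral>w. f (\<lambda>i\<in>I. w (p i)) \<partial>gauss K) = (\<integral>w. f w \<partial>gauss I)"
    using integral_distr[OF D(2) m] D(1) by simp
qed

text \<open>Functions of disjoint blocks of coordinates are independent; \<open>p\<close> and
  \<open>q\<close> embed the two blocks.\<close>

lemma gauss_integral_mult:
  fixes f :: "('i \<Rightarrow> real) \<Rightarrow> real" and g :: "('j \<Rightarrow> real) \<Rightarrow> real"
  assumes p: "inj_on p I" "p \<in> I \<rightarrow> K" and q: "inj_on q J" "q \<in> J \<rightarrow> K"
    and disj: "p ` I \<inter> q ` J = {}"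
    and f: "integrable (gauss I) f" and g: "integrable (gauss J) g"
  shows "(\<integral>w. f (\<lambda>i\<in>I. w (p i)) * g (\<lambda>j\<in>J. w (q j)) \<partial>gauss K)
    = (\<integral>w. f w \<partial>gauss I) * (\<integral>w. g w \<partial>gauss J)"
proof -
  interpret prob_space "gauss K" by (rule prob_space_gauss)
  have m: "(\<lambda>u. \<lambda>i\<in>L. u (r i)) \<in> measurable (PiM (r ` L) (\<lambda>_. borel)) (gauss L)" for r :: "'l \<Rightarrow> 'k" and L
    by (intro measurable_restrict)
       (auto simp: measurable_cong_sets[OF refl sets_stdn] intro: measurable_component_singleton)
  have "indep_var (PiM (p ` I) (\<lambda>_. borel)) (\<lambda>w. restrict (\<lambda>i. w i) (p ` I))
       (PiM (q ` J) (\<lambda>_. borel)) (\<lambda>w. restrict (\<lambda>i. w i) (q ` J))"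
    using p q by (intro indep_var_restrict[OF gauss_indep disj]) auto
  then have "indep_var borel ((\<lambda>u. f (\<lambda>i\<in>I. u (p i))) \<circ> (\<lambda>w. restrict (\<lambda>i. w i) (p ` I)))
       borel ((\<lambda>u. g (\<lambda>j\<in>J. u (q j))) \<circ> (\<lambda>w. restrict (\<lambda>i. w i) (q ` J)))"
    by (rule indep_var_compose)
       (use measurable_compose[OF m borel_measurable_integrable[OF f]]
            measurable_compose[OF m borel_measurable_integrable[OF g]] in auto)
  moreover have "(\<lambda>u. f (\<lambda>i\<in>I. u (p i))) \<circ> (\<lambda>w. restrict (\<lambda>i. w i) (p ` I)) = (\<lambda>w. f (\<lambda>i\<in>I. w (p i)))"
    by (auto simp: fun_eq_iff intro!: arg_cong[where f=f])
  moreover have "(\<lambda>u. g (\<lambda>j\<in>J. u (q j))) \<circ> (\<lambda>w. restrict (\<lambda>i. w i) (q ` J)) = (\<lambda>w. g (\<lambda>j\<in>J. w (q j)))"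
    by (auto simp: fun_eq_iff intro!: arg_cong[where f=g])
  ultimately have "indep_var borel (\<lambda>w. f (\<lambda>i\<in>I. w (p i))) borel (\<lambda>w. g (\<lambda>j\<in>J. w (q j)))"
    by simp
  from indep_var_lebesgue_integral[OF this gauss_integral_reindex(1)[OF p f] gauss_integral_reindex(1)[OF q g]]
  show ?thesis
    using gauss_integral_reindex(2)[OF p f] gauss_integral_reindex(2)[OF q g] by simp
qed

text \<open>Cauchy-Schwarz for unit vectors, termwise from 2 x y <= x^2 + y^2. It makes both factors
  of the covariance gap nonnegative.\<close>

lemma sum_mult_le_1:
  fixes x y :: "'i \<Rightarrow> real"
  assumes "(\<Sum>i\<in>I. (x i)\<^sup>2) = 1" "(\<Sum>i\<in>I. (y i)\<^sup>2) = 1"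
  shows "(\<Sum>i\<in>I. x i * y i) \<le> 1"
proof -
  have "(\<Sum>i\<in>I. x i * y i) \<le> (\<Sum>i\<in>I. ((x i)\<^sup>2 + (y i)\<^sup>2) / 2)"
  proof (rule sum_mono)
    fix i
    show "x i * y i \<le> ((x i)\<^sup>2 + (y i)\<^sup>2) / 2"
      using sum_squares_bound[of "x i" "y i"] by simp
  qed
  also have "\<dots> = 1" using assms by (simp add: sum.distrib add_divide_distrib sum_divide_distrib[symmetric])
  finally show ?thesis .
qed

lemma Max_add_Times:
  fixes f :: "'x \<Rightarrow> real" and g :: "'y \<Rightarrow> real"
  assumes "finite X" "X \<noteq> {}" "finite Y" "Y \<noteq> {}"
  shows "Max ((\<lambda>(x, y). f x + g y) ` (X \<times> Y)) = Max (f ` X) + Max (g ` Y)"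
proof (rule antisym)
  show "Max ((\<lambda>(x, y). f x + g y) ` (X \<times> Y)) \<le> Max (f ` X) + Max (g ` Y)"
    using assms by (intro Max.boundedI) (auto intro!: add_mono)
  have "Max (f ` X) \<in> f ` X" "Max (g ` Y) \<in> g ` Y" using assms by (auto intro!: Max_in)
  then obtain x y where "x \<in> X" "y \<in> Y" "Max (f ` X) = f x" "Max (g ` Y) = g y" by auto
  then show "Max (f ` X) + Max (g ` Y) \<le> Max ((\<lambda>(x, y). f x + g y) ` (X \<times> Y))"
    using assms by (intro Max_ge) auto
qed

text \<open>The coordinate \<open>None\<close> in the proof carries the extra normal variable that equalizes the variances.\<close>

theorem chevet_exp:
  fixes X :: "('j \<Rightarrow> real) set" and Y :: "('i \<Rightarrow> real) set" and I :: "'i set" and J :: "'j set"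
  assumes fin: "finite I" "finite J" and X: "finite X" "X \<noteq> {}" and Y: "finite Y" "Y \<noteq> {}"
    and nX: "\<And>x. x \<in> X \<Longrightarrow> (\<Sum>j\<in>J. (x j)\<^sup>2) = 1" and nY: "\<And>y. y \<in> Y \<Longrightarrow> (\<Sum>i\<in>I. (y i)\<^sup>2) = 1"
    and c: "c > 0"
  shows "exp (c\<^sup>2 / 2) * (\<integral>w. exp (c * Max ((\<lambda>(x, y). \<Sum>i\<in>I. \<Sum>j\<in>J. y i * w (i, j) * x j) ` (X \<times> Y))) \<partial>gauss (I \<times> J))
    \<le> (\<integral>w. exp (c * Max ((\<lambda>y. \<Sum>i\<in>I. w i * y i) ` Y)) \<partial>gauss I)
     * (\<integral>w. exp (c * Max ((\<lambda>x. \<Sum>j\<in>J. w j * x j) ` X)) \<partial>gauss J)"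
proof -
  let ?S = "X \<times> Y"
  let ?K = "insert None (Some ` (I \<times> J))"
  let ?L = "I <+> J"
  define a where "a = (\<lambda>(x::'j \<Rightarrow> real, y::'i \<Rightarrow> real). case_option 1 (\<lambda>(i, j). y i * x j))"
  define a' where "a' = (\<lambda>(x::'j \<Rightarrow> real, y::'i \<Rightarrow> real). case_sum y x)"
  have S: "finite ?S" "?S \<noteq> {}" using X Y by auto
  have sK: "(\<Sum>k\<in>?K. g k) = g None + (\<Sum>i\<in>I. \<Sum>j\<in>J. g (Some (i, j)))" for g :: "('i \<times> 'j) option \<Rightarrow> real"
    using fin by (simp add: sum.reindex sum.cartesian_product)
  have sL: "(\<Sum>k\<in>?L. g k) = (\<Sum>i\<in>I. g (Inl i)) + (\<Sum>j\<in>J. g (Inr j))" for g :: "'i + 'j \<Rightarrow> real"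
    using fin by (subst sum.Plus) auto
  have covK: "(\<Sum>k\<in>?K. a s k * a t k) = 1 + (\<Sum>i\<in>I. snd s i * snd t i) * (\<Sum>j\<in>J. fst s j * fst t j)" for s t
    unfolding sK by (simp add: a_def split_beta sum_product mult_ac)
  have covL: "(\<Sum>k\<in>?L. a' s k * a' t k) = (\<Sum>i\<in>I. snd s i * snd t i) + (\<Sum>j\<in>J. fst s j * fst t j)" for s t
    unfolding sL by (simp add: a'_def split_beta)
  have le: "(\<integral>w. exp (c * Max (lin ?K a w ` ?S)) \<partial>gauss ?K) \<le> (\<integral>v. exp (c * Max (lin ?L a' v ` ?S)) \<partial>gauss ?L)"
  proof (rule slepian_exp_Max[OF S c])
    fix s t assume st: "s \<in> ?S" "t \<in> ?S"
    have "(\<Sum>i\<in>I. snd s i * snd t i) \<le> 1" "(\<Sum>j\<in>J. fst s j * fst t j) \<le> 1"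
      using st nX nY by (auto intro!: sum_mult_le_1)
    then have "0 \<le> (1 - (\<Sum>i\<in>I. snd s i * snd t i)) * (1 - (\<Sum>j\<in>J. fst s j * fst t j))"
      by simp
    then show "(\<Sum>k\<in>?L. a' s k * a' t k) \<le> (\<Sum>k\<in>?K. a s k * a t k)"
      unfolding covK covL by (simp add: algebra_simps)
  next
    fix s assume "s \<in> ?S"
    then show "(\<Sum>k\<in>?K. a s k * a s k) = (\<Sum>k\<in>?L. a' s k * a' s k)"
      unfolding covK covL using nX nY by (auto simp: power2_eq_square)
  qed (use fin in auto)
  define B where "B w = Max ((\<lambda>(x, y). \<Sum>i\<in>I. \<Sum>j\<in>J. y i * w (i, j) * x j) ` ?S)" for w :: "'i \<times> 'j \<Rightarrow> real"
  define P where "P w = Max ((\<lambda>y. \<Sum>i\<in>I. w i * y i) ` Y)" for w :: "'i \<Rightarrow> real"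
  define Q where "Q w = Max ((\<lambda>x. \<Sum>j\<in>J. w j * x j) ` X)" for w :: "'j \<Rightarrow> real"
  have P: "P w = Max (lin I (\<lambda>y. y) w ` Y)" for w
    by (simp add: P_def lin_def[abs_def] mult.commute)
  have Q: "Q w = Max (lin J (\<lambda>x. x) w ` X)" for w
    by (simp add: Q_def lin_def[abs_def] mult.commute)
  have B: "B w = Max (lin (I \<times> J) (\<lambda>(x, y) (i, j). y i * x j) w ` ?S)" for w
    unfolding B_def lin_def
    by (intro arg_cong[where f=Max] image_cong refl) (auto simp: sum.cartesian_product mult_ac intro!: sum.cong)
  have iB: "integrable (gauss (I \<times> J)) (\<lambda>w. exp (c * B w))"
    unfolding B by (rule integrable_exp_Max_lin[OF S]) (use fin in auto)
  have iP: "integrable (gauss I) (\<lambda>w. exp (c * P w))"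
    unfolding P by (rule integrable_exp_Max_lin[OF Y fin(1)])
  have iQ: "integrable (gauss J) (\<lambda>w. exp (c * Q w))"
    unfolding Q by (rule integrable_exp_Max_lin[OF X fin(2)])
  have mK: "Max (lin ?K a w ` ?S) = w None + B (\<lambda>k\<in>I \<times> J. w (Some k))" for w
  proof -
    have "lin ?K a w s = w None + (case s of (x, y) \<Rightarrow> \<Sum>i\<in>I. \<Sum>j\<in>J. y i * w (Some (i, j)) * x j)" for s
      unfolding lin_def sK by (simp add: a_def split_beta mult_ac)
    then have "lin ?K a w ` ?S = (\<lambda>r. w None + r) ` (\<lambda>(x, y). \<Sum>i\<in>I. \<Sum>j\<in>J. y i * w (Some (i, j)) * x j) ` ?S"
      by (simp add: image_image)
    also have "Max \<dots> = w None + Max ((\<lambda>(x, y). \<Sum>i\<in>I. \<Sum>j\<in>J. y i * w (Some (i, j)) * x j) ` ?S)"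
      using S by (intro mono_Max_commute[symmetric]) (auto intro!: monoI)
    finally show ?thesis by (simp add: B_def)
  qed
  have mL: "Max (lin ?L a' w ` ?S) = P (\<lambda>i\<in>I. w (Inl i)) + Q (\<lambda>j\<in>J. w (Inr j))" for w
  proof -
    have "lin ?L a' w s = (case s of (x, y) \<Rightarrow> (\<Sum>j\<in>J. w (Inr j) * x j) + (\<Sum>i\<in>I. w (Inl i) * y i))" for s
      unfolding lin_def sL by (simp add: a'_def split_beta mult_ac)
    then have "Max (lin ?L a' w ` ?S) = Max ((\<lambda>(x, y). (\<Sum>j\<in>J. w (Inr j) * x j) + (\<Sum>i\<in>I. w (Inl i) * y i)) ` ?S)"
      by simp
    then show ?thesis
      by (simp add: Max_add_Times[OF X Y] P_def Q_def)
  qed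
  \<comment> \<open>The extra variable is written as a linear form over a one-element index type, so
    that the product formula for disjoint blocks applies and splits off the factor exp (c^2 /
    2).\<close>
  have "(\<integral>w. exp (c * Max (lin ?K a w ` ?S)) \<partial>gauss ?K)
     = (\<integral>w. exp (\<Sum>u\<in>{()}. c * (\<lambda>u\<in>{()}. w None) u) * exp (c * B (\<lambda>k\<in>I \<times> J. w (Some k))) \<partial>gauss ?K)"
    by (simp add: mK mult_exp_exp ring_distribs)
  also have "\<dots> = (\<integral>w. exp (\<Sum>u\<in>{()}. c * w u) \<partial>gauss {()}) * (\<integral>w. exp (c * B w) \<partial>gauss (I \<times> J))"
  proof (rule gauss_integral_mult[where f = "\<lambda>w. exp (\<Sum>u\<in>{()}. c * w u)" and p = "\<lambda>_. None" and q = Some])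
    show "integrable (gauss {()}) (\<lambda>w. exp (\<Sum>u\<in>{()}. c * w u))"
      using gauss.product_integrable_prod[of "{()}" "\<lambda>_ x. exp (c * x)"] has_bochner_integral_stdn_exp[of c]
      by (simp add: has_bochner_integral_iff)
  qed (use iB in auto)
  also have "\<dots> = exp (c\<^sup>2 / 2) * (\<integral>w. exp (c * B w) \<partial>gauss (I \<times> J))"
    by (subst integral_gauss_exp_linear) auto
  finally have eK: "(\<integral>w. exp (c * Max (lin ?K a w ` ?S)) \<partial>gauss ?K) = exp (c\<^sup>2 / 2) * (\<integral>w. exp (c * B w) \<partial>gauss (I \<times> J))" .
  have "(\<integral>v. exp (c * Max (lin ?L a' v ` ?S)) \<partial>gauss ?L)
    = (\<integral>w. exp (c * P (\<lambda>i\<in>I. w (Inl i))) * exp (c * Q (\<lambda>j\<in>J. w (Inr j))) \<partial>gauss ?L)"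
    by (simp add: mL mult_exp_exp ring_distribs)
  also have "\<dots> = (\<integral>w. exp (c * P w) \<partial>gauss I) * (\<integral>w. exp (c * Q w) \<partial>gauss J)"
    by (rule gauss_integral_mult[where f = "\<lambda>w. exp (c * P w)" and g = "\<lambda>w. exp (c * Q w)" and p = Inl and q = Inr])
       (use iP iQ in auto)
  finally show ?thesis
    using le eK unfolding B_def P_def Q_def by simp
qed

text \<open>Jensen's inequality by integrating the tangent of the exponential at the mean, which
  lies below the curve. Positivity of the exponential moment comes along with it.\<close>

lemma exp_expectation_le:
  assumes "prob_space M" and f: "integrable M f" "integrable M (\<lambda>x. exp (c * f x :: real))"
  shows "c * (\<integral>x. f x \<partial>M) \<le> ln (\<integral>x. exp (c * f x) \<partial>M)"
    "(\<integral>x. exp (c * f x) \<partial>M) > 0"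
proof -
  interpret prob_space M by fact
  let ?a = "\<integral>x. f x \<partial>M"
  have "(\<integral>x. exp (c * ?a) * (1 + (c * f x - c * ?a)) \<partial>M) \<le> (\<integral>x. exp (c * f x) \<partial>M)"
  proof (rule integral_mono)
    fix x
    have "exp (c * ?a) * (1 + (c * f x - c * ?a)) \<le> exp (c * ?a) * exp (c * f x - c * ?a)"
      by (intro mult_left_mono exp_ge_add_one_self) auto
    then show "exp (c * ?a) * (1 + (c * f x - c * ?a)) \<le> exp (c * f x)"
      by (simp add: mult_exp_exp)
  qed (use f in auto)
  also have "(\<integral>x. exp (c * ?a) * (1 + (c * f x - c * ?a)) \<partial>M) = exp (c * ?a)"
    using f by (simp add: prob_space)
  finally have *: "exp (c * ?a) \<le> (\<integral>x. exp (c * f x) \<partial>M)" .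
  moreover show pos: "(\<integral>x. exp (c * f x) \<partial>M) > 0"
    by (rule less_le_trans[OF _ *]) simp
  ultimately show "c * ?a \<le> ln (\<integral>x. exp (c * f x) \<partial>M)"
    by (simp add: ln_ge_iff)
qed

section \<open>Sums of the largest coordinates\<close>

text \<open>As a maximum over index sets rather than a sum over sorted values, it becomes
  superadditive simply by forming unions.\<close>

definition topsum :: "nat \<Rightarrow> nat \<Rightarrow> (nat \<Rightarrow> real) \<Rightarrow> real" where
  "topsum d k w = Max ((\<lambda>J. \<Sum>j\<in>J. w j) ` {J. J \<subseteq> {..<d} \<and> card J = k})"

lemma finite_subsets_card: "finite {J::nat set. J \<subseteq> {..<d} \<and> card J = k}"
  by simp

lemma subsets_card_nonempty: "k \<le> d \<Longrightarrow> {J. J \<subseteq> {..<d} \<and> card J = k} \<noteq> {}"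
  by (rule ex_in_conv[THEN iffD1]) (auto intro!: exI[of _ "{..<k}"])

lemma topsum_ge: "J \<subseteq> {..<d} \<Longrightarrow> card J = k \<Longrightarrow> (\<Sum>j\<in>J. w j) \<le> topsum d k w"
  unfolding topsum_def by (intro Max_ge) auto

lemma topsum_attained:
  assumes "k \<le> d"
  obtains J where "J \<subseteq> {..<d}" "card J = k" "topsum d k w = (\<Sum>j\<in>J. w j)"
proof -
  have "topsum d k w \<in> (\<lambda>J. \<Sum>j\<in>J. w j) ` {J. J \<subseteq> {..<d} \<and> card J = k}"
    unfolding topsum_def using subsets_card_nonempty[OF assms] by (intro Max_in) auto
  then show thesis using that by auto
qed

lemma topsum_cong: "(\<And>i. i < d \<Longrightarrow> w i = v i) \<Longrightarrow> topsum d k w = topsum d k v"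
  unfolding topsum_def by (intro arg_cong[where f=Max] image_cong refl sum.cong) auto

lemma topsum_restrict [simp]: "topsum d k (\<lambda>i\<in>{..<d}. w i) = topsum d k w"
  by (rule topsum_cong) simp

lemma topsum_measurable:
  assumes "k \<le> d"
  shows "topsum d k \<in> borel_measurable (gauss {..<d})"
proof -
  have "(\<lambda>w. Max ((\<lambda>J. \<Sum>j\<in>J. w j) ` {J. J \<subseteq> {..<d} \<and> card J = k})) \<in> borel_measurable (gauss {..<d})"
    using subsets_card_nonempty[OF assms]
    by (intro borel_measurable_Max finite_subsets_card borel_measurable_sum)
       (auto simp: measurable_cong_sets[OF refl sets_stdn, symmetric] intro!: measurable_component_singleton)
  then show ?thesis by (simp add: topsum_def[abs_def])
qed

lemma topsum_abs_le:
  assumes "k \<le> d"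
  shows "\<bar>topsum d k w\<bar> \<le> (\<Sum>i<d. \<bar>w i\<bar>)"
proof -
  obtain J where J: "J \<subseteq> {..<d}" "topsum d k w = (\<Sum>j\<in>J. w j)"
    using topsum_attained[OF assms] by metis
  have "\<bar>\<Sum>j\<in>J. w j\<bar> \<le> (\<Sum>j\<in>J. \<bar>w j\<bar>)" by (rule sum_abs)
  also have "\<dots> \<le> (\<Sum>i<d. \<bar>w i\<bar>)" using J by (intro sum_mono2) auto
  finally show ?thesis using J by simp
qed

lemma integrable_exp_topsum:
  assumes "k \<le> d"
  shows "integrable (gauss {..<d}) (\<lambda>w. exp (s * topsum d k w))"
proof (rule integrable_gauss_exp_bound[where K = 1 and C = "\<bar>s\<bar>"])
  show "(\<lambda>w. exp (s * topsum d k w)) \<in> borel_measurable (gauss {..<d})"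
    using topsum_measurable[OF assms] by simp
  fix w
  have "\<bar>s * topsum d k w\<bar> \<le> \<bar>s\<bar> * (\<Sum>i<d. \<bar>w i\<bar>)"
    unfolding abs_mult by (intro mult_left_mono topsum_abs_le assms) auto
  then show "\<bar>exp (s * topsum d k w)\<bar> \<le> 1 * exp (\<bar>s\<bar> * (\<Sum>i<d. \<bar>w i\<bar>))" by simp
qed simp

lemma integrable_topsum:
  assumes "k \<le> d"
  shows "integrable (gauss {..<d}) (topsum d k)"
proof (rule integrable_gauss_exp_bound[where K = 1 and C = 1])
  fix w
  have "\<bar>topsum d k w\<bar> \<le> (\<Sum>i<d. \<bar>w i\<bar>)"
    by (rule topsum_abs_le[OF assms])
  also have "\<dots> \<le> exp (\<Sum>i<d. \<bar>w i\<bar>)"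
    using exp_ge_add_one_self[of "\<Sum>i<d. \<bar>w i\<bar>"] by linarith
  finally show "\<bar>topsum d k w\<bar> \<le> 1 * exp (1 * (\<Sum>i<d. \<bar>w i\<bar>))" by simp
qed (use topsum_measurable[OF assms] in auto)

text \<open>Optimal index sets of two consecutive blocks, the second one shifted by
  \<open>d1\<close>, unite to a competitor for the whole range.\<close>

lemma topsum_superadditive:
  assumes "k1 \<le> d1" "k2 \<le> d2"
  shows "topsum d1 k1 w + topsum d2 k2 (\<lambda>i. w (d1 + i)) \<le> topsum (d1 + d2) (k1 + k2) w"
proof -
  obtain J1 where J1: "J1 \<subseteq> {..<d1}" "card J1 = k1" "topsum d1 k1 w = (\<Sum>j\<in>J1. w j)"
    using topsum_attained[OF assms(1)] by metis
  obtain J2 where J2: "J2 \<subseteq> {..<d2}" "card J2 = k2" "topsum d2 k2 (\<lambda>i. w (d1 + i)) = (\<Sum>j\<in>J2. w (d1 + j))"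
    using topsum_attained[OF assms(2), of "\<lambda>i. w (d1 + i)"] by metis
  let ?J = "J1 \<union> (+) d1 ` J2"
  have fin: "finite J1" "finite J2" using J1 J2 finite_subset by blast+
  have disj: "J1 \<inter> (+) d1 ` J2 = {}" using J1 by auto
  have "card ?J = k1 + k2"
    using fin disj J1 J2 by (simp add: card_Un_disjoint card_image)
  moreover have "?J \<subseteq> {..<d1 + d2}" using J1 J2 by auto
  ultimately have "(\<Sum>j\<in>?J. w j) \<le> topsum (d1 + d2) (k1 + k2) w" by (intro topsum_ge)
  moreover have "(\<Sum>j\<in>?J. w j) = (\<Sum>j\<in>J1. w j) + (\<Sum>j\<in>J2. w (d1 + j))"
    using fin disj by (simp add: sum.union_disjoint sum.reindex)
  ultimately show ?thesis using J1 J2 by simp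
qed

section \<open>Means and cumulant generating functions of top sums\<close>

definition mean_top :: "nat \<Rightarrow> nat \<Rightarrow> real" where
  "mean_top d k = (\<integral>w. topsum d k w \<partial>gauss {..<d})"

definition cgf_top :: "real \<Rightarrow> nat \<Rightarrow> nat \<Rightarrow> real" where
  "cgf_top s d k = ln (\<integral>w. exp (s * topsum d k w) \<partial>gauss {..<d})"

lemma exp_topsum_pos:
  assumes "k \<le> d"
  shows "(\<integral>w. exp (s * topsum d k w) \<partial>gauss {..<d}) > 0"
  by (rule exp_expectation_le(2)[OF prob_space_gauss integrable_topsum integrable_exp_topsum]) fact+

lemma exp_cgf_top: "k \<le> d \<Longrightarrow> exp (cgf_top s d k) = (\<integral>w. exp (s * topsum d k w) \<partial>gauss {..<d})"
  unfolding cgf_top_def using exp_topsum_pos by simp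

lemma mean_top_superadditive:
  assumes "k1 \<le> d1" "k2 \<le> d2"
  shows "mean_top d1 k1 + mean_top d2 k2 \<le> mean_top (d1 + d2) (k1 + k2)"
proof -
  let ?K = "{..<d1 + d2}"
  have p: "inj_on id {..<d1}" "id \<in> {..<d1} \<rightarrow> ?K" and q: "inj_on ((+) d1) {..<d2}" "(+) d1 \<in> {..<d2} \<rightarrow> ?K"
    by auto
  note 1 = gauss_integral_reindex[OF p integrable_topsum[OF assms(1)]]
  note 2 = gauss_integral_reindex[OF q integrable_topsum[OF assms(2)]]
  have "mean_top d1 k1 + mean_top d2 k2 = (\<integral>w. topsum d1 k1 w + topsum d2 k2 (\<lambda>i. w (d1 + i)) \<partial>gauss ?K)"
    unfolding mean_top_def using 1 2 by simp
  also have "\<dots> \<le> mean_top (d1 + d2) (k1 + k2)"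
    unfolding mean_top_def
    using 1 2 assms by (intro integral_mono topsum_superadditive integrable_topsum Bochner_Integration.integrable_add) auto
  finally show ?thesis .
qed

text \<open>Consecutive blocks are independent copies, so the exponential moment of the sum of their
  top sums factorises; the logarithm turns the product into a sum.\<close>

lemma cgf_top_superadditive:
  assumes "k1 \<le> d1" "k2 \<le> d2" and s: "s \<ge> 0"
  shows "cgf_top s d1 k1 + cgf_top s d2 k2 \<le> cgf_top s (d1 + d2) (k1 + k2)"
proof -
  let ?K = "{..<d1 + d2}"
  have p: "inj_on id {..<d1}" "id \<in> {..<d1} \<rightarrow> ?K" and q: "inj_on ((+) d1) {..<d2}" "(+) d1 \<in> {..<d2} \<rightarrow> ?K"
    by auto
  note i1 = integrable_exp_topsum[OF assms(1), of s] and i2 = integrable_exp_topsum[OF assms(2), of s]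
  have eq: "(\<integral>w. exp (s * topsum d1 k1 w) * exp (s * topsum d2 k2 (\<lambda>i. w (d1 + i))) \<partial>gauss ?K)
    = exp (cgf_top s d1 k1 + cgf_top s d2 k2)"
    using gauss_integral_mult[OF p q _ i1 i2] assms by (auto simp: exp_add exp_cgf_top)
  have "exp (cgf_top s d1 k1 + cgf_top s d2 k2) \<le> (\<integral>w. exp (s * topsum (d1 + d2) (k1 + k2) w) \<partial>gauss ?K)"
    unfolding eq[symmetric]
  proof (rule integral_mono)
    show i3: "integrable (gauss ?K) (\<lambda>w. exp (s * topsum (d1 + d2) (k1 + k2) w))"
      using assms by (intro integrable_exp_topsum) auto
    show le: "exp (s * topsum d1 k1 w) * exp (s * topsum d2 k2 (\<lambda>i. w (d1 + i))) \<le> exp (s * topsum (d1 + d2) (k1 + k2) w)" for w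
      using mult_left_mono[OF topsum_superadditive[OF assms(1,2), of w] s] by (simp add: mult_exp_exp distrib_left)
    show "integrable (gauss ?K) (\<lambda>w. exp (s * topsum d1 k1 w) * exp (s * topsum d2 k2 (\<lambda>i. w (d1 + i))))"
    proof (rule Bochner_Integration.integrable_bound[OF i3])
      show "(\<lambda>w. exp (s * topsum d1 k1 w) * exp (s * topsum d2 k2 (\<lambda>i. w (d1 + i)))) \<in> borel_measurable (gauss ?K)"
        using gauss_integral_reindex(1)[OF p i1] gauss_integral_reindex(1)[OF q i2]
        by (intro borel_measurable_times) (auto dest: borel_measurable_integrable)
      show "AE w in gauss ?K. norm (exp (s * topsum d1 k1 w) * exp (s * topsum d2 k2 (\<lambda>i. w (d1 + i)))) \<le>
         norm (exp (s * topsum (d1 + d2) (k1 + k2) w))"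
        using le by (intro AE_I2) (simp add: abs_mult)
    qed
  qed
  also have "\<dots> = exp (cgf_top s (d1 + d2) (k1 + k2))"
    using assms by (simp add: exp_cgf_top)
  finally show ?thesis by simp
qed

lemma mean_top_nonneg:
  assumes "k \<le> d"
  shows "mean_top d k \<ge> 0"
proof -
  have *: "has_bochner_integral (gauss {..<d}) (\<lambda>w. \<Sum>i\<in>{..<k}. w i) (\<Sum>i\<in>{..<k}. 0)"
    using assms by (intro has_bochner_integral_sum gauss_component_integral[OF _ stdn_moment_1]) auto
  have "(\<integral>w. (\<Sum>i\<in>{..<k}. w i) \<partial>gauss {..<d}) \<le> mean_top d k"
    unfolding mean_top_def using * assms
    by (intro integral_mono integrable_topsum topsum_ge) (auto simp: has_bochner_integral_iff)
  then show ?thesis using * by (simp add: has_bochner_integral_iff)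
qed

lemma mean_top_le_cgf_top: "k \<le> d \<Longrightarrow> s * mean_top d k \<le> cgf_top s d k"
  unfolding mean_top_def cgf_top_def
  by (intro exp_expectation_le(1) prob_space_gauss integrable_topsum integrable_exp_topsum)

text \<open>The fixed set \<open>{..<k}\<close> competes in the maximum, and its sum is normal with
  mean 0 and variance \<open>k\<close>.\<close>

lemma cgf_top_lower:
  assumes "k \<le> d" "s \<ge> 0"
  shows "real k * s\<^sup>2 / 2 \<le> cgf_top s d k"
proof -
  have i: "integrable (gauss {..<d}) (\<lambda>w. exp (\<Sum>i<d. (if i < k then s else 0) * w i))"
    by (rule integrable_gauss_exp_bound[where K = 1 and C = s])
       (use assms in \<open>auto simp: sum_distrib_left abs_if intro!: sum_mono mult_nonneg_nonpos\<close>)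
  have "exp (real k * s\<^sup>2 / 2) = (\<integral>w. exp (\<Sum>i<d. (if i < k then s else 0) * w i) \<partial>gauss {..<d})"
  proof (subst integral_gauss_exp_linear)
    have "{..<d} \<inter> {i. i < k} = {..<k}" using assms by auto
    then have "(\<Sum>i<d. (if i < k then s else 0)\<^sup>2) = real k * s\<^sup>2"
      by (simp add: if_distrib[of "\<lambda>x. x\<^sup>2"] sum.If_cases cong: if_cong)
    then show "exp (real k * s\<^sup>2 / 2) = exp ((\<Sum>i<d. (if i < k then s else 0)\<^sup>2) / 2)" by simp
  qed simp
  also have "\<dots> \<le> (\<integral>w. exp (s * topsum d k w) \<partial>gauss {..<d})"
  proof (intro integral_mono i integrable_exp_topsum assms)
    fix w :: "nat \<Rightarrow> real"
    have "{..<d} \<inter> {i. i < k} = {..<k}" using assms by auto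
    then have "(\<Sum>i<d. (if i < k then s else 0) * w i) = s * (\<Sum>i<k. w i)"
      by (simp add: if_distrib[of "\<lambda>x. x * _"] sum.If_cases sum_distrib_left cong: if_cong)
    also have "\<dots> \<le> s * topsum d k w"
      using assms by (intro mult_left_mono topsum_ge) auto
    finally show "exp (\<Sum>i<d. (if i < k then s else 0) * w i) \<le> exp (s * topsum d k w)" by simp
  qed
  finally show ?thesis
    using assms by (simp only: exp_cgf_top[symmetric] exp_le_cancel_iff)
qed

lemma cgf_top_nonneg: "k \<le> d \<Longrightarrow> s \<ge> 0 \<Longrightarrow> cgf_top s d k \<ge> 0"
  using cgf_top_lower[of k d s] by (rule order_trans[rotated]) auto

text \<open>The bound comes from \<open>topsum d k w \<le> k \<theta> + (\<Sum>i<d. max 0 (w i - \<theta>))\<close>, an equality when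
  \<open>\<theta>\<close> is the \<open>k\<close>-th largest value.\<close>

lemma cgf_top_upper:
  assumes "k \<le> d" "s \<ge> 0"
  shows "cgf_top s d k \<le> real d * (s\<^sup>2 / 2 + exp (s * \<theta> - s\<^sup>2 / 2)) - s * \<theta> * (real d - real k)"
proof -
  have top: "topsum d k w \<le> real k * \<theta> + (\<Sum>i<d. max 0 (w i - \<theta>))" for w
  proof -
    obtain J where J: "J \<subseteq> {..<d}" "card J = k" "topsum d k w = (\<Sum>j\<in>J. w j)"
      using topsum_attained[OF assms(1)] by metis
    have "(\<Sum>j\<in>J. w j) = real k * \<theta> + (\<Sum>j\<in>J. w j - \<theta>)"
      using J by (simp add: sum_subtractf)
    also have "(\<Sum>j\<in>J. w j - \<theta>) \<le> (\<Sum>j\<in>J. max 0 (w j - \<theta>))" by (intro sum_mono) auto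
    also have "(\<Sum>j\<in>J. max 0 (w j - \<theta>)) \<le> (\<Sum>i<d. max 0 (w i - \<theta>))"
      using J by (intro sum_mono2) auto
    finally show ?thesis using J by simp
  qed
  have le: "exp (s * topsum d k w) \<le> exp (s * (real k * \<theta>)) * (\<Prod>i<d. 1 + exp (- s * \<theta>) * exp (s * w i))" for w
  proof -
    have "exp (s * topsum d k w) \<le> exp (s * (real k * \<theta> + (\<Sum>i<d. max 0 (w i - \<theta>))))"
      using mult_left_mono[OF top assms(2)] by simp
    also have "\<dots> = exp (s * (real k * \<theta>)) * (\<Prod>i<d. exp (s * max 0 (w i - \<theta>)))"
      by (simp add: distrib_left exp_add sum_distrib_left exp_sum)
    \<comment> \<open>The positive part is removed by exp (s max 0 y) <= 1 + exp (s y), leaving a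
      product of independent factors with explicit means.\<close>
    also have "(\<Prod>i<d. exp (s * max 0 (w i - \<theta>))) \<le> (\<Prod>i<d. 1 + exp (- s * \<theta>) * exp (s * w i))"
      by (intro prod_mono) (auto simp: max_def mult_exp_exp algebra_simps)
    finally show ?thesis by simp
  qed
  have i1: "integrable stdn (\<lambda>x. 1 + exp (- s * \<theta>) * exp (s * x))"
    using has_bochner_integral_stdn_exp[of s] by (auto simp: has_bochner_integral_iff)
  have "(\<integral>w. exp (s * topsum d k w) \<partial>gauss {..<d})
      \<le> (\<integral>w. exp (s * (real k * \<theta>)) * (\<Prod>i<d. 1 + exp (- s * \<theta>) * exp (s * w i)) \<partial>gauss {..<d})"
    by (intro integral_mono le integrable_exp_topsum assms Bochner_Integration.integrable_mult_right
        gauss.product_integrable_prod i1) simp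
  also have "\<dots> = exp (s * (real k * \<theta>)) * (\<Prod>i<d. \<integral>x. 1 + exp (- s * \<theta>) * exp (s * x) \<partial>stdn)"
    using gauss.product_integral_prod[of "{..<d}", OF _ i1] by simp
  also have "(\<integral>x. 1 + exp (- s * \<theta>) * exp (s * x) \<partial>stdn) = 1 + exp (- s * \<theta>) * exp (s\<^sup>2 / 2)"
    using has_bochner_integral_stdn_exp[of s] by (simp add: has_bochner_integral_iff stdn.prob_space[simplified])
  also have "exp (s * (real k * \<theta>)) * (\<Prod>i<d. 1 + exp (- s * \<theta>) * exp (s\<^sup>2 / 2))
     = exp (s * (real k * \<theta>)) * (1 + exp (s\<^sup>2 / 2 - s * \<theta>)) ^ d"
    by (simp add: mult_exp_exp add.commute)
  \<comment> \<open>This factor is extracted before 1 + x <= exp x is applied, so that the estimate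
    stays sharp for very negative \<theta>, the regime needed when k / d tends to 1.\<close>
  also have "1 + exp (s\<^sup>2 / 2 - s * \<theta>) = exp (s\<^sup>2 / 2 - s * \<theta>) * (1 + exp (s * \<theta> - s\<^sup>2 / 2))"
    by (simp add: distrib_left mult_exp_exp)
  also have "exp (s * (real k * \<theta>)) * (exp (s\<^sup>2 / 2 - s * \<theta>) * (1 + exp (s * \<theta> - s\<^sup>2 / 2))) ^ d
    \<le> exp (s * (real k * \<theta>)) * (exp (s\<^sup>2 / 2 - s * \<theta>) * exp (exp (s * \<theta> - s\<^sup>2 / 2))) ^ d"
    by (intro mult_left_mono power_mono exp_ge_add_one_self add_nonneg_nonneg mult_nonneg_nonneg) auto
  also have "\<dots> = exp (real d * (s\<^sup>2 / 2 + exp (s * \<theta> - s\<^sup>2 / 2)) - s * \<theta> * (real d - real k))"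
    by (simp add: mult_exp_exp exp_of_nat_mult[symmetric] algebra_simps)
  finally show ?thesis
    using assms by (simp add: exp_cgf_top[symmetric])
qed

text \<open>Hoelder's inequality in normalised form: exp (u s) has integral 1 for every s, and
  pointwise convexity of the exponential bounds the geometric mean of two such densities by their
  arithmetic mean.\<close>

lemma cgf_top_convex:
  assumes k: "k \<le> d"
  shows "convex_on UNIV (\<lambda>s. cgf_top s d k)"
proof (rule convex_onI)
  fix t x y :: real
  assume t: "0 < t" "t < 1"
  define u where "u = (\<lambda>s w. s * topsum d k w - cgf_top s d k)"
  have i: "integrable (gauss {..<d}) (\<lambda>w. exp (u s w))" "(\<integral>w. exp (u s w) \<partial>gauss {..<d}) = 1" for s
    using integrable_exp_topsum[OF k, of s] exp_cgf_top[OF k, of s] exp_topsum_pos[OF k, of s] unfolding u_def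
    by (auto simp: exp_diff)
  let ?z = "(1 - t) *\<^sub>R x + t *\<^sub>R y"
  have eq: "exp ((1 - t) * u x w + t * u y w) = exp (?z * topsum d k w) * exp (- ((1 - t) * cgf_top x d k + t * cgf_top y d k))" for w
    unfolding u_def by (simp add: mult_exp_exp algebra_simps)
  have "exp (cgf_top ?z d k) * exp (- ((1 - t) * cgf_top x d k + t * cgf_top y d k))
     = (\<integral>w. exp ((1 - t) * u x w + t * u y w) \<partial>gauss {..<d})"
    unfolding eq exp_cgf_top[OF k] by simp
  also have "\<dots> \<le> (\<integral>w. (1 - t) * exp (u x w) + t * exp (u y w) \<partial>gauss {..<d})"
  proof (rule integral_mono)
    show "integrable (gauss {..<d}) (\<lambda>w. exp ((1 - t) * u x w + t * u y w))"
      unfolding eq using integrable_exp_topsum[OF k] by simp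
    show "exp ((1 - t) * u x w + t * u y w) \<le> (1 - t) * exp (u x w) + t * exp (u y w)" for w
      using convex_onD[OF exp_convex, of t "u x w" "u y w"] t by simp
  qed (use i(1) in auto)
  also have "\<dots> = 1" using i by simp
  finally show "cgf_top ?z d k \<le> (1 - t) * cgf_top x d k + t * cgf_top y d k"
    by (simp add: mult_exp_exp)
qed simp

lemma cgf_top_0: "cgf_top 0 d k = 0"
proof -
  interpret prob_space "gauss {..<d} :: (nat \<Rightarrow> real) measure" by (rule prob_space_gauss)
  show ?thesis by (simp add: cgf_top_def prob_space)
qed

text \<open>A convex function vanishing at 0 has chord slopes from 0 that increase.\<close>

lemma cgf_top_scale:
  assumes "k \<le> d" "0 < s" "s \<le> t"
  shows "cgf_top s d k / s \<le> cgf_top t d k / t"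
proof -
  have "cgf_top ((1 - s / t) *\<^sub>R 0 + (s / t) *\<^sub>R t) d k \<le> (1 - s / t) * cgf_top 0 d k + (s / t) * cgf_top t d k"
    using assms by (intro convex_onD[OF cgf_top_convex]) auto
  then show ?thesis using assms by (simp add: cgf_top_0 field_simps)
qed

lemma cgf_top_mono:
  assumes "k \<le> d" "0 \<le> s" "s \<le> t"
  shows "cgf_top s d k \<le> cgf_top t d k"
proof (cases "s = 0")
  case True
  then show ?thesis
    using cgf_top_nonneg[of k d t] assms by (simp add: cgf_top_0)
next
  case False
  have nn: "cgf_top t d k \<ge> 0"
    using cgf_top_nonneg[of k d t] assms by simp
  have "cgf_top s d k \<le> s * (cgf_top t d k / t)"
    using cgf_top_scale[of k d s t] False assms by (simp add: field_simps)
  also have "\<dots> \<le> t * (cgf_top t d k / t)" using assms False nn by (intro mult_right_mono) auto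
  finally show ?thesis using False assms by simp
qed

text \<open>Jensen gives the lower bound, and a second-order Maclaurin bound for the exponential
  gives the upper one with error s B.\<close>

lemma cgf_top_small:
  assumes k: "k \<le> d"
  shows "((\<lambda>s. cgf_top s d k / s) \<longlongrightarrow> mean_top d k) (at_right 0)"
proof -
  \<comment> \<open>For s up to 1 the weight exp |\<open>topsum\<close>| dominates the exponential
    in the remainder, so one finite constant serves for all such s.\<close>
  define B where "B = (\<integral>w. (topsum d k w)\<^sup>2 * exp \<bar>topsum d k w\<bar> \<partial>gauss {..<d})"
  have iB: "integrable (gauss {..<d}) (\<lambda>w. (topsum d k w)\<^sup>2 * exp \<bar>topsum d k w\<bar>)"
  proof (rule integrable_gauss_exp_bound[where K = 2 and C = 2])
    fix w
    have sq: "x\<^sup>2 \<le> 2 * exp x" if "x \<ge> 0" for x :: real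
      using exp_lower_Taylor_quadratic[OF that] that by simp
    have "\<bar>(topsum d k w)\<^sup>2 * exp \<bar>topsum d k w\<bar>\<bar> = \<bar>topsum d k w\<bar>\<^sup>2 * exp \<bar>topsum d k w\<bar>" by simp
    also have "\<dots> \<le> 2 * exp \<bar>topsum d k w\<bar> * exp \<bar>topsum d k w\<bar>"
      by (intro mult_right_mono sq) auto
    also have "\<dots> = 2 * exp (2 * \<bar>topsum d k w\<bar>)" by (simp add: mult_exp_exp)
    also have "\<dots> \<le> 2 * exp (2 * (\<Sum>i<d. \<bar>w i\<bar>))" using topsum_abs_le[OF k] by simp
    finally show "\<bar>(topsum d k w)\<^sup>2 * exp \<bar>topsum d k w\<bar>\<bar> \<le> 2 * exp (2 * (\<Sum>i<d. \<bar>w i\<bar>))" .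
  qed (use topsum_measurable[OF k] in auto)
  interpret prob_space "gauss {..<d} :: (nat \<Rightarrow> real) measure" by (rule prob_space_gauss)
  have up: "cgf_top s d k / s \<le> mean_top d k + s * B" if s: "0 < s" "s \<le> 1" for s
  proof -
    have "(\<integral>w. exp (s * topsum d k w) \<partial>gauss {..<d}) \<le>
       (\<integral>w. 1 + s * topsum d k w + s\<^sup>2 * ((topsum d k w)\<^sup>2 * exp \<bar>topsum d k w\<bar>) \<partial>gauss {..<d})"
    proof (rule integral_mono[OF integrable_exp_topsum[OF k]])
      fix w
      let ?x = "topsum d k w"
      have "exp (s * ?x) \<le> 1 + s * ?x + \<bar>s * ?x\<bar>\<^sup>2 * exp \<bar>s * ?x\<bar>"
      proof -
        obtain t where t: "\<bar>t\<bar> \<le> \<bar>s * ?x\<bar>" "exp (s * ?x) = (\<Sum>m<2. (s * ?x) ^ m / fact m) + exp t / fact 2 * (s * ?x) ^ 2"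
          using Maclaurin_exp_le[of "s * ?x" 2] by blast
        have "exp t / 2 * (s * ?x)\<^sup>2 \<le> exp \<bar>s * ?x\<bar> * (s * ?x)\<^sup>2"
        proof (intro mult_right_mono)
          have "exp t \<le> exp \<bar>s * ?x\<bar>" using t(1) by simp
          then show "exp t / 2 \<le> exp \<bar>s * ?x\<bar>" using exp_gt_zero[of t] by linarith
        qed simp
        then show ?thesis unfolding t(2) by (simp add: numeral_2_eq_2 mult_ac)
      qed
      also have "\<bar>s * ?x\<bar>\<^sup>2 * exp \<bar>s * ?x\<bar> \<le> s\<^sup>2 * (?x\<^sup>2 * exp \<bar>?x\<bar>)"
        using s by (auto simp: power_mult_distrib abs_mult mult_left_le_one_le intro!: mult_left_mono)
      finally show "exp (s * ?x) \<le> 1 + s * ?x + s\<^sup>2 * (?x\<^sup>2 * exp \<bar>?x\<bar>)" by simp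
    qed (use iB integrable_topsum[OF k] in auto)
    also have "\<dots> = 1 + s * mean_top d k + s\<^sup>2 * B"
      using iB integrable_topsum[OF k] by (simp add: mean_top_def B_def prob_space)
    also have "\<dots> \<le> exp (s * mean_top d k + s\<^sup>2 * B)"
      using exp_ge_add_one_self[of "s * mean_top d k + s\<^sup>2 * B"] by (simp add: add.assoc)
    finally have "cgf_top s d k \<le> s * mean_top d k + s\<^sup>2 * B"
      using k by (simp add: exp_cgf_top[symmetric])
    then show ?thesis using s by (simp add: field_simps power2_eq_square)
  qed
  show ?thesis
  proof (rule tendsto_sandwich)
    show "\<forall>\<^sub>F s in at_right 0. mean_top d k \<le> cgf_top s d k / s"
      using mean_top_le_cgf_top[OF k] by (auto simp: eventually_at_right_field field_simps intro!: exI[of _ 1])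
    show "\<forall>\<^sub>F s in at_right 0. cgf_top s d k / s \<le> mean_top d k + s * B"
      using up by (auto simp: eventually_at_right_field intro!: exI[of _ 1])
    show "((\<lambda>s. mean_top d k + s * B) \<longlongrightarrow> mean_top d k) (at_right 0)"
      by (auto intro!: tendsto_eq_intros)
  qed simp
qed

section \<open>Limits of superadditive functions and of infima\<close>

text \<open>The core of Fekete's argument: letting n grow bounds x j - \<epsilon> by the lower
  limit, and letting j grow afterwards brings the upper limit within \<epsilon> of the lower
  one.\<close>

lemma convergent_if_eventually_above:
  fixes x :: "nat \<Rightarrow> real"
  assumes b: "\<forall>\<^sub>F n in sequentially. \<bar>x n\<bar> \<le> C"
    and above: "\<And>\<epsilon>. \<epsilon> > 0 \<Longrightarrow> \<forall>\<^sub>F j in sequentially. \<forall>\<^sub>F n in sequentially. x j - \<epsilon> \<le> x n"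
  shows "convergent x"
proof -
  let ?L = "liminf (\<lambda>n. ereal (x n))" and ?U = "limsup (\<lambda>n. ereal (x n))"
  have LU: "?L \<le> ?U" by (rule Liminf_le_Limsup) simp
  have L1: "ereal (- C) \<le> ?L"
    by (rule Liminf_bounded) (use b in \<open>auto elim!: eventually_mono\<close>)
  have U1: "?U \<le> ereal C"
    by (rule Limsup_bounded) (use b in \<open>auto elim!: eventually_mono\<close>)
  have "?U \<le> ?L + ereal \<epsilon>" if "\<epsilon> > 0" for \<epsilon>
  proof (rule Limsup_bounded)
    show "\<forall>\<^sub>F j in sequentially. ereal (x j) \<le> ?L + ereal \<epsilon>"
      using above[OF that]
    proof eventually_elim
      case (elim j)
      have "ereal (x j - \<epsilon>) \<le> ?L"
        by (rule Liminf_bounded) (use elim in \<open>auto elim!: eventually_mono\<close>)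
      then have "ereal (x j - \<epsilon>) + ereal \<epsilon> \<le> ?L + ereal \<epsilon>" by (rule add_right_mono)
      then show ?case by simp
    qed
  qed
  then have UL: "?U \<le> ?L" by (rule ereal_le_epsilon2)
  have eq: "?L = ?U" by (rule antisym[OF LU UL])
  have "?L \<le> ereal C" using LU U1 by (rule order_trans)
  then obtain l where l: "?L = ereal l" using L1 by (cases ?L) auto
  have "((\<lambda>n. ereal (x n)) \<longlongrightarrow> ereal l) sequentially"
    unfolding tendsto_iff_Liminf_eq_Limsup[OF trivial_limit_sequentially] using eq[symmetric] l by simp
  then have "x \<longlonglongrightarrow> l" by simp
  then show ?thesis by (rule convergentI)
qed

lemma superadditive_mult:
  fixes f :: "nat \<Rightarrow> nat \<Rightarrow> real"
  assumes super: "\<And>d1 k1 d2 k2. k1 \<le> d1 \<Longrightarrow> k2 \<le> d2 \<Longrightarrow> f d1 k1 + f d2 k2 \<le> f (d1 + d2) (k1 + k2)"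
    and nonneg: "\<And>d k. k \<le> d \<Longrightarrow> 0 \<le> f d k" and K: "K \<le> D"
  shows "real q * f D K \<le> f (q * D) (q * K)"
proof (induction q)
  case 0
  show ?case using nonneg[of 0 0] by simp
next
  case (Suc q)
  have "real (Suc q) * f D K \<le> f D K + f (q * D) (q * K)" using Suc by (simp add: distrib_right)
  also have "\<dots> \<le> f (D + q * D) (K + q * K)" using K by (intro super) auto
  finally show ?case by simp
qed

text \<open>Filling \<open>(d, k)\<close> with copies of a block \<open>(D, K)\<close> loses only a small proportion if the ratios
  \<open>k / d\<close> and \<open>K / D\<close> are close.\<close>

lemma superadditive_convergent:
  fixes f :: "nat \<Rightarrow> nat \<Rightarrow> real" and d k :: "nat \<Rightarrow> nat"
  assumes super: "\<And>d1 k1 d2 k2. k1 \<le> d1 \<Longrightarrow> k2 \<le> d2 \<Longrightarrow> f d1 k1 + f d2 k2 \<le> f (d1 + d2) (k1 + k2)"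
    and nonneg: "\<And>d k. k \<le> d \<Longrightarrow> 0 \<le> f d k"
    and linear: "\<And>d k. k \<le> d \<Longrightarrow> f d k \<le> C * real d"
    and kd: "\<forall>\<^sub>F n in sequentially. 0 < d n \<and> k n \<le> d n"
    and d: "filterlim d at_top sequentially"
    and \<gamma>: "(\<lambda>n. real (k n) / real (d n)) \<longlonglongrightarrow> \<gamma>" "0 < \<gamma>" "\<gamma> < 1"
  shows "convergent (\<lambda>n. f (d n) (k n) / real (d n))"
proof (rule convergent_if_eventually_above)
  let ?x = "\<lambda>n. f (d n) (k n) / real (d n)" and ?r = "\<lambda>n. real (k n) / real (d n)"
  have C: "C \<ge> 0" using nonneg[of 0 1] linear[of 0 1] by simp
  show "\<forall>\<^sub>F n in sequentially. \<bar>?x n\<bar> \<le> C"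
    using kd
  proof eventually_elim
    case (elim n)
    then show ?case using nonneg[of "k n" "d n"] linear[of "k n" "d n"] by (simp add: field_simps)
  qed
  fix \<epsilon> :: real assume e: "\<epsilon> > 0"
  \<comment> \<open>The limiting proportion of coordinates covered by whole copies of the j-th
    block. Chosen and unchosen positions each limit the number of copies, hence the minimum; it
    tends to 1 because 0 < \<gamma> < 1 keeps both denominators away from 0.\<close>
  define \<rho> where "\<rho> j = min (\<gamma> / ?r j) ((1 - \<gamma>) / (1 - ?r j))" for j
  have "\<rho> \<longlonglongrightarrow> min (\<gamma> / \<gamma>) ((1 - \<gamma>) / (1 - \<gamma>))"
    unfolding \<rho>_def using \<gamma> by (intro tendsto_intros) auto
  then have "\<rho> \<longlonglongrightarrow> 1" using \<gamma> by simp
  then have "(\<lambda>j. C * \<bar>1 - \<rho> j\<bar>) \<longlonglongrightarrow> C * \<bar>1 - 1\<bar>" by (intro tendsto_intros)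
  then have "\<forall>\<^sub>F j in sequentially. C * \<bar>1 - \<rho> j\<bar> < \<epsilon> / 2"
    using e by (intro order_tendstoD) auto
  moreover have "\<forall>\<^sub>F j in sequentially. 0 < ?r j" "\<forall>\<^sub>F j in sequentially. ?r j < 1"
    using \<gamma> by (auto intro: order_tendstoD)
  ultimately show "\<forall>\<^sub>F j in sequentially. \<forall>\<^sub>F n in sequentially. ?x j - \<epsilon> \<le> ?x n"
    using kd
  proof eventually_elim
    case (elim j)
    define D where "D = d j"
    define K where "K = k j"
    have D: "0 < D" "0 < K" "K < D"
      using elim by (auto simp: D_def K_def zero_less_divide_iff)
    \<comment> \<open>Up to rounding, t n * d n copies fit: each uses K of the k n chosen and D - K
      of the d n - k n unchosen positions.\<close>
    define t where "t n = min (?r n / real K) ((1 - ?r n) / real (D - K))" for n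
    have "t \<longlonglongrightarrow> min (\<gamma> / real K) ((1 - \<gamma>) / real (D - K))"
      unfolding t_def using \<gamma> D by (intro tendsto_intros) auto
    moreover have "min (\<gamma> / real K) ((1 - \<gamma>) / real (D - K)) = \<rho> j / real D"
    proof -
      have "\<gamma> / ?r j / real D = \<gamma> / real K" "(1 - \<gamma>) / (1 - ?r j) / real D = (1 - \<gamma>) / real (D - K)"
        using D unfolding D_def[symmetric] K_def[symmetric] by (auto simp: field_simps of_nat_diff)
      moreover have "min a b / real D = min (a / real D) (b / real D)" for a b
        using D by (auto simp: min_def divide_right_mono field_simps)
      ultimately show ?thesis unfolding \<rho>_def by (simp only:)
    qed
    moreover have "(\<lambda>n. 1 / real (d n)) \<longlonglongrightarrow> 0"
      using filterlim_compose[OF lim_1_over_n d] by simp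
    ultimately have "(\<lambda>n. (t n - 1 / real (d n)) * f D K) \<longlonglongrightarrow> (\<rho> j / real D - 0) * f D K"
      by (intro tendsto_intros) auto
    moreover have "?x j - \<epsilon> < (\<rho> j / real D - 0) * f D K"
    proof -
      have xj: "0 \<le> ?x j" "?x j \<le> C"
        using elim nonneg[of "k j" "d j"] linear[of "k j" "d j"] by (auto simp: field_simps)
      have "(1 - \<rho> j) * ?x j \<le> \<bar>1 - \<rho> j\<bar> * C" using xj by (intro mult_mono) auto
      then have "?x j - \<rho> j * ?x j < \<epsilon>"
        using elim(1) e unfolding left_diff_distrib mult.commute[of _ C] mult_1_left by linarith
      then show ?thesis by (simp add: D_def K_def)
    qed
    ultimately have "\<forall>\<^sub>F n in sequentially. ?x j - \<epsilon> < (t n - 1 / real (d n)) * f D K"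
      by (intro order_tendstoD)
    then show ?case
      using kd
    proof eventually_elim
      case (elim n)
      \<comment> \<open>Rounding down loses at most one copy, which is the term 1 / d n subtracted
        above.\<close>
      define q where "q = nat \<lfloor>t n * real (d n)\<rfloor>"
      have dn: "0 < d n" "k n \<le> d n" using elim by auto
      have t0: "t n \<ge> 0" using dn D by (auto simp: t_def)
      have q: "real q \<le> t n * real (d n)" "t n * real (d n) - 1 \<le> real q"
        using t0 dn unfolding q_def by (auto simp: of_nat_nat)
      have "t n * real (d n) \<le> ?r n / real K * real (d n)" unfolding t_def by (intro mult_right_mono) auto
      also have "\<dots> = real (k n) / real K" using dn by simp
      finally have "real q \<le> real (k n) / real K" using q by simp
      then have "real q * real K \<le> real (k n)" using D by (simp add: pos_le_divide_eq)
      then have qK: "q * K \<le> k n" by (metis of_nat_le_iff of_nat_mult)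
      have "t n * real (d n) \<le> (1 - ?r n) / real (D - K) * real (d n)" unfolding t_def by (intro mult_right_mono) auto
      also have "\<dots> = real (d n - k n) / real (D - K)" using dn D by (simp add: field_simps of_nat_diff)
      finally have "real q \<le> real (d n - k n) / real (D - K)" using q by simp
      then have "real q * real (D - K) \<le> real (d n - k n)" using D by (simp add: pos_le_divide_eq)
      then have qD: "q * (D - K) \<le> d n - k n" by (metis of_nat_le_iff of_nat_mult)
      have qDK: "q * D = q * (D - K) + q * K" using D by (simp add: diff_mult_distrib2)
      \<comment> \<open>The leftover is again an admissible pair because the unchosen positions
        suffice too; its nonnegative value can therefore be added before superadditivity is
        used.\<close>
      have le: "q * K \<le> q * D" "q * D \<le> d n" "k n - q * K \<le> d n - q * D"
        using qK qD dn unfolding qDK by auto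
      have "real q * f D K \<le> f (q * D) (q * K)"
        using D by (intro superadditive_mult super nonneg) auto
      also have "\<dots> \<le> f (q * D) (q * K) + f (d n - q * D) (k n - q * K)"
        using nonneg[OF le(3)] by simp
      also have "\<dots> \<le> f (q * D + (d n - q * D)) (q * K + (k n - q * K))"
        by (intro super le)
      also have "\<dots> = f (d n) (k n)" using le qK by simp
      finally have "real q * f D K \<le> f (d n) (k n)" .
      moreover have "(t n * real (d n) - 1) * f D K \<le> real q * f D K"
        using q D nonneg[of K D] by (intro mult_right_mono) auto
      ultimately have "(t n * real (d n) - 1) * f D K / real (d n) \<le> ?x n"
        by (intro divide_right_mono) auto
      moreover have "(t n - 1 / real (d n)) * f D K = (t n * real (d n) - 1) * f D K / real (d n)"
        using dn by (simp add: field_simps)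
      ultimately have "(t n - 1 / real (d n)) * f D K \<le> ?x n" by simp
      then show ?case using elim by simp
    qed
  qed
qed

text \<open>When nearly all coordinates are chosen, the top sum behaves like the full sum, a centred
  normal variable of variance d. The fixed-set lower bound and the upper bound with a suitable
  \<theta> meet in the limit.\<close>

lemma cgf_top_full_limit:
  fixes d k :: "nat \<Rightarrow> nat"
  assumes kd: "\<forall>\<^sub>F n in sequentially. 0 < d n \<and> k n \<le> d n"
    and \<gamma>: "(\<lambda>n. real (k n) / real (d n)) \<longlonglongrightarrow> 1" and s: "s > 0"
  shows "(\<lambda>n. cgf_top s (d n) (k n) / real (d n)) \<longlonglongrightarrow> s\<^sup>2 / 2"
proof (rule order_tendstoI)
  fix a assume a: "a < s\<^sup>2 / 2"
  have "(\<lambda>n. real (k n) / real (d n) * (s\<^sup>2 / 2)) \<longlonglongrightarrow> 1 * (s\<^sup>2 / 2)"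
    by (intro tendsto_intros \<gamma>)
  then have "\<forall>\<^sub>F n in sequentially. a < real (k n) / real (d n) * (s\<^sup>2 / 2)"
    using a by (intro order_tendstoD) auto
  then show "\<forall>\<^sub>F n in sequentially. a < cgf_top s (d n) (k n) / real (d n)"
    using kd
  proof eventually_elim
    case (elim n)
    have "real (k n) / real (d n) * (s\<^sup>2 / 2) = (real (k n) * s\<^sup>2 / 2) / real (d n)" by simp
    also have "\<dots> \<le> cgf_top s (d n) (k n) / real (d n)"
      using elim s by (intro divide_right_mono cgf_top_lower) auto
    finally show ?case using elim(1) by simp
  qed
next
  fix a assume a: "s\<^sup>2 / 2 < a"
  \<comment> \<open>Chosen so that the exponential term equals half of the gap between a and s^2 /
    2; the other correction, s \<theta> (1 - k / d), vanishes in the limit.\<close>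
  define \<theta> where "\<theta> = (ln ((a - s\<^sup>2 / 2) / 2) + s\<^sup>2 / 2) / s"
  have "exp (s * \<theta> - s\<^sup>2 / 2) = (a - s\<^sup>2 / 2) / 2"
    using s a by (simp add: \<theta>_def)
  then have \<theta>: "s\<^sup>2 / 2 + exp (s * \<theta> - s\<^sup>2 / 2) < a"
    using a by (simp add: field_simps)
  let ?u = "\<lambda>n. s\<^sup>2 / 2 + exp (s * \<theta> - s\<^sup>2 / 2) - s * \<theta> * (1 - real (k n) / real (d n))"
  have "?u \<longlonglongrightarrow> s\<^sup>2 / 2 + exp (s * \<theta> - s\<^sup>2 / 2) - s * \<theta> * (1 - 1)"
    by (intro tendsto_intros \<gamma>)
  then have "\<forall>\<^sub>F n in sequentially. ?u n < a"
    using \<theta> by (intro order_tendstoD) auto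
  then show "\<forall>\<^sub>F n in sequentially. cgf_top s (d n) (k n) / real (d n) < a"
    using kd
  proof eventually_elim
    case (elim n)
    have "cgf_top s (d n) (k n) / real (d n) \<le>
      (real (d n) * (s\<^sup>2 / 2 + exp (s * \<theta> - s\<^sup>2 / 2)) - s * \<theta> * (real (d n) - real (k n))) / real (d n)"
      using elim s by (intro divide_right_mono cgf_top_upper) auto
    also have "\<dots> = ?u n" using elim by (simp add: field_simps)
    finally show ?case using elim by simp
  qed
qed

text \<open>The choice \<theta> = 0 in the upper bound, which provides the linear growth required
  for block filling.\<close>

lemma cgf_top_linear:
  assumes "k \<le> d" "s \<ge> 0"
  shows "cgf_top s d k \<le> (s\<^sup>2 / 2 + 1) * real d"
proof -
  have "cgf_top s d k \<le> real d * (s\<^sup>2 / 2 + exp (s * 0 - s\<^sup>2 / 2)) - s * 0 * (real d - real k)"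
    by (rule cgf_top_upper[OF assms])
  also have "\<dots> \<le> real d * (s\<^sup>2 / 2 + 1)" by (simp add: mult_left_mono)
  finally show ?thesis by (simp add: mult.commute)
qed

section \<open>Top sums per coordinate when the ratio k / d converges\<close>

context
  fixes d k :: "nat \<Rightarrow> nat" and \<gamma> :: real
  assumes kd: "\<forall>\<^sub>F n in sequentially. 0 < d n \<and> k n \<le> d n"
    and d: "filterlim d at_top sequentially"
    and \<gamma>: "(\<lambda>n. real (k n) / real (d n)) \<longlonglongrightarrow> \<gamma>" "0 < \<gamma>"
begin

lemma ratio_le_1: "\<gamma> \<le> 1"
  by (rule tendsto_upperbound[OF \<gamma>(1)]) (use kd in \<open>auto elim!: eventually_mono\<close>)

lemma cgf_top_convergent:
  assumes s: "s > 0"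
  shows "convergent (\<lambda>n. cgf_top s (d n) (k n) / real (d n))"
proof (cases "\<gamma> = 1")
  case True
  then show ?thesis using cgf_top_full_limit[OF kd _ s] \<gamma> by (auto intro: convergentI)
next
  case False
  then show ?thesis using ratio_le_1 s
    by (intro superadditive_convergent[where f = "cgf_top s" and C = "s\<^sup>2 / 2 + 1", OF _ _ _ kd d \<gamma>] cgf_top_superadditive
        cgf_top_nonneg cgf_top_linear) auto
qed

lemma mean_top_convergent: "convergent (\<lambda>n. mean_top (d n) (k n) / real (d n))"
proof (cases "\<gamma> = 1")
  case True
  have "(\<lambda>n. mean_top (d n) (k n) / real (d n)) \<longlonglongrightarrow> 0"
  proof (rule order_tendstoI)
    fix a :: real assume "a < 0"
    then show "\<forall>\<^sub>F n in sequentially. a < mean_top (d n) (k n) / real (d n)"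
      using kd by (auto elim!: eventually_mono intro: less_le_trans[OF _ divide_nonneg_nonneg] mean_top_nonneg)
  next
    fix a :: real assume a: "a > 0"
    \<comment> \<open>The target accuracy a doubles as parameter: by Jensen the mean per coordinate
      is at most the generating function per coordinate at a, divided by a, and this tends to a /
      2.\<close>
    have "(\<lambda>n. cgf_top a (d n) (k n) / real (d n)) \<longlonglongrightarrow> a\<^sup>2 / 2"
      using cgf_top_full_limit[OF kd _ a] \<gamma> True by simp
    then have "\<forall>\<^sub>F n in sequentially. cgf_top a (d n) (k n) / real (d n) < a\<^sup>2"
      using a by (intro order_tendstoD) auto
    then show "\<forall>\<^sub>F n in sequentially. mean_top (d n) (k n) / real (d n) < a"
      using kd
    proof eventually_elim
      case (elim n)
      have "a * (mean_top (d n) (k n) / real (d n)) = a * mean_top (d n) (k n) / real (d n)" by simp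
      also have "\<dots> \<le> cgf_top a (d n) (k n) / real (d n)"
        using elim by (intro divide_right_mono mean_top_le_cgf_top) auto
      also have "\<dots> < a * a" using elim by (simp add: power2_eq_square)
      finally show ?case using a by (simp only: mult_less_cancel_left_pos)
    qed
  qed
  then show ?thesis by (rule convergentI)
next
  case False
  have "mean_top d' k' \<le> 3 / 2 * real d'" if "k' \<le> d'" for d' k'
    using mean_top_le_cgf_top[OF that, of 1] cgf_top_linear[OF that, of 1] by simp
  then show ?thesis using ratio_le_1 False
    by (intro superadditive_convergent[where f = mean_top and C = "3 / 2", OF _ _ _ kd d \<gamma>] mean_top_superadditive
        mean_top_nonneg) auto
qed

text \<open>The pointwise limit inherits convexity and so is continuous on the positive reals.
  Monotonicity in the parameter traps the values at \<open>u n\<close> between those at fixed points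
  just below and just above s.\<close>

lemma cgf_top_convergent_varying:
  assumes u: "u \<longlonglongrightarrow> s" and s: "s > 0"
  shows "convergent (\<lambda>n. cgf_top (u n) (d n) (k n) / real (d n))"
proof -
  define \<Lambda> where "\<Lambda> t = lim (\<lambda>n. cgf_top t (d n) (k n) / real (d n))" for t
  have L: "(\<lambda>n. cgf_top t (d n) (k n) / real (d n)) \<longlonglongrightarrow> \<Lambda> t" if "t > 0" for t
    using cgf_top_convergent[OF that] by (simp add: \<Lambda>_def convergent_LIMSEQ_iff)
  have conv: "convex_on {0<..} \<Lambda>"
  proof (rule convex_onI)
    fix t x y :: real assume t: "0 < t" "t < 1" and x: "x \<in> {0<..}" "y \<in> {0<..}"
    have z: "(1 - t) *\<^sub>R x + t *\<^sub>R y > 0" using t x by (simp add: add_pos_pos)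
    show "\<Lambda> ((1 - t) *\<^sub>R x + t *\<^sub>R y) \<le> (1 - t) * \<Lambda> x + t * \<Lambda> y"
    proof (rule tendsto_le[OF _ _ L[OF z]])
      show "(\<lambda>n. (1 - t) * (cgf_top x (d n) (k n) / real (d n)) + t * (cgf_top y (d n) (k n) / real (d n)))
         \<longlonglongrightarrow> (1 - t) * \<Lambda> x + t * \<Lambda> y"
        using x by (intro tendsto_intros L) auto
      show "\<forall>\<^sub>F n in sequentially. cgf_top ((1 - t) *\<^sub>R x + t *\<^sub>R y) (d n) (k n) / real (d n)
        \<le> (1 - t) * (cgf_top x (d n) (k n) / real (d n)) + t * (cgf_top y (d n) (k n) / real (d n))"
        using kd
      proof eventually_elim
        case (elim n)
        have "cgf_top ((1 - t) *\<^sub>R x + t *\<^sub>R y) (d n) (k n) \<le> (1 - t) * cgf_top x (d n) (k n) + t * cgf_top y (d n) (k n)"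
          using elim t by (intro convex_onD[OF cgf_top_convex]) auto
        then show ?case by (simp add: divide_right_mono add_divide_distrib[symmetric])
      qed
    qed simp
  qed simp
  have "continuous_on {0<..} \<Lambda>"
    by (rule convex_on_continuous[OF _ conv]) simp
  then have cont: "isCont \<Lambda> s"
    using s by (simp add: continuous_on_eq_continuous_at)
  have "(\<lambda>n. cgf_top (u n) (d n) (k n) / real (d n)) \<longlonglongrightarrow> \<Lambda> s"
  proof (rule order_tendstoI)
    fix a assume a: "a < \<Lambda> s"
    have "\<forall>\<^sub>F t in at s. a < \<Lambda> t"
      using cont a unfolding isCont_def by (rule order_tendstoD(1))
    then obtain e where e: "e > 0" "\<And>t. t \<noteq> s \<Longrightarrow> dist t s < e \<Longrightarrow> a < \<Lambda> t"
      unfolding eventually_at by blast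
    \<comment> \<open>Halving the minimum with s keeps t positive, where the pointwise limit is
      available.\<close>
    define t where "t = s - min e s / 2"
    have "dist t s < e" "0 < t" "t < s"
      using e(1) s by (auto simp: t_def dist_real_def min_def)
    then have t: "0 < t" "t < s" "a < \<Lambda> t" using e(2) by auto
    have "\<forall>\<^sub>F n in sequentially. a < cgf_top t (d n) (k n) / real (d n)" "\<forall>\<^sub>F n in sequentially. t < u n"
      using L[OF t(1)] u t by (auto intro: order_tendstoD)
    then show "\<forall>\<^sub>F n in sequentially. a < cgf_top (u n) (d n) (k n) / real (d n)"
      using kd
    proof eventually_elim
      case (elim n)
      then have "cgf_top t (d n) (k n) / real (d n) \<le> cgf_top (u n) (d n) (k n) / real (d n)"
        using t by (intro divide_right_mono cgf_top_mono) auto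
      then show ?case using elim by simp
    qed
  next
    fix a assume a: "\<Lambda> s < a"
    have "\<forall>\<^sub>F t in at s. \<Lambda> t < a"
      using cont a unfolding isCont_def by (rule order_tendstoD(2))
    then obtain e where e: "e > 0" "\<And>t. t \<noteq> s \<Longrightarrow> dist t s < e \<Longrightarrow> \<Lambda> t < a"
      unfolding eventually_at by blast
    define t where "t = s + e / 2"
    have "dist t s < e" "s < t"
      using e(1) by (auto simp: t_def dist_real_def)
    then have t: "s < t" "\<Lambda> t < a" using e(2) by auto
    have "\<forall>\<^sub>F n in sequentially. cgf_top t (d n) (k n) / real (d n) < a" "\<forall>\<^sub>F n in sequentially. u n < t"
       "\<forall>\<^sub>F n in sequentially. 0 < u n"
      using L[of t] u t s by (auto intro: order_tendstoD)
    then show "\<forall>\<^sub>F n in sequentially. cgf_top (u n) (d n) (k n) / real (d n) < a"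
      using kd
    proof eventually_elim
      case (elim n)
      then have "cgf_top (u n) (d n) (k n) / real (d n) \<le> cgf_top t (d n) (k n) / real (d n)"
        by (intro divide_right_mono cgf_top_mono) auto
      then show ?case using elim by simp
    qed
  qed
  then show ?thesis by (rule convergentI)
qed

end

section \<open>Convergence of infima over a parameter\<close>

lemma tendsto_Min_image:
  fixes f :: "'i \<Rightarrow> nat \<Rightarrow> real"
  assumes "finite A" "A \<noteq> {}" "\<And>i. i \<in> A \<Longrightarrow> f i \<longlonglongrightarrow> l i"
  shows "(\<lambda>n. Min ((\<lambda>i. f i n) ` A)) \<longlonglongrightarrow> Min (l ` A)"
  using assms
proof (induction A rule: finite_ne_induct)
  case (insert i A)
  then show ?case by (simp add: tendsto_min)
qed simp

lemma convergent_if_approx: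
  fixes x :: "nat \<Rightarrow> real"
  assumes "\<And>\<epsilon>. \<epsilon> > 0 \<Longrightarrow> \<exists>v. convergent v \<and> (\<forall>\<^sub>F n in sequentially. \<bar>x n - v n\<bar> \<le> \<epsilon>)"
  shows "convergent x"
proof -
  have "Cauchy x"
  proof (rule metric_CauchyI)
    fix e :: real assume e: "e > 0"
    obtain v where v: "convergent v" "\<forall>\<^sub>F n in sequentially. \<bar>x n - v n\<bar> \<le> e / 4"
      using assms[of "e / 4"] e by auto
    obtain M1 where M1: "\<And>n. n \<ge> M1 \<Longrightarrow> \<bar>x n - v n\<bar> \<le> e / 4"
      using v(2) by (auto simp: eventually_sequentially)
    obtain M2 where M2: "\<And>m n. m \<ge> M2 \<Longrightarrow> n \<ge> M2 \<Longrightarrow> dist (v m) (v n) < e / 4"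
      using metric_CauchyD[OF convergent_Cauchy[OF v(1)], of "e / 4"] e by auto
    show "\<exists>M. \<forall>m\<ge>M. \<forall>n\<ge>M. dist (x m) (x n) < e"
    proof (intro exI[of _ "max M1 M2"] allI impI)
      fix m n assume mn: "max M1 M2 \<le> m" "max M1 M2 \<le> n"
      have "\<bar>x m - v m\<bar> \<le> e / 4" "\<bar>x n - v n\<bar> \<le> e / 4" "\<bar>v m - v n\<bar> < e / 4"
        using M1[of m] M1[of n] M2[of m n] mn by (auto simp: dist_real_def)
      then show "dist (x m) (x n) < e"
        using e unfolding dist_real_def by linarith
    qed
  qed
  then show ?thesis by (rule Cauchy_convergent)
qed

text \<open>Monotonicity of \<open>G n\<close> makes the infimum comparable, up to \<open>\<delta> / 2\<close> and uniformly in \<open>n\<close>, with a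
  minimum over the grid \<open>\<delta> \<nat>\<close>. No continuity in \<open>s\<close> is needed except at \<open>0\<close>.\<close>

lemma convergent_INF:
  fixes G :: "nat \<Rightarrow> real \<Rightarrow> real"
  assumes mono: "\<forall>\<^sub>F n in sequentially. \<forall>s\<ge>0. \<forall>t\<ge>s. G n s \<le> G n t"
    and low: "\<forall>\<^sub>F n in sequentially. \<forall>s>0. s \<le> G n s"
    and inf0: "\<forall>\<^sub>F n in sequentially. (INF s\<in>{0<..}. - s / 2 + G n s) \<le> G n 0"
    and conv: "\<And>s. s \<ge> 0 \<Longrightarrow> convergent (\<lambda>n. G n s)"
  shows "convergent (\<lambda>n. INF s\<in>{0<..}. - s / 2 + G n s)"
proof (rule convergent_if_approx)
  fix \<epsilon> :: real assume e: "\<epsilon> > 0"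
  \<comment> \<open>Rounding s down to the grid changes -s / 2 by at most \<delta> / 2 =
    \<epsilon>.\<close>
  define \<delta> where "\<delta> = 2 * \<epsilon>"
  have \<delta>: "\<delta> > 0" using e by (simp add: \<delta>_def)
  obtain l0 where l0: "(\<lambda>n. G n 0) \<longlonglongrightarrow> l0" using conv[of 0] by (auto simp: convergent_def)
  have g0: "\<forall>\<^sub>F n in sequentially. G n 0 < l0 + 1"
    by (rule order_tendstoD[OF l0]) simp
  \<comment> \<open>Since G n s >= s, the objective is at least s / 2, hence at least l0 + 1 beyond
    the N-th grid point. There it exceeds G n 0, the value at grid point 0, so a finite grid
    suffices.\<close>
  define N where "N = nat \<lceil>2 * (l0 + 1) / \<delta>\<rceil>"
  have N: "real N * \<delta> / 2 \<ge> l0 + 1"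
  proof -
    have "2 * (l0 + 1) / \<delta> \<le> real N" unfolding N_def by (simp add: real_nat_ceiling_ge)
    then show ?thesis using \<delta> by (simp add: field_simps)
  qed
  define v where "v n = Min ((\<lambda>i. - (real i * \<delta>) / 2 + G n (real i * \<delta>)) ` {..N})" for n
  have "convergent v"
  proof -
    have "(\<lambda>n. - (real i * \<delta>) / 2 + G n (real i * \<delta>)) \<longlonglongrightarrow> - (real i * \<delta>) / 2 + lim (\<lambda>n. G n (real i * \<delta>))" for i
      using conv[of "real i * \<delta>"] \<delta> by (intro tendsto_intros) (simp add: convergent_LIMSEQ_iff)
    then have "v \<longlonglongrightarrow> Min ((\<lambda>i. - (real i * \<delta>) / 2 + lim (\<lambda>n. G n (real i * \<delta>))) ` {..N})"
      unfolding v_def by (intro tendsto_Min_image) auto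
    then show ?thesis by (rule convergentI)
  qed
  moreover have "\<forall>\<^sub>F n in sequentially. \<bar>(INF s\<in>{0<..}. - s / 2 + G n s) - v n\<bar> \<le> \<epsilon>"
    using mono low inf0 g0
  proof eventually_elim
    case (elim n)
    have vle: "v n \<le> - (real i * \<delta>) / 2 + G n (real i * \<delta>)" if "i \<le> N" for i
      unfolding v_def using that by (intro Min_le) auto
    have lower: "v n - \<epsilon> \<le> - s / 2 + G n s" if s: "s > 0" for s
    proof -
      define i where "i = nat \<lfloor>s / \<delta>\<rfloor>"
      have i: "real i * \<delta> \<le> s" "s < (real i + 1) * \<delta>"
      proof -
        have "real i \<le> s / \<delta>" "s / \<delta> < real i + 1"
          using s \<delta> unfolding i_def by (auto simp: of_nat_nat)
        then show "real i * \<delta> \<le> s" "s < (real i + 1) * \<delta>" using \<delta> by (auto simp: field_simps)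
      qed
      show ?thesis
      proof (cases "i \<le> N")
        case True
        have "G n (real i * \<delta>) \<le> G n s" using elim(1) i \<delta> by auto
        then show ?thesis using vle[OF True] i by (simp add: \<delta>_def algebra_simps)
      next
        case False
        then have "real N * \<delta> \<le> real i * \<delta>" using \<delta> by (intro mult_right_mono) auto
        then have "real N * \<delta> / 2 \<le> s / 2" using i by simp
        moreover have "s \<le> G n s" using elim s by auto
        moreover have "v n \<le> G n 0" using vle[of 0] by simp
        ultimately show ?thesis using N elim(4) e by linarith
      qed
    qed
    have bdd: "bdd_below ((\<lambda>s. - s / 2 + G n s) ` {0<..})"
      using lower by (intro bdd_belowI2) auto
    have "v n - \<epsilon> \<le> (INF s\<in>{0<..}. - s / 2 + G n s)"
      using lower by (intro cINF_greatest) auto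
    moreover have "(INF s\<in>{0<..}. - s / 2 + G n s) \<le> v n"
    proof -
      have "v n \<in> (\<lambda>i. - (real i * \<delta>) / 2 + G n (real i * \<delta>)) ` {..N}"
        unfolding v_def by (intro Min_in) auto
      then obtain i where i: "v n = - (real i * \<delta>) / 2 + G n (real i * \<delta>)" by auto
      show ?thesis
      \<comment> \<open>The grid contains 0 although the infimum runs over positive s; there the
        hypothesis \<open>inf0\<close> takes the place of membership.\<close>
      proof (cases "i = 0")
        case True
        then show ?thesis using i elim(3) by simp
      next
        case False
        then show ?thesis unfolding i using \<delta> by (intro cINF_lower bdd) auto
      qed
    qed
    ultimately show ?case using e by simp
  qed
  ultimately show "\<exists>v. convergent v \<and> (\<forall>\<^sub>F n in sequentially. \<bar>(INF s\<in>{0<..}. - s / 2 + G n s) - v n\<bar> \<le> \<epsilon>)"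
    by blast
qed

section \<open>The random dual and its lifting\<close>

lemma selector_sum:
  fixes d :: nat
  assumes "I \<subseteq> {..<d}"
  shows "(\<Sum>i<d. v i * restrict (\<lambda>i. if i \<in> I then r else 0) {..<d} i) = r * (\<Sum>i\<in>I. v i :: real)"
proof -
  have "(\<Sum>i<d. v i * restrict (\<lambda>i. if i \<in> I then r else 0) {..<d} i) = (\<Sum>i<d. if i \<in> I then r * v i else 0)"
    by (intro sum.cong) auto
  also have "\<dots> = (\<Sum>i\<in>I. r * v i)"
    using sum.inter_restrict[of "{..<d}" "\<lambda>i. r * v i" I] assms by (simp add: Int_absorb1)
  finally show ?thesis by (simp add: sum_distrib_left)
qed

lemma finite_selector_vecs: "finite (selector_vecs d k)"
  unfolding selector_vecs_def by (rule finite_subset[OF _ finite_PiE[of "{..<d}" "\<lambda>_. {0, 1 / sqrt (real k)}"]]) auto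

lemma selector_vecs_nonempty: "0 < k \<Longrightarrow> k \<le> d \<Longrightarrow> selector_vecs d k \<noteq> {}"
  using subsets_card_nonempty[of k d] by (simp add: selector_vecs_eq)

lemma selector_vecs_norm:
  assumes "0 < k" "x \<in> selector_vecs d k"
  shows "(\<Sum>i<d. (x i)\<^sup>2) = 1"
proof -
  obtain I where I: "I \<subseteq> {..<d}" "card I = k"
    and x: "x = restrict (\<lambda>i. if i \<in> I then 1 / sqrt (real k) else 0) {..<d}"
    using assms by (auto simp: selector_vecs_eq)
  have "(\<Sum>i<d. (x i)\<^sup>2) = 1 / sqrt (real k) * (\<Sum>i\<in>I. x i)"
    unfolding power2_eq_square using selector_sum[OF I(1), of x "1 / sqrt (real k)"] x by simp
  also have "(\<Sum>i\<in>I. x i) = (\<Sum>i\<in>I. 1 / sqrt (real k))"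
    using I x by (intro sum.cong) auto
  finally show ?thesis using I assms by simp
qed

text \<open>Selector vectors are indicators of k-element sets divided by sqrt k.\<close>

lemma max_selector_eq_topsum:
  assumes "0 < k" "k \<le> d"
  shows "max_selector d k v = topsum d k v / sqrt (real k)"
proof -
  have "(\<lambda>x. \<Sum>i<d. v i * x i) ` selector_vecs d k = (\<lambda>t. t / sqrt (real k)) ` (\<lambda>J. \<Sum>j\<in>J. v j) ` {J. J \<subseteq> {..<d} \<and> card J = k}"
    unfolding selector_vecs_eq[OF assms(1)] image_image by (intro image_cong refl) (subst selector_sum, auto)
  moreover have "Max ((\<lambda>t. t / sqrt (real k)) ` (\<lambda>J. \<Sum>j\<in>J. v j) ` {J. J \<subseteq> {..<d} \<and> card J = k}) = topsum d k v / sqrt (real k)"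
    unfolding topsum_def using subsets_card_nonempty[OF assms(2)]
    by (intro mono_Max_commute[symmetric]) (auto intro!: monoI divide_right_mono)
  ultimately show ?thesis by (simp add: max_selector_def)
qed

lemma gauss_law_integral:
  fixes f :: "('i \<Rightarrow> real) \<Rightarrow> real"
  assumes "prob_space M" "prob_space.indep_vars M (\<lambda>_. borel) X K"
    and "\<And>i. i \<in> K \<Longrightarrow> distributed M lborel (X i) std_normal_density"
    and "inj_on p I" "p \<in> I \<rightarrow> K" and f: "integrable (gauss I) f"
  shows "integrable M (\<lambda>\<omega>. f (\<lambda>i\<in>I. X (p i) \<omega>))"
    "(\<integral>\<omega>. f (\<lambda>i\<in>I. X (p i) \<omega>) \<partial>M) = (\<integral>w. f w \<partial>gauss I)"
proof -
  note D = gauss_law_inj[OF assms(1-5)]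
  show "integrable M (\<lambda>\<omega>. f (\<lambda>i\<in>I. X (p i) \<omega>))"
    using integrable_distr[OF D(2), of f] f D(1) by simp
  show "(\<integral>\<omega>. f (\<lambda>i\<in>I. X (p i) \<omega>) \<partial>M) = (\<integral>w. f w \<partial>gauss I)"
    using integral_distr[OF D(2) borel_measurable_integrable[OF f, simplified]] D(1) by simp
qed

lemma mult_INF:
  fixes f :: "'i \<Rightarrow> real"
  assumes "r > 0" "I \<noteq> {}" "bdd_below (f ` I)"
  shows "(INF i\<in>I. r * f i) = r * (INF i\<in>I. f i)"
proof -
  have "Inf ((*) r ` f ` I) = r * Inf (f ` I)"
    using assms
    by (intro continuous_at_Inf_mono[symmetric] monoI continuous_intros) (auto intro: continuous_within_subset)
  then show ?thesis by (simp add: image_image)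
qed

text \<open>With c = s sqrt n and a = sqrt n / sqrt k the argument c / sqrt k becomes s a, and each
  logarithmic term of the objective is this quantity divided by sqrt n. The value at s = 0 is the
  right limit, which makes the plain dual the endpoint of the lifted family.\<close>

definition scaled_cgf :: "real \<Rightarrow> nat \<Rightarrow> nat \<Rightarrow> real \<Rightarrow> real" where
  "scaled_cgf a d k s = (if s = 0 then a * mean_top d k else cgf_top (s * a) d k / s)"

lemma scaled_cgf_mono:
  assumes "k \<le> d" "a > 0" "0 \<le> s" "s \<le> t"
  shows "scaled_cgf a d k s \<le> scaled_cgf a d k t"
proof (cases "s = 0")
  case True
  then show ?thesis
    using mean_top_le_cgf_top[OF assms(1), of "t * a"] assms
    by (auto simp: scaled_cgf_def field_simps)
next
  case False
  then have "cgf_top (s * a) d k / (s * a) \<le> cgf_top (t * a) d k / (t * a)"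
    using assms by (intro cgf_top_scale) auto
  then show ?thesis using False assms by (simp add: scaled_cgf_def field_simps)
qed

lemma scaled_cgf_lower:
  assumes "k \<le> d" "a > 0" "0 < s"
  shows "real k * a\<^sup>2 * s / 2 \<le> scaled_cgf a d k s"
  using cgf_top_lower[OF assms(1), of "s * a"] assms
  by (simp add: scaled_cgf_def field_simps power2_eq_square)

lemma scaled_cgf_tendsto_0:
  assumes "k \<le> d" "a > 0"
  shows "(scaled_cgf a d k \<longlongrightarrow> scaled_cgf a d k 0) (at_right 0)"
proof -
  have "filterlim (\<lambda>s. s * a) (at_right 0) (at_right 0)"
    using assms by (auto simp: filterlim_at eventually_at_filter intro!: tendsto_eq_intros)
  then have "((\<lambda>s. a * (cgf_top (s * a) d k / (s * a))) \<longlongrightarrow> a * mean_top d k) (at_right 0)"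
    by (intro tendsto_mult tendsto_const filterlim_compose[OF cgf_top_small[OF assms(1)]])
  moreover have "\<forall>\<^sub>F s in at_right 0. a * (cgf_top (s * a) d k / (s * a)) = scaled_cgf a d k s"
    using assms by (auto simp: eventually_at_filter scaled_cgf_def)
  ultimately show ?thesis
    by (subst tendsto_cong[symmetric]) (auto simp: scaled_cgf_def)
qed

text \<open>The scale \<open>a n\<close> tends to 1 / sqrt \<beta>, so for s > 0 the generating
  function is taken at the moving argument s * \<open>a n\<close>. Normalisation by
  \<open>d n\<close> is exchanged for normalisation by n through the limit \<alpha>.\<close>

lemma scaled_cgf_convergent:
  fixes d k :: "nat \<Rightarrow> nat"
  assumes kd: "\<forall>\<^sub>F n in sequentially. 0 < k n \<and> k n \<le> d n"
    and \<alpha>: "(\<lambda>n. real (d n) / real n) \<longlonglongrightarrow> \<alpha>" "\<alpha> > 0"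
    and \<beta>: "(\<lambda>n. real (k n) / real n) \<longlonglongrightarrow> \<beta>" "\<beta> > 0"
    and s: "s \<ge> 0"
  shows "convergent (\<lambda>n. scaled_cgf (sqrt (real n) / sqrt (real (k n))) (d n) (k n) s / real n)"
proof -
  have n0: "\<forall>\<^sub>F n::nat in sequentially. n > 0" by (rule eventually_gt_at_top)
  have kd': "\<forall>\<^sub>F n in sequentially. 0 < d n \<and> k n \<le> d n"
    using kd by eventually_elim auto
  have "filterlim (\<lambda>n. real (d n) / real n * real n) at_top sequentially"
    by (rule filterlim_tendsto_pos_mult_at_top[OF \<alpha> filterlim_real_sequentially])
  moreover have "\<forall>\<^sub>F n in sequentially. real (d n) / real n * real n = real (d n)"
    using n0 by eventually_elim simp
  ultimately have "filterlim (\<lambda>n. real (d n)) at_top sequentially"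
    by (simp cong: filterlim_cong)
  then have d: "filterlim d at_top sequentially"
    by (simp add: filterlim_sequentially_iff_filterlim_real)
  have "(\<lambda>n. (real (k n) / real n) / (real (d n) / real n)) \<longlonglongrightarrow> \<beta> / \<alpha>"
    using \<alpha> \<beta> by (intro tendsto_intros) auto
  moreover have "\<forall>\<^sub>F n in sequentially. (real (k n) / real n) / (real (d n) / real n) = real (k n) / real (d n)"
    using n0 by eventually_elim simp
  ultimately have \<gamma>: "(\<lambda>n. real (k n) / real (d n)) \<longlonglongrightarrow> \<beta> / \<alpha>"
    by (rule Lim_transform_eventually)
  have \<gamma>0: "0 < \<beta> / \<alpha>" using \<alpha> \<beta> by simp
  define a where "a n = sqrt (real n) / sqrt (real (k n))" for n
  have "(\<lambda>n. sqrt (1 / (real (k n) / real n))) \<longlonglongrightarrow> sqrt (1 / \<beta>)"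
    using \<beta> by (intro tendsto_intros) auto
  then have a: "a \<longlonglongrightarrow> sqrt (1 / \<beta>)"
    by (simp add: a_def[abs_def] real_sqrt_divide)
  have "convergent (\<lambda>n. scaled_cgf (a n) (d n) (k n) s / real (d n))"
  proof (cases "s = 0")
    case True
    have "convergent (\<lambda>n. a n * (mean_top (d n) (k n) / real (d n)))"
      by (intro convergent_mult convergentI[OF a] mean_top_convergent[OF kd' d \<gamma> \<gamma>0])
    then show ?thesis using True by (simp add: scaled_cgf_def)
  next
    case False
    have "convergent (\<lambda>n. cgf_top (s * a n) (d n) (k n) / real (d n) * (1 / s))"
      using False s \<beta>
      by (intro convergent_mult convergent_const
          cgf_top_convergent_varying[OF kd' d \<gamma> \<gamma>0, of _ "s * sqrt (1 / \<beta>)"] tendsto_intros a) auto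
    then show ?thesis using False by (simp add: scaled_cgf_def mult.commute)
  qed
  then have "convergent (\<lambda>n. scaled_cgf (a n) (d n) (k n) s / real (d n) * (real (d n) / real n))"
    using \<alpha> by (intro convergent_mult) (auto intro: convergentI)
  moreover have "\<forall>\<^sub>F n in sequentially. scaled_cgf (a n) (d n) (k n) s / real (d n) * (real (d n) / real n)
     = scaled_cgf (a n) (d n) (k n) s / real n"
    using kd' by eventually_elim simp
  ultimately show ?thesis
    unfolding a_def by (subst (asm) convergent_cong)
qed

definition objective :: "nat \<Rightarrow> nat \<Rightarrow> nat \<Rightarrow> nat \<Rightarrow> real \<Rightarrow> real" where
  "objective m n k1 k2 c =
    - c / 2 + 1 / c * cgf_top (c / sqrt (real k1)) m k1 + 1 / c * cgf_top (c / sqrt (real k2)) n k2"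

text \<open>Still a quantity at fixed n: the objective at c = s sqrt n divided by sqrt n, with -s /
  2 left out. The division by n is what lets it converge.\<close>

definition limit_objective :: "nat \<Rightarrow> nat \<Rightarrow> nat \<Rightarrow> nat \<Rightarrow> real \<Rightarrow> real" where
  "limit_objective m n k1 k2 s = (scaled_cgf (sqrt (real n) / sqrt (real k1)) m k1 s
    + scaled_cgf (sqrt (real n) / sqrt (real k2)) n k2 s) / real n"

section \<open>The rescaled objective at fixed size\<close>

context
  fixes m n k1 k2 :: nat
  assumes n: "0 < n" and k1: "0 < k1" "k1 \<le> m" and k2: "0 < k2" "k2 \<le> n"
begin

lemma limit_objective_mono: "0 \<le> s \<Longrightarrow> s \<le> t \<Longrightarrow> limit_objective m n k1 k2 s \<le> limit_objective m n k1 k2 t"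
  unfolding limit_objective_def using n k1 k2
  by (intro divide_right_mono add_mono scaled_cgf_mono) auto

text \<open>Each of the two cumulant terms contributes at least s / 2. After subtraction of s / 2
  the objective is thus nonnegative and tends to infinity with s.\<close>

lemma limit_objective_lower:
  assumes "s > 0" shows "s \<le> limit_objective m n k1 k2 s"
proof -
  have "real k1 * (sqrt (real n) / sqrt (real k1))\<^sup>2 * s / 2 + real k2 * (sqrt (real n) / sqrt (real k2))\<^sup>2 * s / 2
     \<le> scaled_cgf (sqrt (real n) / sqrt (real k1)) m k1 s + scaled_cgf (sqrt (real n) / sqrt (real k2)) n k2 s"
    using n k1 k2 assms by (intro add_mono scaled_cgf_lower) auto
  then show ?thesis
    using n k1 k2 by (simp add: limit_objective_def power_divide field_simps)
qed

lemma objective_scaled: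
  assumes "s > 0"
  shows "objective m n k1 k2 (s * sqrt (real n)) = sqrt (real n) * (- s / 2 + limit_objective m n k1 k2 s)"
proof -
  have sn: "sqrt (real n) > 0" "sqrt (real n) * sqrt (real n) = real n" using n by auto
  have "1 / (s * sqrt (real n)) * x = sqrt (real n) * (x / s / real n)" for x
    using sn assms n by (simp add: field_simps)
  then show ?thesis
    using assms unfolding objective_def limit_objective_def scaled_cgf_def
    by (simp add: algebra_simps add_divide_distrib)
qed

lemma bdd_limit_objective: "bdd_below ((\<lambda>s. - s / 2 + limit_objective m n k1 k2 s) ` {0<..})"
proof (rule bdd_belowI2)
  fix s :: real assume "s \<in> {0<..}"
  then show "0 \<le> - s / 2 + limit_objective m n k1 k2 s" using limit_objective_lower[of s] by simp
qed

lemma INF_objective: "(INF c\<in>{0<..}. objective m n k1 k2 c) = sqrt (real n) * (INF s\<in>{0<..}. - s / 2 + limit_objective m n k1 k2 s)"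
proof -
  have "{0<..} = (\<lambda>s. s * sqrt (real n)) ` {0<..}"
  proof (intro set_eqI iffI)
    fix c :: real assume "c \<in> {0<..}"
    then show "c \<in> (\<lambda>s. s * sqrt (real n)) ` {0<..}"
      using n by (intro image_eqI[of _ _ "c / sqrt (real n)"]) auto
  qed (use n in auto)
  then have "(INF c\<in>{0<..}. objective m n k1 k2 c) = (INF s\<in>{0<..}. objective m n k1 k2 (s * sqrt (real n)))"
    by (metis image_image)
  also have "\<dots> = (INF s\<in>{0<..}. sqrt (real n) * (- s / 2 + limit_objective m n k1 k2 s))"
    by (intro INF_cong refl objective_scaled) simp
  also have "\<dots> = sqrt (real n) * (INF s\<in>{0<..}. - s / 2 + limit_objective m n k1 k2 s)"
    using n by (intro mult_INF bdd_limit_objective) auto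
  finally show ?thesis .
qed

lemma INF_limit_objective_le: "(INF s\<in>{0<..}. - s / 2 + limit_objective m n k1 k2 s) \<le> limit_objective m n k1 k2 0"
proof -
  have lim: "((\<lambda>s. - s / 2 + limit_objective m n k1 k2 s) \<longlongrightarrow> - 0 / 2 + limit_objective m n k1 k2 0) (at_right 0)"
    unfolding limit_objective_def using n k1 k2
    by (intro tendsto_intros scaled_cgf_tendsto_0) auto
  have "(INF s\<in>{0<..}. - s / 2 + limit_objective m n k1 k2 s) \<le> - 0 / 2 + limit_objective m n k1 k2 0"
  proof (rule tendsto_lowerbound[OF lim])
    show "\<forall>\<^sub>F s in at_right 0. (INF s\<in>{0<..}. - s / 2 + limit_objective m n k1 k2 s) \<le> - s / 2 + limit_objective m n k1 k2 s"
      using eventually_at_right_less[of 0]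
      by eventually_elim (rule cINF_lower[OF bdd_limit_objective], simp)
  qed simp
  then show ?thesis by simp
qed

end

section \<open>Expectations under the given joint law\<close>

context
  fixes M :: "'a measure" and m n k1 k2 :: nat
    and A :: "nat \<Rightarrow> nat \<Rightarrow> 'a \<Rightarrow> real" and h g :: "nat \<Rightarrow> 'a \<Rightarrow> real"
  assumes n: "0 < n" and k1: "0 < k1" "k1 \<le> m" and k2: "0 < k2" "k2 \<le> n" and M: "prob_space M"
    and A_normal: "\<And>i j. i < m \<Longrightarrow> j < n \<Longrightarrow> distributed M lborel (A i j) std_normal_density"
    and h_normal: "\<And>i. i < m \<Longrightarrow> distributed M lborel (h i) std_normal_density"
    and g_normal: "\<And>j. j < n \<Longrightarrow> distributed M lborel (g j) std_normal_density"
    and indep: "prob_space.indep_vars M (\<lambda>_. borel)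
      (\<lambda>v. case v of Inl (i, j) \<Rightarrow> A i j | Inr (Inl i) \<Rightarrow> h i | Inr (Inr j) \<Rightarrow> g j)
      (({..<m} \<times> {..<n}) <+> ({..<m} <+> {..<n}))"
begin

lemma all_normal:
  assumes "v \<in> ({..<m} \<times> {..<n}) <+> ({..<m} <+> {..<n})"
  shows "distributed M lborel
    (case v of Inl (i, j) \<Rightarrow> A i j | Inr (Inl i) \<Rightarrow> h i | Inr (Inr j) \<Rightarrow> g j) std_normal_density"
  using assms A_normal h_normal g_normal by (auto split: sum.split)

lemma A_law:
  assumes "integrable (gauss ({..<m} \<times> {..<n})) f"
  shows "(\<integral>\<omega>. f (\<lambda>(i, j)\<in>{..<m} \<times> {..<n}. A i j \<omega>) \<partial>M) = (\<integral>w. (f w :: real) \<partial>gauss ({..<m} \<times> {..<n}))"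
  using gauss_law_integral(2)[OF M indep all_normal _ _ assms, of Inl]
  by (auto simp: restrict_def split_beta cong: if_cong)

lemma h_law:
  assumes "integrable (gauss {..<m}) f"
  shows "integrable M (\<lambda>\<omega>. f (\<lambda>i\<in>{..<m}. h i \<omega>) :: real)"
    "(\<integral>\<omega>. f (\<lambda>i\<in>{..<m}. h i \<omega>) \<partial>M) = (\<integral>w. (f w :: real) \<partial>gauss {..<m})"
  using gauss_law_integral[OF M indep all_normal _ _ assms, of "\<lambda>i. Inr (Inl i)"]
  by (auto simp: inj_on_def)

lemma g_law:
  assumes "integrable (gauss {..<n}) f"
  shows "integrable M (\<lambda>\<omega>. f (\<lambda>i\<in>{..<n}. g i \<omega>) :: real)"
    "(\<integral>\<omega>. f (\<lambda>i\<in>{..<n}. g i \<omega>) \<partial>M) = (\<integral>w. (f w :: real) \<partial>gauss {..<n})"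
  using gauss_law_integral[OF M indep all_normal _ _ assms, of "\<lambda>i. Inr (Inr i)"]
  by (auto simp: inj_on_def)

lemma exp_max_selector_h:
  "(\<integral>\<omega>. exp (c * max_selector m k1 (\<lambda>i. h i \<omega>)) \<partial>M) = exp (cgf_top (c / sqrt (real k1)) m k1)"
proof -
  have "(\<integral>\<omega>. exp (c / sqrt (real k1) * topsum m k1 (\<lambda>i\<in>{..<m}. h i \<omega>)) \<partial>M) = exp (cgf_top (c / sqrt (real k1)) m k1)"
    using h_law(2)[OF integrable_exp_topsum[OF k1(2)]] by (simp only: exp_cgf_top[OF k1(2)])
  then show ?thesis by (simp add: max_selector_eq_topsum k1)
qed

lemma exp_max_selector_g:
  "(\<integral>\<omega>. exp (c * max_selector n k2 (\<lambda>i. g i \<omega>)) \<partial>M) = exp (cgf_top (c / sqrt (real k2)) n k2)"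
proof -
  have "(\<integral>\<omega>. exp (c / sqrt (real k2) * topsum n k2 (\<lambda>i\<in>{..<n}. g i \<omega>)) \<partial>M) = exp (cgf_top (c / sqrt (real k2)) n k2)"
    using g_law(2)[OF integrable_exp_topsum[OF k2(2)]] by (simp only: exp_cgf_top[OF k2(2)])
  then show ?thesis by (simp add: max_selector_eq_topsum k2)
qed

lemma lifted_random_dual_eq:
  "lifted_random_dual M m n k1 k2 h g = 1 / sqrt (real k1 * real k2) * (INF c\<in>{0<..}. objective m n k1 k2 c)"
  unfolding lifted_random_dual_def objective_def by (simp add: exp_max_selector_h exp_max_selector_g)

lemma expectation_lifted_random_dual:
  "(\<integral>\<omega>. lifted_random_dual M m n k1 k2 h g * sqrt (real n) \<partial>M)
    = real n / sqrt (real k1 * real k2) * (INF s\<in>{0<..}. - s / 2 + limit_objective m n k1 k2 s)"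
proof -
  interpret prob_space M by (rule M)
  show ?thesis by (simp add: prob_space lifted_random_dual_eq INF_objective[OF n k1 k2])
qed

text \<open>The maximum over the product set splits into two separate maxima, each a rescaled top
  sum, so only their means enter; these are the values of \<open>scaled_cgf\<close> at 0.\<close>

lemma expectation_random_dual:
  "(\<integral>\<omega>. random_dual m n k1 k2 (\<lambda>i. h i \<omega>) (\<lambda>j. g j \<omega>) * sqrt (real n) \<partial>M)
    = real n / sqrt (real k1 * real k2) * limit_objective m n k1 k2 0"
proof -
  have eq: "random_dual m n k1 k2 v w = 1 / sqrt (real k1 * real k2) *
    (topsum m k1 v / sqrt (real k1) + topsum n k2 w / sqrt (real k2))" for v w
  proof -
    have "random_dual m n k1 k2 v w = 1 / sqrt (real k1 * real k2) *
      Max ((\<lambda>(x, y). (\<Sum>j<n. w j * x j) + (\<Sum>i<m. v i * y i)) ` (selector_vecs n k2 \<times> selector_vecs m k1))"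
      by (simp add: random_dual_def add.commute)
    also have "\<dots> = 1 / sqrt (real k1 * real k2) * (max_selector n k2 w + max_selector m k1 v)"
      using k1 k2 by (subst Max_add_Times) (auto simp: finite_selector_vecs selector_vecs_nonempty max_selector_def)
    finally show ?thesis using k1 k2 by (simp add: max_selector_eq_topsum add.commute)
  qed
  note H = h_law[OF integrable_topsum[OF k1(2)], simplified] and G = g_law[OF integrable_topsum[OF k2(2)], simplified]
  have "(\<integral>\<omega>. random_dual m n k1 k2 (\<lambda>i. h i \<omega>) (\<lambda>j. g j \<omega>) * sqrt (real n) \<partial>M)
    = 1 / sqrt (real k1 * real k2) * (mean_top m k1 / sqrt (real k1) + mean_top n k2 / sqrt (real k2)) * sqrt (real n)"
    unfolding eq using H G by (simp add: mean_top_def)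
  also have "\<dots> = real n / sqrt (real k1 * real k2) * limit_objective m n k1 k2 0"
  proof -
    have "real n / sqrt (real k1 * real k2) * (x / real n) = x / sqrt (real k1 * real k2)" for x
      using n by simp
    from this show ?thesis
      unfolding limit_objective_def by (simp only:) (simp add: scaled_cgf_def algebra_simps add_divide_distrib)
  qed
  finally show ?thesis .
qed

lemma largest_avg_submatrix_le:
  "(\<integral>\<omega>. largest_avg_submatrix m n k1 k2 (\<lambda>i j. A i j \<omega>) * sqrt (real n) \<partial>M)
    \<le> (\<integral>\<omega>. lifted_random_dual M m n k1 k2 h g * sqrt (real n) \<partial>M)"
proof -
  interpret prob_space M by (rule M)
  let ?X = "selector_vecs n k2" and ?Y = "selector_vecs m k1" and ?I = "{..<m} \<times> {..<n}"
  define B where "B w = Max ((\<lambda>(x, y). \<Sum>i<m. \<Sum>j<n. y i * w (i, j) * x j) ` (?X \<times> ?Y))" for w :: "nat \<times> nat \<Rightarrow> real"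
  have S: "finite (?X \<times> ?Y)" "?X \<times> ?Y \<noteq> {}"
    using k1 k2 by (auto simp: finite_selector_vecs selector_vecs_nonempty)
  have B: "B w = Max (lin ?I (\<lambda>(x, y) (i, j). y i * x j) w ` (?X \<times> ?Y))" for w
    unfolding B_def lin_def
    by (intro arg_cong[where f=Max] image_cong refl) (auto simp: sum.cartesian_product mult_ac intro!: sum.cong)
  have iB: "integrable (gauss ?I) (\<lambda>w. exp (c * B w))" for c
    unfolding B by (rule integrable_exp_Max_lin[OF S]) simp
  \<comment> \<open>The elementary bound |x| <= exp x + exp (-x) reduces integrability to the
    exponential moments at 1 and -1.\<close>
  have iB1: "integrable (gauss ?I) B"
  proof (rule Bochner_Integration.integrable_bound)
    show "integrable (gauss ?I) (\<lambda>w. exp (1 * B w) + exp (- 1 * B w))"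
      by (intro Bochner_Integration.integrable_add iB)
    show "B \<in> borel_measurable (gauss ?I)"
      unfolding B[abs_def] using S by measurable
    have "\<bar>x\<bar> \<le> \<bar>exp x + exp (- x)\<bar>" for x :: real
      using exp_ge_add_one_self[of x] exp_ge_add_one_self[of "- x"] exp_gt_zero[of x] exp_gt_zero[of "- x"] by linarith
    then show "AE w in gauss ?I. norm (B w) \<le> norm (exp (1 * B w) + exp (- 1 * B w))"
      by (intro AE_I2) simp
  qed
  have "largest_avg_submatrix m n k1 k2 (\<lambda>i j. A i j \<omega>) = 1 / sqrt (real k1 * real k2) * B (\<lambda>(i, j)\<in>?I. A i j \<omega>)" for \<omega>
    unfolding largest_avg_submatrix_eq[OF k1 k2] B_def
    by (intro arg_cong2[where f="(*)"] arg_cong[where f=Max] image_cong refl) (auto intro!: sum.cong)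
  then have "(\<integral>\<omega>. largest_avg_submatrix m n k1 k2 (\<lambda>i j. A i j \<omega>) * sqrt (real n) \<partial>M)
    = 1 / sqrt (real k1 * real k2) * (\<integral>w. B w \<partial>gauss ?I) * sqrt (real n)"
    using A_law[OF iB1] by simp
  also have "\<dots> \<le> 1 / sqrt (real k1 * real k2) * (INF c\<in>{0<..}. objective m n k1 k2 c) * sqrt (real n)"
  proof (intro mult_right_mono mult_left_mono)
    show "(\<integral>w. B w \<partial>gauss ?I) \<le> (INF c\<in>{0<..}. objective m n k1 k2 c)"
    proof (rule cINF_greatest)
      fix c :: real assume "c \<in> {0<..}"
      then have c: "c > 0" by simp
      have P: "(\<integral>w. exp (c * Max ((\<lambda>y. \<Sum>i<m. w i * y i) ` ?Y)) \<partial>gauss {..<m}) = exp (cgf_top (c / sqrt (real k1)) m k1)"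
        using k1 by (simp add: max_selector_def[symmetric] max_selector_eq_topsum exp_cgf_top)
      have Q: "(\<integral>w. exp (c * Max ((\<lambda>x. \<Sum>j<n. w j * x j) ` ?X)) \<partial>gauss {..<n}) = exp (cgf_top (c / sqrt (real k2)) n k2)"
        using k2 by (simp add: max_selector_def[symmetric] max_selector_eq_topsum exp_cgf_top)
      have "exp (c\<^sup>2 / 2) * (\<integral>w. exp (c * B w) \<partial>gauss ?I)
        \<le> exp (cgf_top (c / sqrt (real k1)) m k1) * exp (cgf_top (c / sqrt (real k2)) n k2)"
        unfolding B_def P[symmetric] Q[symmetric]
        using k1 k2 by (intro chevet_exp c) (auto simp: finite_selector_vecs selector_vecs_nonempty selector_vecs_norm)
      moreover note J = exp_expectation_le[OF prob_space_gauss iB1 iB[of c]]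
      have "exp (c * (\<integral>w. B w \<partial>gauss ?I)) \<le> (\<integral>w. exp (c * B w) \<partial>gauss ?I)"
        using J by (simp add: ln_ge_iff)
      ultimately have "exp (c\<^sup>2 / 2) * exp (c * (\<integral>w. B w \<partial>gauss ?I))
        \<le> exp (cgf_top (c / sqrt (real k1)) m k1) * exp (cgf_top (c / sqrt (real k2)) n k2)"
        by (meson exp_ge_zero mult_left_mono order_trans)
      then have "c\<^sup>2 / 2 + c * (\<integral>w. B w \<partial>gauss ?I)
        \<le> cgf_top (c / sqrt (real k1)) m k1 + cgf_top (c / sqrt (real k2)) n k2"
        by (simp add: mult_exp_exp)
      \<comment> \<open>Division by c turns the surplus c^2 / 2 on the left into the term -c / 2 of
        the objective.\<close>
      then show "(\<integral>w. B w \<partial>gauss ?I) \<le> objective m n k1 k2 c"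
        using c unfolding objective_def by (simp add: field_simps power2_eq_square)
    qed simp
  qed auto
  also have "\<dots> = (\<integral>\<omega>. lifted_random_dual M m n k1 k2 h g * sqrt (real n) \<partial>M)"
    by (simp add: prob_space lifted_random_dual_eq)
  finally show ?thesis .
qed

end

text \<open>Both inequalities already hold for every positive n, so what remains is convergence: the
  common prefactor and the rescaled infimum, or its endpoint at s = 0, converge separately. The
  submatrix value enters through its upper limit, which is its limit whenever that exists.\<close>

theorem theorem4:
  fixes M :: "nat \<Rightarrow> 'a measure"
    and m k1 k2 :: "nat \<Rightarrow> nat"
    and \<alpha> \<beta>1 \<beta>2 :: real
    and A :: "nat \<Rightarrow> nat \<Rightarrow> nat \<Rightarrow> 'a \<Rightarrow> real"
    and h g :: "nat \<Rightarrow> nat \<Rightarrow> 'a \<Rightarrow> real"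
  assumes k1: "\<And>n. n > 0 \<Longrightarrow> 0 < k1 n \<and> k1 n \<le> m n"
    and k2: "\<And>n. n > 0 \<Longrightarrow> 0 < k2 n \<and> k2 n \<le> n"
    and \<alpha>: "(\<lambda>n. real (m n) / real n) \<longlonglongrightarrow> \<alpha>" "\<alpha> > 0"
    and \<beta>1: "(\<lambda>n. real (k1 n) / real n) \<longlonglongrightarrow> \<beta>1" "\<beta>1 > 0"
    and \<beta>2: "(\<lambda>n. real (k2 n) / real n) \<longlonglongrightarrow> \<beta>2" "\<beta>2 > 0"
    and M: "\<And>n. n > 0 \<Longrightarrow> prob_space (M n)"
    and A_normal: "\<And>n i j. n > 0 \<Longrightarrow> i < m n \<Longrightarrow> j < n \<Longrightarrow>
          distributed (M n) lborel (A n i j) std_normal_density"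
    and h_normal: "\<And>n i. n > 0 \<Longrightarrow> i < m n \<Longrightarrow>
          distributed (M n) lborel (h n i) std_normal_density"
    and g_normal: "\<And>n j. n > 0 \<Longrightarrow> j < n \<Longrightarrow>
          distributed (M n) lborel (g n j) std_normal_density"
    and indep: "\<And>n. n > 0 \<Longrightarrow>
          prob_space.indep_vars (M n) (\<lambda>_. borel)
            (\<lambda>v. case v of Inl (i, j) \<Rightarrow> A n i j | Inr (Inl i) \<Rightarrow> h n i | Inr (Inr j) \<Rightarrow> g n j)
            (({..<m n} \<times> {..<n}) <+> ({..<m n} <+> {..<n}))"
  defines "E\<xi> \<equiv> (\<lambda>n. LINT \<omega>|M n.
          largest_avg_submatrix (m n) n (k1 n) (k2 n) (\<lambda>i j. A n i j \<omega>) * sqrt (real n))"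
    and "EL2 \<equiv> (\<lambda>n. LINT \<omega>|M n.
          lifted_random_dual (M n) (m n) n (k1 n) (k2 n) (h n) (g n) * sqrt (real n))"
    and "EL \<equiv> (\<lambda>n. LINT \<omega>|M n.
          random_dual (m n) n (k1 n) (k2 n) (\<lambda>i. h n i \<omega>) (\<lambda>j. g n j \<omega>) * sqrt (real n))"
  shows "convergent EL2 \<and> convergent EL \<and>
    limsup (\<lambda>n. ereal (E\<xi> n)) \<le> ereal (lim EL2) \<and> lim EL2 \<le> lim EL"
proof -
  define G where "G n = limit_objective (m n) n (k1 n) (k2 n)" for n
  define I where "I n = (INF s\<in>{0<..}. - s / 2 + G n s)" for n
  \<comment> \<open>The prefactor after one sqrt n from the normalisation meets the other from the
    rescaled objective; it tends to 1 / sqrt (\<beta>1 \<beta>2).\<close>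
  define r where "r n = real n / sqrt (real (k1 n) * real (k2 n))" for n
  have k1': "0 < k1 n" "k1 n \<le> m n" and k2': "0 < k2 n" "k2 n \<le> n" if "n > 0" for n
    using k1[OF that] k2[OF that] by auto
  have EL2: "EL2 n = r n * I n" if n: "n > 0" for n
    unfolding EL2_def r_def I_def G_def
    by (rule expectation_lifted_random_dual[OF n k1'[OF n] k2'[OF n] M[OF n] A_normal[OF n] h_normal[OF n] g_normal[OF n] indep[OF n]])
  have EL: "EL n = r n * G n 0" if n: "n > 0" for n
    unfolding EL_def r_def G_def
    by (rule expectation_random_dual[OF n k1'[OF n] k2'[OF n] M[OF n] A_normal[OF n] h_normal[OF n] g_normal[OF n] indep[OF n]])
  have E\<xi>: "E\<xi> n \<le> EL2 n" if n: "n > 0" for n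
    unfolding E\<xi>_def EL2_def
    by (rule largest_avg_submatrix_le[OF n k1'[OF n] k2'[OF n] M[OF n] A_normal[OF n] h_normal[OF n] g_normal[OF n] indep[OF n]])
  have n0: "\<forall>\<^sub>F n::nat in sequentially. n > 0" by (rule eventually_gt_at_top)
  have IG: "I n \<le> G n 0" if n: "n > 0" for n
    unfolding I_def G_def by (rule INF_limit_objective_le[OF n k1'[OF n] k2'[OF n]])
  have conv_G: "convergent (\<lambda>n. G n s)" if s: "s \<ge> 0" for s
  proof -
    have 1: "\<forall>\<^sub>F n in sequentially. 0 < k1 n \<and> k1 n \<le> m n"
      using n0 by eventually_elim (rule k1)
    have 2: "\<forall>\<^sub>F n in sequentially. 0 < k2 n \<and> k2 n \<le> n"
      using n0 by eventually_elim (rule k2)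
    \<comment> \<open>The vector g has dimension n itself, so its limiting ratio is 1.\<close>
    have "(\<lambda>n. real n / real n) \<longlonglongrightarrow> 1"
      by (rule tendsto_eventually) (use n0 in \<open>auto elim: eventually_mono\<close>)
    from convergent_add[OF scaled_cgf_convergent[OF 1 \<alpha> \<beta>1 s] scaled_cgf_convergent[OF 2 this zero_less_one \<beta>2 s]]
    show ?thesis
      by (simp add: G_def limit_objective_def add_divide_distrib)
  qed
  have conv_I: "convergent I"
    unfolding I_def
  proof (rule convergent_INF[OF _ _ _ conv_G])
    show "\<forall>\<^sub>F n in sequentially. \<forall>s\<ge>0. \<forall>t\<ge>s. G n s \<le> G n t"
      using n0 by eventually_elim (auto simp: G_def intro!: limit_objective_mono k1' k2')
    show "\<forall>\<^sub>F n in sequentially. \<forall>s>0. s \<le> G n s"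
      using n0 by eventually_elim (auto simp: G_def intro!: limit_objective_lower k1' k2')
    show "\<forall>\<^sub>F n in sequentially. (INF s\<in>{0<..}. - s / 2 + G n s) \<le> G n 0"
      using n0 by eventually_elim (use IG in \<open>auto simp: I_def\<close>)
  qed
  have conv_r: "convergent r"
  proof (rule convergentI)
    have "(\<lambda>n. 1 / sqrt (real (k1 n) / real n * (real (k2 n) / real n))) \<longlonglongrightarrow> 1 / sqrt (\<beta>1 * \<beta>2)"
      using \<beta>1 \<beta>2 by (intro tendsto_intros) auto
    moreover have "\<forall>\<^sub>F n in sequentially. 1 / sqrt (real (k1 n) / real n * (real (k2 n) / real n)) = r n"
      using n0 by eventually_elim (simp add: r_def real_sqrt_mult real_sqrt_divide)
    ultimately show "r \<longlonglongrightarrow> 1 / sqrt (\<beta>1 * \<beta>2)"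
      by (rule Lim_transform_eventually)
  qed
  have c2: "convergent EL2"
    using convergent_mult[OF conv_r conv_I]
    by (rule iffD1[OF convergent_cong, rotated]) (use n0 in \<open>eventually_elim, simp add: EL2\<close>)
  have c1: "convergent EL"
    using convergent_mult[OF conv_r conv_G[of 0, simplified]]
    by (rule iffD1[OF convergent_cong, rotated]) (use n0 in \<open>eventually_elim, simp add: EL\<close>)
  have L2: "EL2 \<longlonglongrightarrow> lim EL2" and L1: "EL \<longlonglongrightarrow> lim EL"
    using c1 c2 by (auto simp: convergent_LIMSEQ_iff)
  have "limsup (\<lambda>n. ereal (E\<xi> n)) \<le> limsup (\<lambda>n. ereal (EL2 n))"
    by (rule Limsup_mono) (use n0 in \<open>eventually_elim, simp add: E\<xi>\<close>)
  also have "\<dots> = ereal (lim EL2)"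
    by (rule lim_imp_Limsup) (use L2 in auto)
  finally have "limsup (\<lambda>n. ereal (E\<xi> n)) \<le> ereal (lim EL2)" .
  moreover have "lim EL2 \<le> lim EL"
  proof (rule tendsto_le[OF _ L1 L2])
    show "\<forall>\<^sub>F n in sequentially. EL2 n \<le> EL n"
      using n0
    proof eventually_elim
      case (elim n)
      have "r n * I n \<le> r n * G n 0"
        by (rule mult_left_mono[OF IG[OF elim]]) (simp add: r_def)
      then show ?case by (simp add: EL EL2 elim)
    qed
  qed simp
  ultimately show ?thesis using c1 c2 by blast
qed

end
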